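(* (Extension Lemma.) Let $n\in\mathbb N$, let $\alpha$ be a finitely generated s-tensor norm of order $n$, let $E$ be a normed space and let $p\in(\widetilde\otimes^{n,s}_\alpha E)'$ be a polynomial. Then the Aron-Berner extension $AB(p)$ of $p$ to the bidual $E''$ belongs to $(\widetilde\otimes^{n,s}_\alpha E'')'$ and $$\|p\|_{(\widetilde\otimes^{n,s}_\alpha E)'}=\|AB(p)\|_{(\widetilde\otimes^{n,s}_\alpha E'')'}.$$
   Context: Normed spaces are over $\mathbb K=\mathbb R$ or $\mathbb C$. $FIN(E)$ is the set of finite dimensional subspaces of $E$; $\mathcal L(E,F)$ is the space of continuous linear operators. $\otimes^{n,s}E$ is the linear span in $\otimes^nE$ of the elements $\otimes^n x=x\otimes\cdots\otimes x$, $x\in E$. For $T\in\mathcal L(E,F)$, $\otimes^{n,s}T:\otimes^{n,s}E\to\otimes^{n,s}F$ is the linear map with $\otimes^n x\mapsto\otimes^n(Tx)$. For $z\in\otimes^{n,s}E$: $\pi_s(z)=\inf\{\sum_j|\lambda_j|\|x_j\|^n\}$ over all representations $z=\sum_{j=1}^r\lambda_j\otimes^n x_j$, and $\varepsilon_s(z)=\sup_{x'\in B_{E'}}|\sum_j\lambda_j x'(x_j)^n|$ for any such representation. An s-tensor norm $\alpha$ of order $n$ assigns to each normed space $E$ a norm $\alpha(\,\cdot\,;\otimes^{n,s}E)$ on $\otimes^{n,s}E$ such that (1) $\varepsilon_s\le\alpha\le\pi_s$ and (2) $\|\otimes^{n,s}T:\otimes^{n,s}_\alpha E\to\otimes^{n,s}_\alpha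 F\|\le\|T\|^n$ for all $T\in\mathcal L(E,F)$. $\otimes^{n,s}_\alpha E$ is $\otimes^{n,s}E$ with this norm and $\widetilde\otimes^{n,s}_\alpha E$ its completion. $\alpha$ is finitely generated if $\alpha(z;\otimes^{n,s}E)=\inf\{\alpha(z;\otimes^{n,s}M):M\in FIN(E),\ z\in\otimes^{n,s}M\}$ for every normed $E$ and $z\in\otimes^{n,s}E$. A continuous $n$-homogeneous polynomial $p$ on $E$ is $p(x)=A(x,\dots,x)$ with $A$ a continuous symmetric $n$-linear form; it is identified with the linear functional on $\otimes^{n,s}E$ given by $\otimes^n x\mapsto p(x)$. Since $\alpha\le\pi_s$, every element of $(\widetilde\otimes^{n,s}_\alpha E)'$ is in this way a continuous $n$-homogeneous polynomial on $E$; $\|p\|_{(\widetilde\otimes^{n,s}_\alpha E)'}$ is its norm as a functional. "$p\in(\widetilde\otimes^{n,s}_\alpha E)'$" means that the associated functional is $\alpha$-continuous. Aron-Berner extension: let $\overline A:(E'')^n\to\mathbb K$ be the iterated extension $\overline A(x_1'',\dots,x_n'')=\lim_{\alpha_1}\cdots\lim_{\alpha_n}A(x^{(1)}_{\alpha_1},\dots,x^{(n)}_{\alpha_n})$, where $(x^{(j)}_{\alpha_j})$ is a net in $E$ converging weak-star to $x_j''$. Then $AB(p)(x'')=\overline A(x'',\dots,x'')$, a continuous $n$-homogeneous polynomial on $E''$. *)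

theory Defs
  imports "HOL-Analysis.Analysis" "HOL-Library.Function_Algebras" "HOL-Library.Multiset"
begin

section \<open>Scalars\<close>

text \<open>The scalar field is the real or the complex field. In the real case the norm is determined by
  \<open>norm (r *\<^sub>R 1) = \<bar>r\<bar>\<close>.\<close>

class real_or_complex = real_normed_field +
  assumes real_or_complex:
    "(\<forall>x. \<exists>r. x = r *\<^sub>R 1) \<or>
     (\<exists>j. j * j = - 1 \<and> (\<forall>x. \<exists>a b. x = a *\<^sub>R 1 + b *\<^sub>R j \<and> norm x = sqrt (a\<^sup>2 + b\<^sup>2)))"

instance real :: real_or_complex
  by standard simp

instance complex :: real_or_complex
proof
  have "x = Re x *\<^sub>R 1 + Im x *\<^sub>R \<i> \<and> norm x = sqrt ((Re x)\<^sup>2 + (Im x)\<^sup>2)" for x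
    by (simp add: complex_eq_iff cmod_def)
  then show "(\<forall>x::complex. \<exists>r. x = r *\<^sub>R 1) \<or>
     (\<exists>j::complex. j * j = - 1 \<and> (\<forall>x. \<exists>a b. x = a *\<^sub>R 1 + b *\<^sub>R j \<and> norm x = sqrt (a\<^sup>2 + b\<^sup>2)))"
    by (metis i_squared)
qed


section \<open>Normed spaces\<close>

text \<open>A normed space is carried by a linear subspace of an ambient vector space; the values of
  \<open>nrm\<close> outside the carrier are irrelevant.\<close>

record ('k, 'v) nspace =
  carrier :: "'v set"
  smult :: "'k \<Rightarrow> 'v \<Rightarrow> 'v"
  nrm :: "'v \<Rightarrow> real"

definition normed_space :: "('k::real_or_complex, 'v::ab_group_add) nspace \<Rightarrow> bool" where
  "normed_space X \<longleftrightarrow>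
     vector_space (smult X) \<and> module.subspace (smult X) (carrier X) \<and>
     (\<forall>x\<in>carrier X. 0 \<le> nrm X x \<and> (nrm X x = 0 \<longleftrightarrow> x = 0)) \<and>
     (\<forall>x\<in>carrier X. \<forall>y\<in>carrier X. nrm X (x + y) \<le> nrm X x + nrm X y) \<and>
     (\<forall>c. \<forall>x\<in>carrier X. nrm X (smult X c x) = norm c * nrm X x)"

definition linear_on :: "('k, 'v::ab_group_add) nspace \<Rightarrow> ('k, 'w::ab_group_add) nspace \<Rightarrow> ('v \<Rightarrow> 'w) \<Rightarrow> bool" where
  "linear_on X Y T \<longleftrightarrow>
     T ` carrier X \<subseteq> carrier Y \<and>
     (\<forall>x\<in>carrier X. \<forall>y\<in>carrier X. T (x + y) = T x + T y) \<and>
     (\<forall>c. \<forall>x\<in>carrier X. T (smult X c x) = smult Y c (T x))"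

definition bounded_linear_on :: "('k, 'v::ab_group_add) nspace \<Rightarrow> ('k, 'w::ab_group_add) nspace \<Rightarrow> ('v \<Rightarrow> 'w) \<Rightarrow> bool" where
  "bounded_linear_on X Y T \<longleftrightarrow>
     linear_on X Y T \<and> (\<exists>C. \<forall>x\<in>carrier X. nrm Y (T x) \<le> C * nrm X x)"

definition opnorm :: "('k, 'v) nspace \<Rightarrow> ('k, 'w) nspace \<Rightarrow> ('v \<Rightarrow> 'w) \<Rightarrow> real" where
  "opnorm X Y T = Sup {nrm Y (T x) | x. x \<in> carrier X \<and> nrm X x \<le> 1}"

definition isometric_iso :: "('k, 'v::ab_group_add) nspace \<Rightarrow> ('k, 'w::ab_group_add) nspace \<Rightarrow> ('v \<Rightarrow> 'w) \<Rightarrow> bool" where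
  "isometric_iso X Y T \<longleftrightarrow>
     linear_on X Y T \<and> T ` carrier X = carrier Y \<and> (\<forall>x\<in>carrier X. nrm Y (T x) = nrm X x)"

text \<open>\<open>FIN X M\<close>: \<open>M\<close> is a finite dimensional linear subspace of \<open>X\<close>; as a normed space it is
  \<open>X\<lparr>carrier := M\<rparr>\<close>.\<close>

definition FIN :: "('k::real_or_complex, 'v::ab_group_add) nspace \<Rightarrow> 'v set \<Rightarrow> bool" where
  "FIN X M \<longleftrightarrow> M \<subseteq> carrier X \<and> (\<exists>B. finite B \<and> M = module.span (smult X) B)"

definition fscale :: "'k \<Rightarrow> ('x \<Rightarrow> 'k) \<Rightarrow> 'x \<Rightarrow> 'k::real_or_complex" where
  "fscale c f = (\<lambda>x. c * f x)"

definition scalars :: "('k::real_or_complex, 'k) nspace" where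
  "scalars = \<lparr>carrier = UNIV, smult = (*), nrm = norm\<rparr>"

text \<open>Functionals are normalised to vanish outside the carrier, so that equal functionals are equal
  functions.\<close>

definition dual :: "('k::real_or_complex, 'v::ab_group_add) nspace \<Rightarrow> ('k, 'v \<Rightarrow> 'k) nspace" where
  "dual X = \<lparr>carrier = {\<phi>. bounded_linear_on X scalars \<phi> \<and> (\<forall>x. x \<notin> carrier X \<longrightarrow> \<phi> x = 0)},
             smult = fscale, nrm = opnorm X scalars\<rparr>"

definition bidual :: "('k::real_or_complex, 'v::ab_group_add) nspace \<Rightarrow> ('k, ('v \<Rightarrow> 'k) \<Rightarrow> 'k) nspace" where
  "bidual X = dual (dual X)"


section \<open>Multilinear forms and symmetric tensors\<close>

definition multilinear_form :: "nat \<Rightarrow> ('k::real_or_complex, 'v::ab_group_add) nspace \<Rightarrow> ('v list \<Rightarrow> 'k) \<Rightarrow> bool" where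
  "multilinear_form n X A \<longleftrightarrow>
     (\<forall>xs\<in>lists (carrier X). length xs = n \<longrightarrow> (\<forall>i<n. \<forall>x\<in>carrier X. \<forall>y\<in>carrier X. \<forall>c.
        A (xs[i := x + y]) = A (xs[i := x]) + A (xs[i := y]) \<and>
        A (xs[i := smult X c x]) = c * A (xs[i := x])))"

definition cont_sym_form :: "nat \<Rightarrow> ('k::real_or_complex, 'v::ab_group_add) nspace \<Rightarrow> ('v list \<Rightarrow> 'k) \<Rightarrow> bool" where
  "cont_sym_form n X A \<longleftrightarrow>
     multilinear_form n X A \<and>
     (\<forall>xs\<in>lists (carrier X). \<forall>ys. length xs = n \<and> mset ys = mset xs \<longrightarrow> A ys = A xs) \<and>
     (\<exists>C. \<forall>xs\<in>lists (carrier X). length xs = n \<longrightarrow> norm (A xs) \<le> C * prod_list (map (nrm X) xs))"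

definition cont_polynomial :: "nat \<Rightarrow> ('k::real_or_complex, 'v::ab_group_add) nspace \<Rightarrow> ('v \<Rightarrow> 'k) \<Rightarrow> bool" where
  "cont_polynomial n X p \<longleftrightarrow> (\<exists>A. cont_sym_form n X A \<and> (\<forall>x\<in>carrier X. p x = A (replicate n x)))"

text \<open>The algebraic tensor product \<open>\<otimes>\<^sup>n X\<close> is realised inside the space of functionals on the
  \<open>n\<close>-linear forms of \<open>X\<close>: the elementary tensor \<open>x\<^sub>1 \<otimes> \<dots> \<otimes> x\<^sub>n\<close> is evaluation at
  \<open>[x\<^sub>1, \<dots>, x\<^sub>n]\<close>. Since all (also discontinuous) forms are admitted and they separate the points
  of the algebraic tensor product, no tensors are identified beyond the multilinear relations.\<close>

type_synonym ('k, 'v) tensor = "('v list \<Rightarrow> 'k) \<Rightarrow> 'k"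

definition elem_tensor :: "nat \<Rightarrow> ('k::real_or_complex, 'v::ab_group_add) nspace \<Rightarrow> 'v list \<Rightarrow> ('k, 'v) tensor" where
  "elem_tensor n X xs = (\<lambda>A. if multilinear_form n X A then A xs else 0)"

definition tensor_power :: "nat \<Rightarrow> ('k::real_or_complex, 'v::ab_group_add) nspace \<Rightarrow> 'v \<Rightarrow> ('k, 'v) tensor" where
  "tensor_power n X x = elem_tensor n X (replicate n x)"

definition sym_tensors :: "nat \<Rightarrow> ('k::real_or_complex, 'v::ab_group_add) nspace \<Rightarrow> ('k, 'v) tensor set" where
  "sym_tensors n X = module.span fscale (tensor_power n X ` carrier X)"

text \<open>\<open>represents n X r z\<close>: the list \<open>r\<close> of pairs \<open>(\<lambda>\<^sub>j, x\<^sub>j)\<close> gives a representation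
  \<open>z = \<Sum>\<^sub>j \<lambda>\<^sub>j \<otimes>\<^sup>n x\<^sub>j\<close>.\<close>

definition represents :: "nat \<Rightarrow> ('k::real_or_complex, 'v::ab_group_add) nspace \<Rightarrow> ('k \<times> 'v) list \<Rightarrow> ('k, 'v) tensor \<Rightarrow> bool" where
  "represents n X r z \<longleftrightarrow>
     snd ` set r \<subseteq> carrier X \<and> z = (\<Sum>(c, x)\<leftarrow>r. fscale c (tensor_power n X x))"

definition pi_s :: "nat \<Rightarrow> ('k::real_or_complex, 'v::ab_group_add) nspace \<Rightarrow> ('k, 'v) tensor \<Rightarrow> real" where
  "pi_s n X z = Inf {\<Sum>(c, x)\<leftarrow>r. norm c * nrm X x ^ n | r. represents n X r z}"

definition eps_s :: "nat \<Rightarrow> ('k::real_or_complex, 'v::ab_group_add) nspace \<Rightarrow> ('k, 'v) tensor \<Rightarrow> real" where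
  "eps_s n X z = Sup {norm (\<Sum>(c, x)\<leftarrow>r. c * \<phi> x ^ n) | r \<phi>.
     represents n X r z \<and> \<phi> \<in> carrier (dual X) \<and> nrm (dual X) \<phi> \<le> 1}"

text \<open>The linear map \<open>\<otimes>\<^sup>n T\<close>, which sends \<open>x\<^sub>1 \<otimes> \<dots> \<otimes> x\<^sub>n\<close> to \<open>T x\<^sub>1 \<otimes> \<dots> \<otimes> T x\<^sub>n\<close>,
  is the transpose of the pullback of forms along \<open>T\<close>. For \<open>T = id\<close> and \<open>X\<close> a subspace of \<open>Y\<close> it is
  the natural inclusion of the tensors on \<open>X\<close> into the tensors on \<open>Y\<close>.\<close>

definition tensor_map :: "nat \<Rightarrow> ('k::real_or_complex, 'w::ab_group_add) nspace \<Rightarrow> ('v \<Rightarrow> 'w) \<Rightarrow> ('k, 'v) tensor \<Rightarrow> ('k, 'w) tensor" where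
  "tensor_map n Y T z = (\<lambda>B. if multilinear_form n Y B then z (\<lambda>xs. B (map T xs)) else 0)"

text \<open>The linear functional on the symmetric tensors with \<open>\<otimes>\<^sup>n x \<mapsto> p x\<close>, zero elsewhere.\<close>

definition lin_functional :: "nat \<Rightarrow> ('k::real_or_complex, 'v::ab_group_add) nspace \<Rightarrow> ('v \<Rightarrow> 'k) \<Rightarrow> ('k, 'v) tensor \<Rightarrow> 'k" where
  "lin_functional n X p z =
     (if z \<in> sym_tensors n X
      then THE v. \<exists>r. represents n X r z \<and> v = (\<Sum>(c, x)\<leftarrow>r. c * p x)
      else 0)"


section \<open>Tensor norms\<close>

text \<open>An assignment \<open>\<alpha>\<close> of functions on tensors to all normed spaces carried by subsets of a type \<open>'u\<close>.
  There is no type of all normed spaces, so \<open>'u\<close> plays the role of a universe; it is arbitrary.\<close>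

type_synonym ('k, 'u) tnorm = "('k, 'u) nspace \<Rightarrow> ('k, 'u) tensor \<Rightarrow> real"

definition tensor_space :: "nat \<Rightarrow> ('k::real_or_complex, 'u::ab_group_add) tnorm \<Rightarrow> ('k, 'u) nspace \<Rightarrow> ('k, ('k, 'u) tensor) nspace" where
  "tensor_space n \<alpha> X = \<lparr>carrier = sym_tensors n X, smult = fscale, nrm = \<alpha> X\<rparr>"

definition s_tensor_norm :: "nat \<Rightarrow> ('k::real_or_complex, 'u::ab_group_add) tnorm \<Rightarrow> bool" where
  "s_tensor_norm n \<alpha> \<longleftrightarrow>
     (\<forall>X. normed_space X \<longrightarrow>
        normed_space (tensor_space n \<alpha> X) \<and>
        (\<forall>z\<in>sym_tensors n X. eps_s n X z \<le> \<alpha> X z \<and> \<alpha> X z \<le> pi_s n X z)) \<and>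
     (\<forall>X Y T. normed_space X \<and> normed_space Y \<and> bounded_linear_on X Y T \<longrightarrow>
        bounded_linear_on (tensor_space n \<alpha> X) (tensor_space n \<alpha> Y) (tensor_map n Y T) \<and>
        opnorm (tensor_space n \<alpha> X) (tensor_space n \<alpha> Y) (tensor_map n Y T) \<le> opnorm X Y T ^ n)"

definition finitely_generated :: "nat \<Rightarrow> ('k::real_or_complex, 'u::ab_group_add) tnorm \<Rightarrow> bool" where
  "finitely_generated n \<alpha> \<longleftrightarrow>
     (\<forall>X. normed_space X \<longrightarrow> (\<forall>z\<in>sym_tensors n X.
        \<alpha> X z = Inf {\<alpha> (X\<lparr>carrier := M\<rparr>) w | M w.
          FIN X M \<and> w \<in> sym_tensors n (X\<lparr>carrier := M\<rparr>) \<and> tensor_map n X id w = z}))"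

text \<open>The dual of a normed space and that of its completion are identified isometrically, so the
  completion of \<open>tensor_space n \<alpha> X\<close> does not appear. Elements of the dual are regarded as
  polynomials.\<close>

definition tensor_dual :: "nat \<Rightarrow> ('k::real_or_complex, 'u::ab_group_add) tnorm \<Rightarrow> ('k, 'u) nspace \<Rightarrow> ('u \<Rightarrow> 'k) set" where
  "tensor_dual n \<alpha> X =
     {p. cont_polynomial n X p \<and> lin_functional n X p \<in> carrier (dual (tensor_space n \<alpha> X))}"

definition tensor_dual_norm :: "nat \<Rightarrow> ('k::real_or_complex, 'u::ab_group_add) tnorm \<Rightarrow> ('k, 'u) nspace \<Rightarrow> ('u \<Rightarrow> 'k) \<Rightarrow> real" where
  "tensor_dual_norm n \<alpha> X p = nrm (dual (tensor_space n \<alpha> X)) (lin_functional n X p)"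


section \<open>Aron-Berner extension\<close>

text \<open>The coarsest filter on \<open>X\<close> that converges weak-star to \<open>x''\<close>: a net in \<open>X\<close> converges weak-star
  to \<open>x''\<close> iff its filter of tails is finer than this one, so a limit along this filter is the limit
  along every such net. The filter is proper since \<open>X\<close> is weak-star dense in its bidual.\<close>

definition wstar_to :: "('k::real_or_complex, 'v::ab_group_add) nspace \<Rightarrow> (('v \<Rightarrow> 'k) \<Rightarrow> 'k) \<Rightarrow> 'v filter" where
  "wstar_to X x'' =
     inf (principal (carrier X)) (INF \<phi>\<in>carrier (dual X). filtercomap \<phi> (nhds (x'' \<phi>)))"

text \<open>\<open>iter_lim [F\<^sub>1, \<dots>, F\<^sub>n] A\<close> is the limit along \<open>x\<^sub>1 \<rightarrow> F\<^sub>1\<close> (outermost) of \<open>\<dots>\<close> the limit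
  along \<open>x\<^sub>n \<rightarrow> F\<^sub>n\<close> (innermost) of \<open>A [x\<^sub>1, \<dots>, x\<^sub>n]\<close>.\<close>

primrec iter_lim :: "'v filter list \<Rightarrow> ('v list \<Rightarrow> 'k::real_or_complex) \<Rightarrow> 'k" where
  "iter_lim [] A = A []"
| "iter_lim (F # Fs) A = Lim F (\<lambda>x. iter_lim Fs (\<lambda>xs. A (x # xs)))"

definition iterated_extension :: "('k::real_or_complex, 'v::ab_group_add) nspace \<Rightarrow> ('v list \<Rightarrow> 'k) \<Rightarrow> (('v \<Rightarrow> 'k) \<Rightarrow> 'k) list \<Rightarrow> 'k" where
  "iterated_extension X A xs'' = iter_lim (map (wstar_to X) xs'') A"

definition sym_form_of :: "nat \<Rightarrow> ('k::real_or_complex, 'v::ab_group_add) nspace \<Rightarrow> ('v \<Rightarrow> 'k) \<Rightarrow> 'v list \<Rightarrow> 'k" where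
  "sym_form_of n X p = (SOME A. cont_sym_form n X A \<and> (\<forall>x\<in>carrier X. p x = A (replicate n x)))"

definition aron_berner :: "nat \<Rightarrow> ('k::real_or_complex, 'v::ab_group_add) nspace \<Rightarrow> ('v \<Rightarrow> 'k) \<Rightarrow> (('v \<Rightarrow> 'k) \<Rightarrow> 'k) \<Rightarrow> 'k" where
  "aron_berner n X p x'' = iterated_extension X (sym_form_of n X p) (replicate n x'')"


section \<open>Realising a space and its bidual in one universe\<close>

text \<open>To speak about the value of \<open>\<alpha>\<close> at \<open>X''\<close>, the bidual has to be represented by a normed space
  carried by the universe \<open>'u\<close>. The lemma \<open>bidual_realizable\<close> below shows that this is no
  restriction: for every \<open>E\<close> there is a universe containing a copy of \<open>E\<close> together with a copy of the
  bidual.\<close>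

lemma vector_space_fscale: "vector_space fscale"
  by unfold_locales (auto simp: fscale_def fun_eq_iff algebra_simps)

lemma normed_spaceD:
  assumes "normed_space X"
  shows "0 \<in> carrier X" "nrm X 0 = 0"
    "x \<in> carrier X \<Longrightarrow> y \<in> carrier X \<Longrightarrow> x + y \<in> carrier X"
    "x \<in> carrier X \<Longrightarrow> smult X c x \<in> carrier X"
    "x \<in> carrier X \<Longrightarrow> 0 \<le> nrm X x"
    "x \<in> carrier X \<Longrightarrow> nrm X x = 0 \<longleftrightarrow> x = 0"
    "x \<in> carrier X \<Longrightarrow> nrm X (smult X c x) = norm c * nrm X x"
    "x \<in> carrier X \<Longrightarrow> y \<in> carrier X \<Longrightarrow> nrm X (x + y) \<le> nrm X x + nrm X y"
proof -
  interpret vector_space "smult X" using assms by (simp add: normed_space_def)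
  have s: "subspace (carrier X)" using assms by (simp add: normed_space_def)
  show 0: "0 \<in> carrier X" using s by (rule subspace_0)
  then show "nrm X 0 = 0" using assms by (simp add: normed_space_def)
  show "x \<in> carrier X \<Longrightarrow> y \<in> carrier X \<Longrightarrow> x + y \<in> carrier X" using s by (rule subspace_add)
  show "x \<in> carrier X \<Longrightarrow> smult X c x \<in> carrier X" using s by (rule subspace_scale)
qed (use assms in \<open>simp_all add: normed_space_def\<close>)

lemma dual_simps:
  "\<phi> \<in> carrier (dual X) \<longleftrightarrow> bounded_linear_on X scalars \<phi> \<and> (\<forall>x. x \<notin> carrier X \<longrightarrow> \<phi> x = 0)"
  "smult (dual X) = fscale" "nrm (dual X) = opnorm X scalars"
  by (simp_all add: dual_def)

lemma scalars_simps: "carrier scalars = UNIV" "smult scalars = (*)" "nrm scalars = norm"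
  by (simp_all add: scalars_def)

lemma opnorm_dual:
  fixes X :: "('a::real_or_complex, 'v::ab_group_add) nspace"
  assumes X: "normed_space X" and p: "bounded_linear_on X scalars \<phi>"
  shows "x \<in> carrier X \<Longrightarrow> norm (\<phi> x) \<le> opnorm X scalars \<phi> * nrm X x"
    and "0 \<le> opnorm X scalars \<phi>"
    and "(\<And>x. x \<in> carrier X \<Longrightarrow> nrm X x \<le> 1 \<Longrightarrow> norm (\<phi> x) \<le> C) \<Longrightarrow> opnorm X scalars \<phi> \<le> C"
proof -
  let ?S = "{norm (\<phi> x) | x. x \<in> carrier X \<and> nrm X x \<le> 1}"
  have op: "opnorm X scalars \<phi> = Sup ?S" by (simp add: opnorm_def scalars_simps)
  have add: "\<phi> (x + y) = \<phi> x + \<phi> y" if "x \<in> carrier X" "y \<in> carrier X" for x y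
    using p that by (simp add: bounded_linear_on_def linear_on_def)
  have sc: "\<phi> (smult X c x) = c * \<phi> x" if "x \<in> carrier X" for x c
    using p that by (simp add: bounded_linear_on_def linear_on_def scalars_simps)
  obtain C0 where C0: "\<And>x. x \<in> carrier X \<Longrightarrow> norm (\<phi> x) \<le> C0 * nrm X x"
    using p by (auto simp: bounded_linear_on_def scalars_simps)
  have bdd: "bdd_above ?S"
  proof (rule bdd_aboveI[of _ "\<bar>C0\<bar>"], clarify)
    fix x assume x: "x \<in> carrier X" "nrm X x \<le> 1"
    have "C0 * nrm X x \<le> \<bar>C0\<bar> * 1"
      using x normed_spaceD(5)[OF X x(1)] by (intro mult_mono) auto
    with C0[OF x(1)] show "norm (\<phi> x) \<le> \<bar>C0\<bar>" by simp
  qed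
  have le: "norm (\<phi> x) \<le> opnorm X scalars \<phi>" if "x \<in> carrier X" "nrm X x \<le> 1" for x
    unfolding op using that bdd by (intro cSup_upper) auto
  have "\<phi> 0 = 0" using add[of 0 0] normed_spaceD(1)[OF X] by simp
  show "0 \<le> opnorm X scalars \<phi>"
    using le[of 0] normed_spaceD(1,2)[OF X] \<open>\<phi> 0 = 0\<close> by simp
  show "x \<in> carrier X \<Longrightarrow> norm (\<phi> x) \<le> opnorm X scalars \<phi> * nrm X x"
  proof (cases "x = 0")
    case True then show ?thesis using \<open>\<phi> 0 = 0\<close> normed_spaceD(2)[OF X] by simp
  next
    case False
    assume x: "x \<in> carrier X"
    have pos: "0 < nrm X x" using False normed_spaceD(5,6)[OF X x] by auto
    let ?c = "inverse (of_real (nrm X x)) :: 'a"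
    have nc: "norm ?c = inverse (nrm X x)" using pos by (simp add: norm_inverse)
    have "norm (\<phi> (smult X ?c x)) \<le> opnorm X scalars \<phi>"
      using pos nc x by (intro le) (simp_all add: normed_spaceD(4,7)[OF X])
    then have "inverse (nrm X x) * norm (\<phi> x) \<le> opnorm X scalars \<phi>"
      by (simp add: sc[OF x] norm_mult nc)
    then show ?thesis using pos by (simp add: field_simps)
  qed
  show "opnorm X scalars \<phi> \<le> C" if "\<And>x. x \<in> carrier X \<Longrightarrow> nrm X x \<le> 1 \<Longrightarrow> norm (\<phi> x) \<le> C"
    unfolding op using that normed_spaceD(1,2)[OF X]
    by (intro cSup_least) (auto intro!: exI[of _ 0])
qed

lemma bounded_linear_on_scalars:
  "bounded_linear_on X scalars \<phi> \<longleftrightarrow>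
     (\<forall>x\<in>carrier X. \<forall>y\<in>carrier X. \<phi> (x + y) = \<phi> x + \<phi> y) \<and>
     (\<forall>c. \<forall>x\<in>carrier X. \<phi> (smult X c x) = c * \<phi> x) \<and>
     (\<exists>C. \<forall>x\<in>carrier X. norm (\<phi> x) \<le> C * nrm X x)"
  by (auto simp: bounded_linear_on_def linear_on_def scalars_simps)

lemma normed_space_dual:
  assumes X: "normed_space X"
  shows "normed_space (dual X)"
proof -
  interpret vector_space fscale by (rule vector_space_fscale)
  let ?D = "carrier (dual X)"
  have bl: "bounded_linear_on X scalars f" if "f \<in> ?D" for f using that by (simp add: dual_simps)
  have add: "f + g \<in> ?D" if f: "f \<in> ?D" and g: "g \<in> ?D" for f g
  proof -
    have "norm ((f + g) x) \<le> (opnorm X scalars f + opnorm X scalars g) * nrm X x"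
      if "x \<in> carrier X" for x
      using opnorm_dual(1)[OF X bl[OF f] that] opnorm_dual(1)[OF X bl[OF g] that]
        norm_triangle_ineq[of "f x" "g x"] by (simp add: algebra_simps)
    then have "\<exists>C. \<forall>x\<in>carrier X. norm ((f + g) x) \<le> C * nrm X x" by blast
    then show ?thesis using f g unfolding dual_simps bounded_linear_on_scalars
      by (simp add: algebra_simps)
  qed
  have sc: "fscale c f \<in> ?D" if f: "f \<in> ?D" for c f
  proof -
    have "norm (fscale c f x) \<le> (norm c * opnorm X scalars f) * nrm X x" if "x \<in> carrier X" for x
      using mult_left_mono[OF opnorm_dual(1)[OF X bl[OF f] that], of "norm c"]
      by (simp add: fscale_def norm_mult mult.assoc)
    then have "\<exists>C. \<forall>x\<in>carrier X. norm (fscale c f x) \<le> C * nrm X x" by blast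
    then show ?thesis using f unfolding dual_simps bounded_linear_on_scalars
      by (simp add: fscale_def algebra_simps)
  qed
  have z: "0 \<in> ?D" by (auto simp: dual_simps bounded_linear_on_scalars intro!: exI[of _ 0])
  have zero: "opnorm X scalars f = 0 \<longleftrightarrow> f = 0" if f: "f \<in> ?D" for f
  proof
    assume "opnorm X scalars f = 0"
    then have "f x = 0" for x
      using opnorm_dual(1)[OF X bl[OF f], of x] f by (cases "x \<in> carrier X") (auto simp: dual_simps)
    then show "f = 0" by (simp add: fun_eq_iff)
  next
    assume "f = 0"
    then show "opnorm X scalars f = 0"
      using opnorm_dual(3)[OF X bl[OF f], of 0] opnorm_dual(2)[OF X bl[OF f]] by simp
  qed
  have tri: "opnorm X scalars (f + g) \<le> opnorm X scalars f + opnorm X scalars g"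
    if f: "f \<in> ?D" and g: "g \<in> ?D" for f g
  proof (rule opnorm_dual(3)[OF X bl[OF add[OF f g]]])
    fix x assume x: "x \<in> carrier X" "nrm X x \<le> 1"
    have "norm (f x) \<le> opnorm X scalars f" "norm (g x) \<le> opnorm X scalars g"
      using opnorm_dual(1)[OF X bl[OF f] x(1)] opnorm_dual(1)[OF X bl[OF g] x(1)]
        mult_left_mono[OF x(2) opnorm_dual(2)[OF X bl[OF f]]]
        mult_left_mono[OF x(2) opnorm_dual(2)[OF X bl[OF g]]] by auto
    then show "norm ((f + g) x) \<le> opnorm X scalars f + opnorm X scalars g"
      using norm_triangle_ineq[of "f x" "g x"] by simp
  qed
  have hle: "opnorm X scalars (fscale c f) \<le> norm c * opnorm X scalars f" if f: "f \<in> ?D" for c f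
  proof (rule opnorm_dual(3)[OF X bl[OF sc[OF f]]])
    fix x assume x: "x \<in> carrier X" "nrm X x \<le> 1"
    have "norm (f x) \<le> opnorm X scalars f"
      using opnorm_dual(1)[OF X bl[OF f] x(1)]
        mult_left_mono[OF x(2) opnorm_dual(2)[OF X bl[OF f]]] by auto
    then show "norm (fscale c f x) \<le> norm c * opnorm X scalars f"
      by (simp add: fscale_def norm_mult mult_left_mono)
  qed
  have hom: "opnorm X scalars (fscale c f) = norm c * opnorm X scalars f" if f: "f \<in> ?D" for c f
  proof (cases "c = 0")
    case True
    then have "fscale c f = 0" by (simp add: fscale_def fun_eq_iff)
    then show ?thesis using True zero[OF z] by simp
  next
    case False
    have "f = fscale (inverse c) (fscale c f)" using False by (simp add: fscale_def fun_eq_iff)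
    then have "opnorm X scalars f \<le> inverse (norm c) * opnorm X scalars (fscale c f)"
      using hle[OF sc[OF f], of "inverse c" c] by (simp add: norm_inverse)
    then have "norm c * opnorm X scalars f \<le> opnorm X scalars (fscale c f)"
      using False by (simp add: field_simps)
    with hle[OF f] show ?thesis by (simp add: antisym)
  qed
  have sub: "subspace ?D" unfolding subspace_def using z add sc by auto
  show ?thesis unfolding normed_space_def
    using vector_space_fscale sub zero tri hom opnorm_dual(2)[OF X bl]
    by (simp add: dual_simps(2,3))
qed

definition dual_map :: "('k::real_or_complex, 'v::ab_group_add) nspace \<Rightarrow> ('v \<Rightarrow> 'w) \<Rightarrow> ('w \<Rightarrow> 'k) \<Rightarrow> 'v \<Rightarrow> 'k" where
  "dual_map X i \<phi> = (\<lambda>x. if x \<in> carrier X then \<phi> (i x) else 0)"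

lemma isometric_iso_dual:
  assumes X: "normed_space X" and Y: "normed_space Y" and i: "isometric_iso X Y i"
  shows "isometric_iso (dual Y) (dual X) (dual_map X i)"
proof -
  have ic: "i x \<in> carrier Y" if "x \<in> carrier X" for x
    using i that by (auto simp: isometric_iso_def)
  have ia: "i (x + y) = i x + i y" if "x \<in> carrier X" "y \<in> carrier X" for x y
    using i that by (auto simp: isometric_iso_def linear_on_def)
  have is': "i (smult X c x) = smult Y c (i x)" if "x \<in> carrier X" for x c
    using i that by (auto simp: isometric_iso_def linear_on_def)
  have inr: "nrm Y (i x) = nrm X x" if "x \<in> carrier X" for x
    using i that by (auto simp: isometric_iso_def)
  have surj: "\<exists>x\<in>carrier X. y = i x" if "y \<in> carrier Y" for y
    using i that by (auto simp: isometric_iso_def)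
  interpret vX: vector_space "smult X" using X by (simp add: normed_space_def)
  interpret vY: vector_space "smult Y" using Y by (simp add: normed_space_def)
  have inj: "x = y" if x: "x \<in> carrier X" and y: "y \<in> carrier X" and e: "i x = i y" for x y
  proof -
    have m: "smult X (-1) y \<in> carrier X" using y by (rule normed_spaceD(4)[OF X])
    have xm: "x + smult X (-1) y \<in> carrier X" using x m by (rule normed_spaceD(3)[OF X])
    have "i (x + smult X (-1) y) = i x + smult Y (-1) (i y)"
      by (simp only: ia[OF x m] is'[OF y])
    then have "i (x + smult X (-1) y) = 0" using e by simp
    then have "nrm X (x + smult X (-1) y) = 0"
      using inr[OF xm] normed_spaceD(2)[OF Y] by simp
    then have "x + smult X (-1) y = 0" using normed_spaceD(6)[OF X xm] by simp
    then show ?thesis by simp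
  qed
  have in': "dual_map X i f \<in> carrier (dual X)" if "f \<in> carrier (dual Y)" for f
  proof -
    obtain C where C: "\<And>y. y \<in> carrier Y \<Longrightarrow> norm (f y) \<le> C * nrm Y y"
      using \<open>f \<in> carrier (dual Y)\<close> unfolding dual_simps bounded_linear_on_scalars by blast
    have "\<exists>C. \<forall>x\<in>carrier X. norm (dual_map X i f x) \<le> C * nrm X x"
      using C[OF ic] by (auto simp: dual_map_def inr intro!: exI[of _ C])
    then show ?thesis using that unfolding dual_simps bounded_linear_on_scalars
      by (simp add: dual_map_def normed_spaceD(3,4)[OF X] ic ia is')
  qed
  have nr: "opnorm X scalars (dual_map X i f) = opnorm Y scalars f" for f
  proof -
    have "{norm (dual_map X i f x) |x. x \<in> carrier X \<and> nrm X x \<le> 1} =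
      {norm (f x) |x. x \<in> carrier Y \<and> nrm Y x \<le> 1}"
    proof (intro set_eqI iffI)
      fix t assume "t \<in> {norm (dual_map X i f x) |x. x \<in> carrier X \<and> nrm X x \<le> 1}"
      then obtain x where "x \<in> carrier X" "nrm X x \<le> 1" "t = norm (f (i x))"
        by (auto simp: dual_map_def)
      then show "t \<in> {norm (f x) |x. x \<in> carrier Y \<and> nrm Y x \<le> 1}"
        using ic inr by (intro CollectI exI[of _ "i x"]) simp
    next
      fix t assume "t \<in> {norm (f x) |x. x \<in> carrier Y \<and> nrm Y x \<le> 1}"
      then obtain y where y: "y \<in> carrier Y" "nrm Y y \<le> 1" "t = norm (f y)" by auto
      then obtain x where "x \<in> carrier X" "y = i x" using surj by metis
      then show "t \<in> {norm (dual_map X i f x) |x. x \<in> carrier X \<and> nrm X x \<le> 1}"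
        using y inr by (intro CollectI exI[of _ x]) (simp add: dual_map_def)
    qed
    then show ?thesis by (simp add: opnorm_def scalars_simps)
  qed
  have onto: "\<exists>f\<in>carrier (dual Y). g = dual_map X i f" if g: "g \<in> carrier (dual X)" for g
  proof -
    let ?j = "\<lambda>y. SOME x. x \<in> carrier X \<and> i x = y"
    have j: "?j (i x) = x" if "x \<in> carrier X" for x
      using that inj by (intro some_equality) auto
    define h where "h = (\<lambda>y. if y \<in> carrier Y then g (?j y) else 0)"
    have fi: "h (i x) = g x" if "x \<in> carrier X" for x using that by (simp add: h_def j ic)
    have gb: "\<And>x y. x \<in> carrier X \<Longrightarrow> y \<in> carrier X \<Longrightarrow> g (x + y) = g x + g y"
      "\<And>c x. x \<in> carrier X \<Longrightarrow> g (smult X c x) = c * g x"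
      using g unfolding dual_simps bounded_linear_on_scalars by auto
    obtain C where C: "\<And>x. x \<in> carrier X \<Longrightarrow> norm (g x) \<le> C * nrm X x"
      using g unfolding dual_simps bounded_linear_on_scalars by blast
    have "h \<in> carrier (dual Y)" unfolding dual_simps bounded_linear_on_scalars
    proof (intro conjI ballI allI exI[of _ C] impI)
      fix x y assume "x \<in> carrier Y" "y \<in> carrier Y"
      then obtain a b where a: "a \<in> carrier X" "x = i a" and b: "b \<in> carrier X" "y = i b"
        using surj by metis
      have "h (i (a + b)) = h (i a) + h (i b)"
        using a b by (subst (1 2 3) fi) (auto simp: gb normed_spaceD(3)[OF X])
      then show "h (x + y) = h x + h y" using a b by (simp add: ia)
    next
      fix c x assume "x \<in> carrier Y"
      then obtain a where a: "a \<in> carrier X" "x = i a" using surj by metis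
      have "h (i (smult X c a)) = c * h (i a)"
        using a by (subst (1 2) fi) (auto simp: gb normed_spaceD(4)[OF X])
      then show "h (smult Y c x) = c * h x" using a by (simp add: is')
    next
      fix x assume "x \<in> carrier Y"
      then obtain a where a: "a \<in> carrier X" "x = i a" using surj by metis
      show "norm (h x) \<le> C * nrm Y x" using fi[OF a(1)] C[OF a(1)] inr[OF a(1)] a by simp
    qed (auto simp: h_def)
    moreover have "g = dual_map X i h"
    proof
      fix x show "g x = dual_map X i h x"
        using g fi[of x] unfolding dual_map_def by (cases "x \<in> carrier X") (auto simp: dual_simps)
    qed
    ultimately show ?thesis by blast
  qed
  have im: "dual_map X i ` carrier (dual Y) = carrier (dual X)"
    using in' onto by blast
  show ?thesis unfolding isometric_iso_def linear_on_def
    using im nr by (auto simp: dual_simps(2,3) fun_eq_iff fscale_def) (simp_all add: dual_map_def)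
qed

lemma normed_space_image:
  assumes X: "normed_space X" and s: "vector_space s"
    and i: "\<And>x y. i (x + y) = i x + i y" "\<And>c x. i (smult X c x) = s c (i x)"
    and ji: "\<And>x. j (i x) = x"
  defines "Y \<equiv> \<lparr>carrier = i ` carrier X, smult = s, nrm = nrm X \<circ> j\<rparr>"
  shows "normed_space Y" "isometric_iso X Y i" "isometric_iso Y X j"
proof -
  interpret vector_space s by (rule s)
  have i0: "i 0 = 0" using i(1)[of 0 0] by simp
  have j0: "j 0 = 0" using ji[of 0] i0 by simp
  have sub: "subspace (i ` carrier X)"
    unfolding subspace_def using normed_spaceD(1,3,4)[OF X] i0 i
    by (auto simp: image_iff) metis+
  have injs: "i x = 0 \<longleftrightarrow> x = 0" for x using ji i0 j0 by metis
  show "normed_space Y" using s sub normed_spaceD[OF X]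
    unfolding normed_space_def Y_def
    by (auto simp: ji injs simp flip: i)
  show "isometric_iso X Y i" "isometric_iso Y X j"
    unfolding isometric_iso_def linear_on_def Y_def
    by (auto simp: ji i image_image simp flip: i)
qed

lemma isometric_iso_trans:
  assumes "isometric_iso X Y f" "isometric_iso Y Z g"
  shows "isometric_iso X Z (g \<circ> f)"
proof -
  have f: "f x \<in> carrier Y" if "x \<in> carrier X" for x
    using assms(1) that by (auto simp: isometric_iso_def)
  have "(g \<circ> f) ` carrier X = carrier Z"
    using assms unfolding isometric_iso_def by (metis image_comp)
  then show ?thesis
    using assms f unfolding isometric_iso_def linear_on_def by simp
qed

lemma bidual_realizable:
  fixes E :: "('k::real_or_complex, 'v::ab_group_add) nspace"
  assumes E: "normed_space E"
  shows "\<exists>(E1 :: ('k, 'v \<times> (('v \<Rightarrow> 'k) \<Rightarrow> 'k)) nspace)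
      (F :: ('k, 'v \<times> (('v \<Rightarrow> 'k) \<Rightarrow> 'k)) nspace) i \<rho>.
    normed_space E1 \<and> isometric_iso E E1 i \<and> normed_space F \<and> isometric_iso F (bidual E1) \<rho>"
proof -
  let ?s = "\<lambda>(c::'k) (x::'v, f::('v \<Rightarrow> 'k) \<Rightarrow> 'k). (smult E c x, fscale c f)"
  interpret E: vector_space "smult E" using E by (simp add: normed_space_def)
  interpret f: vector_space "fscale :: 'k \<Rightarrow> (('v \<Rightarrow> 'k) \<Rightarrow> 'k) \<Rightarrow> ('v \<Rightarrow> 'k) \<Rightarrow> 'k"
    by (rule vector_space_fscale)
  have s: "vector_space ?s"
    by unfold_locales (auto simp: E.scale_right_distrib E.scale_left_distrib
        f.scale_right_distrib f.scale_left_distrib)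
  define E1 where "E1 = \<lparr>carrier = (\<lambda>x. (x, 0)) ` carrier E, smult = ?s, nrm = nrm E \<circ> fst\<rparr>"
  have E1: "normed_space E1" "isometric_iso E E1 (\<lambda>x. (x, 0))"
    unfolding E1_def by (rule normed_space_image[OF E s]; simp)+
  have D: "normed_space (dual E)" "normed_space (dual E1)"
    by (rule normed_space_dual, fact)+
  have B: "normed_space (bidual E)" unfolding bidual_def by (rule normed_space_dual, fact)
  define F where "F = \<lparr>carrier = (\<lambda>f. (0, f)) ` carrier (bidual E), smult = ?s, nrm = nrm (bidual E) \<circ> snd\<rparr>"
  have F: "normed_space F" "isometric_iso F (bidual E) snd"
    unfolding F_def by (rule normed_space_image[OF B s]; simp add: bidual_def dual_simps)+
  have "isometric_iso (bidual E) (bidual E1) (dual_map (dual E1) (dual_map E (\<lambda>x. (x, 0))))"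
    unfolding bidual_def by (intro isometric_iso_dual D E E1)
  from isometric_iso_trans[OF F(2) this] E1 F(1) show ?thesis by (intro exI conjI)
qed

end

theory Submission
  imports Defs "HOL-Combinatorics.Permutations"
begin

text \<open>
  Write \<open>AB\<close> for the extension of \<open>p\<close>, \<open>A\<close> for the symmetric form of \<open>p\<close>, and regard \<open>F\<close> as the
  bidual of \<open>E\<close>.

  One inequality is formal. The canonical embedding \<open>J\<close> of \<open>E\<close> into \<open>F\<close> is a contraction and
  \<open>AB (J x) = p x\<close>, so the functional of \<open>p\<close> is that of \<open>AB\<close> composed with \<open>\<otimes>\<^sup>n J\<close>, and the mapping
  property of \<open>\<alpha>\<close> bounds the norm of \<open>p\<close> by that of \<open>AB\<close> (\<open>canonical_embedding\<close>).

  For the other one, finite generation reduces the estimate of \<open>AB\<close> on a tensor to the case of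
  \<open>w = \<Sum>\<^sub>j \<lambda>\<^sub>j \<otimes>\<^sup>n x\<^sub>j\<close> over a finite dimensional subspace \<open>M\<close> of \<open>F\<close>. It is enough to find, for
  each \<open>c > 1\<close>, operators \<open>S\<close> from \<open>M\<close> to \<open>E\<close> of norm at most \<open>c\<close> for which \<open>p (S x\<^sub>j)\<close> is as close as
  desired to \<open>AB x\<^sub>j\<close> for every \<open>j\<close>: then \<open>AB\<close> at \<open>w\<close> is close to \<open>p\<close> at \<open>\<otimes>\<^sup>n S w\<close>, whose \<open>\<alpha>\<close>-norm is
  at most \<open>c\<^sup>n \<alpha>(w; M)\<close> (\<open>aron_berner_finite_dim_bound\<close>).

  The principle of local reflexivity (\<open>local_reflexivity\<close>) gives operators \<open>R\<close> from \<open>M\<close> to \<open>E\<close> of norm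
  at most \<open>c\<close> such that \<open>\<phi> (R x)\<close> is close to \<open>x \<phi>\<close> for finitely many functionals \<open>\<phi>\<close>. As \<open>AB\<close> need not be
  weak-star continuous, one such \<open>R\<close> does not do. But operators \<open>R\<^sub>0, R\<^sub>1, \<dots>\<close> may be chosen one
  after the other, each adapted to the functionals that arise by putting values of the previous
  ones into the first slots of \<open>A\<close> (\<open>successive_operators\<close>). Then \<open>A (R\<^bsub>i\<^esub> x, R\<^bsub>j\<^esub> x, \<dots>)\<close> is close
  to \<open>AB x\<close> for all increasing sequences of indices, and, \<open>A\<close> being symmetric, for all
  sequences of distinct indices. Let \<open>S\<close> be the average of the first \<open>m\<close> of these operators.
  Expanding \<open>A (S x, \<dots>, S x)\<close> gives the average over all sequences of \<open>n\<close> indices below \<open>m\<close>, and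
  those with a repetition are a fraction of at most \<open>n\<^sup>2 / m\<close> (\<open>averaged_operator\<close>).

  The iterated limits are handled through \<open>bidual_ext\<close>, in which each limit along a net that
  converges weak-star to \<open>x\<close> is replaced by an application of \<open>x\<close> to a functional. The resulting
  form on the bidual need not be symmetric, so \<open>AB\<close> is exhibited as a polynomial by means of its
  symmetrization.
\<close>

section \<open>The Hahn--Banach theorem\<close>

definition sublinear_on :: "(real \<Rightarrow> 'w::ab_group_add \<Rightarrow> 'w) \<Rightarrow> 'w set \<Rightarrow> ('w \<Rightarrow> real) \<Rightarrow> bool" where
  "sublinear_on s S q \<longleftrightarrow> q 0 = 0 \<and> (\<forall>x\<in>S. \<forall>y\<in>S. q (x + y) \<le> q x + q y) \<and>
     (\<forall>r>0. \<forall>x\<in>S. q (s r x) \<le> r * q x)"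

lemma sublinear_on_minus:
  assumes s: "vector_space s" and S: "module.subspace s S" and q: "sublinear_on s S q" and x: "x \<in> S"
  shows "- q (- x) \<le> q x"
proof -
  interpret vector_space s by (rule s)
  have "q (x + - x) \<le> q x + q (- x)"
    using q x subspace_neg[OF S x] unfolding sublinear_on_def by blast
  then show ?thesis using q by (simp add: sublinear_on_def)
qed

lemma sublinear_on_scale:
  assumes s: "vector_space s" and S: "module.subspace s S" and q: "sublinear_on s S q"
    and x: "x \<in> S" and r: "0 \<le> r"
  shows "q (s r x) = r * q x"
proof (cases "r = 0")
  case True
  interpret vector_space s by (rule s)
  show ?thesis using True q by (simp add: sublinear_on_def)
next
  case False
  interpret vector_space s by (rule s)
  from False r have r: "r > 0" by simp
  have le: "q (s r x) \<le> r * q x" if "r > 0" "x \<in> S" for r x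
    using q that unfolding sublinear_on_def by blast
  have "q (s (inverse r) (s r x)) \<le> inverse r * q (s r x)"
    using r by (intro le subspace_scale[OF S x]) auto
  then have "r * q x \<le> q (s r x)" using r by (simp add: field_simps)
  then show ?thesis using le[OF r x] by simp
qed

text \<open>Take for \<open>q' x\<close> the infimum of \<open>q (x + t y) - t q y\<close> over \<open>t \<ge> 0\<close>. The gain is at the point
  \<open>- y\<close>, where \<open>q' (- y) \<le> - q y\<close>: if \<open>q\<close> could not be lowered any further, it would be linear along \<open>y\<close>.\<close>

lemma sublinear_on_directional:
  assumes s: "vector_space s" and S: "module.subspace s S" and q: "sublinear_on s S q" and y: "y \<in> S"
  obtains q' where "sublinear_on s S q'" "\<And>x. x \<in> S \<Longrightarrow> q' x \<le> q x"
    "\<And>x. x \<in> S \<Longrightarrow> q' x \<le> q (x + y) - q y" "\<And>x. x \<notin> S \<Longrightarrow> q' x = 0"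
proof -
  interpret vector_space s by (rule s)
  note [simp] = subspace_add[OF S] subspace_scale[OF S] subspace_neg[OF S] subspace_0[OF S]
  define V where "V x = (\<lambda>t. q (x + s t y) - t * q y) ` {0..}" for x
  define q' where "q' x = (if x \<in> S then Inf (V x) else 0)" for x
  have sub: "q (a + b) \<le> q a + q b" if "a \<in> S" "b \<in> S" for a b
    using q that unfolding sublinear_on_def by blast
  have low: "- q (- x) \<le> q (x + s t y) - t * q y" if "x \<in> S" "0 \<le> t" for x t
  proof -
    have "q ((x + s t y) + - x) \<le> q (x + s t y) + q (- x)" using that y by (intro sub) auto
    then show ?thesis using sublinear_on_scale[OF s S q y that(2)] by simp
  qed
  have V_ne: "V x \<noteq> {}" for x by (auto simp: V_def)
  have bdd: "bdd_below (V x)" if "x \<in> S" for x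
    using low[OF that] by (auto simp: V_def intro!: bdd_belowI[of _ "- q (- x)"])
  have up: "q' x \<le> q (x + s t y) - t * q y" if "x \<in> S" "0 \<le> t" for x t
    unfolding q'_def using that bdd by (auto simp: V_def intro!: cInf_lower)
  have lower: "c \<le> q' x" if "x \<in> S" "\<And>t. 0 \<le> t \<Longrightarrow> c \<le> q (x + s t y) - t * q y" for c x
    unfolding q'_def using that V_ne by (auto simp: V_def intro!: cInf_greatest)
  have "q' 0 \<le> 0" using up[of 0 0] q by (simp add: sublinear_on_def)
  moreover have "0 \<le> q' 0"
    using low[of 0] q by (intro lower) (auto simp: sublinear_on_def)
  moreover have "q' (x + x') \<le> q' x + q' x'" if x: "x \<in> S" and x': "x' \<in> S" for x x'
  proof -
    have *: "q' (x + x') \<le> (q (x + s t y) - t * q y) + (q (x' + s u y) - u * q y)"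
      if "0 \<le> t" "0 \<le> u" for t u
    proof -
      have "q ((x + s t y) + (x' + s u y)) \<le> q (x + s t y) + q (x' + s u y)"
        using x x' y by (intro sub) auto
      moreover have "(x + s t y) + (x' + s u y) = x + x' + s (t + u) y"
        by (simp add: scale_left_distrib algebra_simps)
      ultimately show ?thesis using up[of "x + x'" "t + u"] x x' that by (simp add: algebra_simps)
    qed
    have "q' (x + x') - (q (x + s t y) - t * q y) \<le> q' x'" if "0 \<le> t" for t
      using *[OF that] x' by (intro lower) (auto simp: algebra_simps)
    then have "q' (x + x') - q' x' \<le> q' x"
      using x by (intro lower) (auto simp: algebra_simps)
    then show ?thesis by simp
  qed
  moreover have "q' (s r x) \<le> r * q' x" if r: "r > 0" and x: "x \<in> S" for r x
  proof -
    have "inverse r * q' (s r x) \<le> q' x"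
    proof (intro lower x)
      fix t :: real assume t: "0 \<le> t"
      have "q (s r x + s (r * t) y) = q (s r (x + s t y))"
        by (simp add: scale_right_distrib)
      also have "\<dots> = r * q (x + s t y)"
        using sublinear_on_scale[OF s S q] x y r by simp
      finally have "q' (s r x) \<le> r * (q (x + s t y) - t * q y)"
        using up[of "s r x" "r * t"] x r t by (simp add: algebra_simps)
      then show "inverse r * q' (s r x) \<le> q (x + s t y) - t * q y"
        using r by (simp add: field_simps)
    qed
    then show ?thesis using r by (simp add: field_simps)
  qed
  ultimately have "sublinear_on s S q'" unfolding sublinear_on_def by simp
  then show ?thesis
    using up[of _ 0] up[of _ 1] by (intro that[of q']) (auto simp: q'_def)
qed

text \<open>Zorn's lemma for the pointwise order: the infimum of a chain is finite since each member that lies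
  below \<open>Q\<close> is bounded below by \<open>- Q (- x)\<close> at \<open>x\<close>, and it is subadditive because any two members
  of the chain have one of them as a lower bound.\<close>

lemma minimal_sublinear:
  assumes s: "vector_space s" and S: "module.subspace s S" and Q: "sublinear_on s S Q"
  obtains q where "sublinear_on s S q" "\<And>x. x \<in> S \<Longrightarrow> q x \<le> Q x"
    "\<And>q' x. sublinear_on s S q' \<Longrightarrow> (\<And>x. x \<in> S \<Longrightarrow> q' x \<le> q x) \<Longrightarrow> x \<in> S \<Longrightarrow> q' x = q x"
proof -
  interpret vector_space s by (rule s)
  note [simp] = subspace_add[OF S] subspace_scale[OF S] subspace_neg[OF S] subspace_0[OF S]
  define P where "P = {q. sublinear_on s S q \<and> (\<forall>x\<in>S. q x \<le> Q x) \<and> (\<forall>x. x \<notin> S \<longrightarrow> q x = 0)}"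
  define ge where "ge = (\<lambda>q q' :: 'a \<Rightarrow> real. q' \<le> q)"
  \<comment> \<open>Values outside \<open>S\<close> are set to zero, which makes the pointwise order on \<open>P\<close> antisymmetric.\<close>
  define cut where "cut q = (\<lambda>x. if x \<in> S then q x else 0)" for q :: "'a \<Rightarrow> real"
  have cut: "cut q \<in> P" if "sublinear_on s S q" "\<And>x. x \<in> S \<Longrightarrow> q x \<le> Q x" for q
    using that unfolding P_def cut_def sublinear_on_def by auto
  have po: "partial_order_on P (relation_of ge P)"
    unfolding ge_def by (rule partial_order_on_relation_ofI) auto
  have ch: "\<exists>u\<in>P. \<forall>a\<in>C. ge a u" if C: "C \<in> Chains (relation_of ge P)" for C
  proof (cases "C = {}")
    case True
    then show ?thesis using cut[OF Q] by auto
  next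
    case False
    have CP: "a \<in> P" if "a \<in> C" for a using C that by (auto simp: Chains_def relation_of_def)
    have tot: "a \<le> b \<or> b \<le> a" if "a \<in> C" "b \<in> C" for a b
      using C that by (auto simp: Chains_def relation_of_def ge_def)
    define u where "u x = (if x \<in> S then INF a\<in>C. a x else 0)" for x
    have low: "- Q (- x) \<le> a x" if "a \<in> C" "x \<in> S" for a x
    proof -
      have "sublinear_on s S a" "a (- x) \<le> Q (- x)"
        using CP[OF that(1)] that(2) by (auto simp: P_def)
      then show ?thesis using sublinear_on_minus[OF s S _ that(2), of a] by simp
    qed
    have bdd: "bdd_below ((\<lambda>a. a x) ` C)" if "x \<in> S" for x
      using low that by (auto intro!: bdd_belowI[of _ "- Q (- x)"])
    have up: "u x \<le> a x" if "a \<in> C" "x \<in> S" for a x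
      unfolding u_def using that bdd by (auto intro: cINF_lower)
    have lower: "c \<le> u x" if "x \<in> S" "\<And>a. a \<in> C \<Longrightarrow> c \<le> a x" for c x
      unfolding u_def using that False by (auto intro: cINF_greatest)
    have aP: "a 0 = 0" "\<And>x y. x \<in> S \<Longrightarrow> y \<in> S \<Longrightarrow> a (x + y) \<le> a x + a y"
      "\<And>r x. r > 0 \<Longrightarrow> x \<in> S \<Longrightarrow> a (s r x) \<le> r * a x" "\<And>x. x \<in> S \<Longrightarrow> a x \<le> Q x"
      if "a \<in> C" for a
      using CP[OF that] unfolding P_def sublinear_on_def by blast+
    have "u 0 = 0"
    proof (rule antisym)
      show "u 0 \<le> 0" using False up[of _ 0] aP(1) by fastforce
      show "0 \<le> u 0"
      proof (rule lower)
        fix a assume "a \<in> C"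
        then show "0 \<le> a 0" using aP(1)[of a] by simp
      qed simp
    qed
    moreover have "u (x + y) \<le> u x + u y" if x: "x \<in> S" and y: "y \<in> S" for x y
    proof -
      have *: "u (x + y) \<le> a x + b y" if a: "a \<in> C" and b: "b \<in> C" for a b
      proof -
        obtain c where c: "c \<in> C" "c \<le> a" "c \<le> b" using tot[OF a b] a b by auto
        have "u (x + y) \<le> c (x + y)" using up[OF c(1)] x y by simp
        also have "\<dots> \<le> c x + c y" using aP(2)[OF c(1) x y] .
        also have "\<dots> \<le> a x + b y" using c(2,3) by (intro add_mono) (auto simp: le_fun_def)
        finally show ?thesis .
      qed
      have "u (x + y) - a x \<le> u y" if "a \<in> C" for a
        using *[OF that] y by (intro lower) (auto simp: algebra_simps)
      then have "u (x + y) - u y \<le> u x" using x by (intro lower) (auto simp: algebra_simps)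
      then show ?thesis by simp
    qed
    moreover have "u (s r x) \<le> r * u x" if r: "r > 0" and x: "x \<in> S" for r x
    proof -
      have "inverse r * u (s r x) \<le> u x"
      proof (intro lower x)
        fix a assume a: "a \<in> C"
        have "u (s r x) \<le> r * a x" using up[OF a, of "s r x"] aP(3)[OF a r x] x by simp
        then show "inverse r * u (s r x) \<le> a x" using r by (simp add: field_simps)
      qed
      then show ?thesis using r by (simp add: field_simps)
    qed
    moreover have "u x \<le> Q x" if "x \<in> S" for x
      using False up aP(4) that by (meson ex_in_conv order_trans)
    ultimately have "u \<in> P" unfolding P_def sublinear_on_def by (auto simp: u_def)
    moreover have "u \<le> a" if "a \<in> C" for a
      using up[OF that] CP[OF that] by (auto simp: le_fun_def P_def u_def)
    ultimately show ?thesis unfolding ge_def by blast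
  qed
  obtain q where q: "q \<in> P" and min: "\<And>a. a \<in> P \<Longrightarrow> a \<le> q \<Longrightarrow> a = q"
    using predicate_Zorn[OF po ch] by (auto simp: ge_def)
  have q': "sublinear_on s S q" "\<And>x. x \<in> S \<Longrightarrow> q x \<le> Q x" "\<And>x. x \<notin> S \<Longrightarrow> q x = 0"
    using q by (auto simp: P_def)
  have "q1 x = q x" if "sublinear_on s S q1" "\<And>x. x \<in> S \<Longrightarrow> q1 x \<le> q x" "x \<in> S" for q1 x
  proof -
    have "cut q1 \<in> P" using that q'(2) by (intro cut) (auto intro: order_trans)
    moreover have "cut q1 \<le> q" using that q'(3) by (auto simp: le_fun_def cut_def)
    ultimately have "cut q1 = q" by (rule min)
    then have "cut q1 x = q x" by simp
    then show ?thesis using \<open>x \<in> S\<close> by (simp add: cut_def)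
  qed
  then show ?thesis using that[of q] q'(1,2) by blast
qed

text \<open>A minimal sublinear functional is not changed by lowering it along any direction, which forces
  additivity.\<close>

lemma hahn_banach_real:
  assumes s: "vector_space s" and S: "module.subspace s S" and Q: "sublinear_on s S Q" and v: "v \<in> S"
  obtains h where "\<And>x y. x \<in> S \<Longrightarrow> y \<in> S \<Longrightarrow> h (x + y) = h x + h y"
    "\<And>r x. x \<in> S \<Longrightarrow> h (s r x) = r * h x" "\<And>x. x \<in> S \<Longrightarrow> h x \<le> Q x" "h v = Q v"
proof -
  interpret vector_space s by (rule s)
  note [simp] = subspace_add[OF S] subspace_scale[OF S] subspace_neg[OF S] subspace_0[OF S]
  \<comment> \<open>Anything below \<open>Q'\<close> is at most \<open>- Q v\<close> at \<open>- v\<close>.\<close>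
  obtain Q' where Q': "sublinear_on s S Q'" "\<And>x. x \<in> S \<Longrightarrow> Q' x \<le> Q x"
    "\<And>x. x \<in> S \<Longrightarrow> Q' x \<le> Q (x + v) - Q v"
    using sublinear_on_directional[OF s S Q v] by metis
  obtain h where h: "sublinear_on s S h" "\<And>x. x \<in> S \<Longrightarrow> h x \<le> Q' x"
    and min: "\<And>q' x. sublinear_on s S q' \<Longrightarrow> (\<And>x. x \<in> S \<Longrightarrow> q' x \<le> h x) \<Longrightarrow> x \<in> S \<Longrightarrow> q' x = h x"
    using minimal_sublinear[OF s S Q'(1)] by blast
  have sub: "h (x + y) \<le> h x + h y" if "x \<in> S" "y \<in> S" for x y
    using h(1) that unfolding sublinear_on_def by blast
  have add: "h (x + y) = h x + h y" if x: "x \<in> S" and y: "y \<in> S" for x y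
  proof -
    obtain q where q: "sublinear_on s S q" "\<And>x. x \<in> S \<Longrightarrow> q x \<le> h x"
      "\<And>x. x \<in> S \<Longrightarrow> q x \<le> h (x + y) - h y"
      using sublinear_on_directional[OF s S h(1) y] by metis
    have "h x \<le> h (x + y) - h y" using q(3)[OF x] min[OF q(1,2) x] by simp
    then show ?thesis using sub[OF x y] by simp
  qed
  have h0: "h 0 = 0" using h(1) by (simp add: sublinear_on_def)
  have neg: "h (- x) = - h x" if "x \<in> S" for x
    using add[of x "- x"] that h0 by simp
  have scale: "h (s r x) = r * h x" if x: "x \<in> S" for r x
  proof (cases "0 \<le> r")
    case True then show ?thesis using sublinear_on_scale[OF s S h(1) x] by simp
  next
    case False
    then have "h (s (- r) x) = - r * h x" by (intro sublinear_on_scale[OF s S h(1) x]) simp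
    then show ?thesis using neg[of "s r x"] x by simp
  qed
  have le: "h x \<le> Q x" if "x \<in> S" for x using h(2) Q'(2) that by (meson order_trans)
  have "h (- v) \<le> Q (- v + v) - Q v" using h(2) Q'(3) v by (meson order_trans subspace_neg[OF S])
  then have "Q v \<le> h v" using neg[OF v] Q by (simp add: sublinear_on_def)
  then show ?thesis using that[of h] add scale le v by force
qed

text \<open>The decomposition in the complex case is unique, so the formula for the norm holds for every
  expression of the form \<open>a + b j\<close>.\<close>

lemma scalar_cases:
  obtains (real) "\<And>x::'k::real_or_complex. \<exists>r. x = of_real r"
  | (complex) j :: "'k::real_or_complex" where "j * j = - 1" "\<And>x. \<exists>a b. x = of_real a + of_real b * j"
      "\<And>a b. norm (of_real a + of_real b * j) = sqrt (a\<^sup>2 + b\<^sup>2)"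
proof -
  consider "\<forall>x::'k. \<exists>r. x = r *\<^sub>R 1"
    | j :: 'k where "j * j = - 1" "\<And>x. \<exists>a b. x = a *\<^sub>R 1 + b *\<^sub>R j \<and> norm x = sqrt (a\<^sup>2 + b\<^sup>2)"
    using real_or_complex[where 'a = 'k] by metis
  then show ?thesis
  proof cases
    case 1
    then show ?thesis by (intro real) (simp add: of_real_def)
  next
    case 2
    \<comment> \<open>A real \<open>j\<close> would be a real square root of \<open>- 1\<close>.\<close>
    have indep: "b = 0" if "of_real a + of_real b * j = 0" for a b
    proof (rule ccontr)
      assume b: "b \<noteq> 0"
      have e: "of_real b * j = of_real (- a)" using that by (simp add: eq_neg_iff_add_eq_0 add.commute)
      have "of_real (- (b\<^sup>2)) = (of_real b * j) * (of_real b * j)"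
        using 2(1) by (simp add: power2_eq_square mult.left_commute mult.assoc)
      also have "\<dots> = of_real (a\<^sup>2)" unfolding e by (simp add: power2_eq_square)
      finally have "- (b\<^sup>2) = a\<^sup>2" by (simp only: of_real_eq_iff)
      moreover have "0 < b\<^sup>2" "0 \<le> a\<^sup>2" using b by simp_all
      ultimately show False by linarith
    qed
    have nrm: "norm (of_real a + of_real b * j) = sqrt (a\<^sup>2 + b\<^sup>2)" for a b
    proof -
      obtain a' b' where ab: "of_real a + of_real b * j = of_real a' + of_real b' * j"
        "norm (of_real a + of_real b * j) = sqrt (a'\<^sup>2 + b'\<^sup>2)"
        using 2(2)[of "of_real a + of_real b * j"] by (auto simp: of_real_def)
      have "of_real (a - a') + of_real (b - b') * j = 0" using ab(1) by (simp add: algebra_simps)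
      moreover from this have "b - b' = 0" by (rule indep)
      ultimately have "a = a'" "b = b'" by simp_all
      then show ?thesis using ab(2) by simp
    qed
    have "\<exists>a b. x = of_real a + of_real b * j" for x using 2(2)[of x] by (auto simp: of_real_def)
    then show ?thesis using complex 2(1) nrm by blast
  qed
qed

text \<open>For complex scalars, a real functional \<open>h\<close> is the real part of \<open>h x - h (j x) j\<close>. A rotation
  that makes the value of this functional real transfers the bound from \<open>h\<close> to it.\<close>

lemma hahn_banach_seminorm:
  fixes s :: "'k::real_or_complex \<Rightarrow> 'w::ab_group_add \<Rightarrow> 'w"
  assumes s: "vector_space s" and S: "module.subspace s S"
    and Qadd: "\<And>x y. x \<in> S \<Longrightarrow> y \<in> S \<Longrightarrow> Q (x + y) \<le> Q x + Q y"
    and Qsc: "\<And>c x. x \<in> S \<Longrightarrow> Q (s c x) = norm c * Q x" and v: "v \<in> S"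
  obtains h :: "'w \<Rightarrow> 'k" where "\<And>x y. x \<in> S \<Longrightarrow> y \<in> S \<Longrightarrow> h (x + y) = h x + h y"
    "\<And>c x. x \<in> S \<Longrightarrow> h (s c x) = c * h x" "\<And>x. x \<in> S \<Longrightarrow> norm (h x) \<le> Q x" "h v = of_real (Q v)"
proof -
  interpret vector_space s by (rule s)
  note [simp] = subspace_add[OF S] subspace_scale[OF S] subspace_neg[OF S] subspace_0[OF S]
  let ?s = "\<lambda>r. s (of_real r)"
  have s': "vector_space ?s"
    by unfold_locales (simp_all add: scale_right_distrib scale_left_distrib)
  then interpret R: vector_space ?s .
  have S': "R.subspace S" unfolding R.subspace_def by simp
  have Q0: "Q 0 = 0" using Qsc[of 0 0] by simp
  have Qn: "Q (- x) = Q x" if "x \<in> S" for x using Qsc[OF that, of "- 1"] by simp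
  have "sublinear_on ?s S Q" using Qadd Qsc Q0 by (simp add: sublinear_on_def)
  then obtain h where h: "\<And>x y. x \<in> S \<Longrightarrow> y \<in> S \<Longrightarrow> h (x + y) = h x + h y"
    "\<And>r x. x \<in> S \<Longrightarrow> h (?s r x) = r * h x" "\<And>x. x \<in> S \<Longrightarrow> h x \<le> Q x" "h v = Q v"
    using hahn_banach_real[OF s' S' _ v] by metis
  have hn: "h (- x) = - h x" if "x \<in> S" for x using h(2)[OF that, of "- 1"] by simp
  show ?thesis
  proof (cases rule: scalar_cases[where 'k = 'k])
    case real
    let ?h = "\<lambda>x. of_real (h x) :: 'k"
    have "?h (s c x) = c * ?h x" if "x \<in> S" for c x
      using real[of c] h(2)[OF that] by (metis of_real_mult)
    moreover have "norm (?h x) \<le> Q x" if "x \<in> S" for x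
      using h(3)[OF that] h(3)[of "- x"] hn[OF that] Qn[OF that] that by simp
    ultimately show ?thesis using h(1,4) by (intro that[of ?h]) simp_all
  next
    case (complex j)
    let ?h = "\<lambda>x. of_real (h x) - of_real (h (s j x)) * j"
    have add: "?h (x + y) = ?h x + ?h y" if "x \<in> S" "y \<in> S" for x y
      using that h(1) by (simp add: scale_right_distrib algebra_simps)
    have sr: "?h (?s r x) = of_real r * ?h x" if "x \<in> S" for r x
    proof -
      have "s j (?s r x) = ?s r (s j x)" by (simp add: mult.commute)
      then show ?thesis using h(2)[of x r] h(2)[of "s j x" r] that by (simp add: algebra_simps)
    qed
    have sj: "?h (s j x) = j * ?h x" if "x \<in> S" for x
    proof -
      have ss: "s j (s j x) = - x" using complex(1) by simp
      have jj: "j * (j * w) = - w" for w using complex(1) by (metis mult.assoc mult_minus1)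
      show ?thesis unfolding ss hn[OF that] by (simp add: algebra_simps jj)
    qed
    have sc: "?h (s c x) = c * ?h x" if x: "x \<in> S" for c x
    proof -
      obtain a b where c: "c = of_real a + of_real b * j" using complex(2) by blast
      have "s c x = ?s a x + ?s b (s j x)" by (simp add: c scale_left_distrib)
      then have "?h (s c x) = ?h (?s a x) + ?h (?s b (s j x))"
        by (simp only: add[OF subspace_scale[OF S x] subspace_scale[OF S subspace_scale[OF S x]]])
      also have "\<dots> = of_real a * ?h x + of_real b * ?h (s j x)"
        by (simp only: sr[OF x, of a] sr[OF subspace_scale[OF S x], of b j])
      finally show ?thesis unfolding sj[OF x] c by (simp only: distrib_right mult.assoc)
    qed
    have re: "h x \<le> norm (?h x)" "norm (?h x) \<le> r \<Longrightarrow> h x = r \<Longrightarrow> ?h x = of_real r" for x r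
    proof -
      have e: "norm (?h x) = sqrt ((h x)\<^sup>2 + (h (s j x))\<^sup>2)"
        using complex(3)[of "h x" "- h (s j x)"] by simp
      show "h x \<le> norm (?h x)" unfolding e by (rule real_sqrt_sum_squares_ge1)
      show "?h x = of_real r" if "norm (?h x) \<le> r" "h x = r"
      proof -
        have "0 \<le> r" using that(1) norm_ge_zero order_trans by blast
        then have "(sqrt ((h x)\<^sup>2 + (h (s j x))\<^sup>2))\<^sup>2 \<le> r\<^sup>2" using that(1) e by (intro power_mono) auto
        then have "(h (s j x))\<^sup>2 \<le> 0" using that(2) by simp
        then show ?thesis using that(2) by simp
      qed
    qed
    have le: "norm (?h x) \<le> Q x" if x: "x \<in> S" for x
    proof (cases "?h x = 0")
      case True
      have "0 \<le> Q x" using Qadd[of x "- x"] Qn[OF x] Q0 x by simp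
      then show ?thesis using True by simp
    next
      case False
      define u where "u = of_real (norm (?h x)) / ?h x"
      have u: "norm u = 1" using False by (simp add: u_def norm_divide)
      have hu: "?h (s u x) = of_real (norm (?h x))" unfolding sc[OF x] using False by (simp add: u_def)
      have "of_real (h (s u x) - norm (?h x)) + of_real (- h (s j (s u x))) * j = 0"
        using hu by (simp add: algebra_simps)
      then have "sqrt ((h (s u x) - norm (?h x))\<^sup>2 + (- h (s j (s u x)))\<^sup>2) = 0"
        using complex(3)[of "h (s u x) - norm (?h x)" "- h (s j (s u x))"] by simp
      then have "norm (?h x) = h (s u x)" by (simp add: sum_power2_eq_zero_iff)
      also have "\<dots> \<le> Q x" using h(3)[of "s u x"] Qsc[OF x, of u] u x by simp
      finally show ?thesis .
    qed
    have "?h v = of_real (Q v)" using le[OF v] h(4) by (rule re(2))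
    with add sc le show ?thesis by (rule that[of ?h])
  qed
qed

section \<open>Finite dimensional subspaces\<close>

lemma compact_cball_scalar: "compact (cball (0::'k::real_or_complex) r)"
proof (cases rule: scalar_cases[where 'k = 'k])
  case real
  have "cball (0::'k) r = of_real ` {- r..r}"
  proof (intro set_eqI iffI)
    fix x :: 'k assume "x \<in> cball 0 r"
    moreover obtain t where "x = of_real t" using real by blast
    ultimately show "x \<in> of_real ` {- r..r}" by (auto simp: abs_le_iff)
  qed (auto simp: abs_le_iff)
  then show ?thesis by (auto intro!: compact_continuous_image continuous_intros)
next
  case (complex j)
  have "cball (0::'k) r = (\<lambda>(a, b). of_real a + of_real b * j) ` cball 0 r"
  proof (intro set_eqI iffI)
    fix x :: 'k assume "x \<in> cball 0 r"
    moreover obtain a b where "x = of_real a + of_real b * j" using complex(2) by blast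
    ultimately show "x \<in> (\<lambda>(a, b). of_real a + of_real b * j) ` cball 0 r"
      by (auto simp: complex(3) norm_Pair intro!: image_eqI[of _ _ "(a, b)"])
  qed (auto simp: complex(3) norm_Pair)
  then show ?thesis by (auto intro!: compact_continuous_image continuous_intros simp: case_prod_beta)
qed

lemma normed_space_vs: "normed_space X \<Longrightarrow> vector_space (smult X)"
  and normed_space_subspace: "normed_space X \<Longrightarrow> module.subspace (smult X) (carrier X)"
  by (simp_all add: normed_space_def)

lemma nrm_minus_commute:
  assumes X: "normed_space X" and "x \<in> carrier X" "y \<in> carrier X"
  shows "x - y \<in> carrier X" "nrm X (y - x) = nrm X (x - y)"
proof -
  interpret vector_space "smult X" using X by (rule normed_space_vs)
  show d: "x - y \<in> carrier X" using assms by (intro subspace_diff normed_space_subspace)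
  show "nrm X (y - x) = nrm X (x - y)" using normed_spaceD(7)[OF X d, of "- 1"] by simp
qed

lemma nrm_sum_le:
  assumes X: "normed_space X" and f: "\<And>i. i \<in> I \<Longrightarrow> f i \<in> carrier X"
  shows "sum f I \<in> carrier X" "nrm X (sum f I) \<le> (\<Sum>i\<in>I. nrm X (f i))"
proof -
  have "sum f I \<in> carrier X \<and> nrm X (sum f I) \<le> (\<Sum>i\<in>I. nrm X (f i))"
    using f
  proof (induction I rule: infinite_finite_induct)
    case (insert i I)
    then have "sum f I \<in> carrier X" "f i \<in> carrier X" "nrm X (sum f I) \<le> (\<Sum>i\<in>I. nrm X (f i))" by auto
    then show ?case using insert.hyps normed_spaceD(3)[OF X, of "f i" "sum f I"]
        normed_spaceD(8)[OF X, of "f i" "sum f I"] by simp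
  qed (use normed_spaceD(1,2)[OF X] in auto)
  then show "sum f I \<in> carrier X" "nrm X (sum f I) \<le> (\<Sum>i\<in>I. nrm X (f i))" by auto
qed

lemma FIN_basis:
  assumes X: "normed_space X" and M: "FIN X M"
  obtains B where "finite B" "B \<subseteq> carrier X" "\<not> module.dependent (smult X) B" "M = module.span (smult X) B"
proof -
  interpret vector_space "smult X" using X by (rule normed_space_vs)
  obtain G where G: "finite G" "M = span G" "M \<subseteq> carrier X" using M by (auto simp: FIN_def)
  obtain B where B: "B \<subseteq> G" "independent B" "G \<subseteq> span B"
    using maximal_independent_subset[of G] by blast
  have "span B = span G" using B by (metis span_mono span_span subset_antisym)
  then show ?thesis using that[of B] B G finite_subset span_superset by blast
qed

lemma continuous_nrm_combination:
  assumes X: "normed_space X" and B: "finite B" "B \<subseteq> carrier X"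
  shows "continuous_on UNIV (\<lambda>c. nrm X (\<Sum>b\<in>B. smult X (c b - a b) b))" (is "continuous_on UNIV ?f")
  unfolding continuous_on_def
proof
  fix c :: "'b \<Rightarrow> 'a"
  interpret vector_space "smult X" using X by (rule normed_space_vs)
  define g where "g x = (\<Sum>b\<in>B. norm (x b - c b) * nrm X b)" for x
  have mem: "smult X t b \<in> carrier X" if "b \<in> B" for t b
    using B that by (auto intro: normed_spaceD(4)[OF X])
  have "continuous_on UNIV g" unfolding g_def by (intro continuous_intros) auto
  then have "(g \<longlongrightarrow> g c) (at c)" by (simp add: continuous_on_def)
  then have g: "(g \<longlongrightarrow> 0) (at c)" by (simp add: g_def)
  have "norm (?f x - ?f c) \<le> g x" for x
  proof -
    let ?F = "\<lambda>y. (\<Sum>b\<in>B. smult X (y b - a b) b)"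
    have F: "?F y \<in> carrier X" for y using mem by (intro nrm_sum_le[OF X])
    have *: "?f y \<le> ?f z + nrm X (?F y - ?F z)" for y z
      using normed_spaceD(8)[OF X F[of z] nrm_minus_commute(1)[OF X F[of y] F[of z]]] by simp
    have "?F x - ?F c = (\<Sum>b\<in>B. smult X (x b - c b) b)"
      by (simp add: sum_subtractf[symmetric] scale_left_diff_distrib[symmetric])
    then have "nrm X (?F x - ?F c) \<le> (\<Sum>b\<in>B. nrm X (smult X (x b - c b) b))"
      using nrm_sum_le(2)[OF X, of B "\<lambda>b. smult X (x b - c b) b"] mem by simp
    also have "\<dots> = g x" unfolding g_def using B by (intro sum.cong) (auto simp: normed_spaceD(7)[OF X])
    finally show ?thesis using *[of x c] *[of c x] nrm_minus_commute(2)[OF X F[of x] F[of c]] by simp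
  qed
  then have "((\<lambda>x. ?f x - ?f c) \<longlongrightarrow> 0) (at c)"
    by (intro Lim_null_comparison[OF _ g]) simp
  then show "(?f \<longlongrightarrow> ?f c) (at c within UNIV)" by (rule LIM_zero_cancel)
qed

lemma compact_coefficient_box:
  "compact (PiE UNIV (\<lambda>b. if b \<in> B then cball 0 r else {0}) :: ('u \<Rightarrow> 'k::real_or_complex) set)"
proof -
  have "compactin (product_topology (\<lambda>_. euclidean) UNIV) (PiE UNIV (\<lambda>b. if b \<in> B then cball 0 r else {0::'k}) :: ('u \<Rightarrow> 'k) set)"
    by (auto simp: compactin_PiE compact_cball_scalar)
  then show ?thesis by (simp add: euclidean_product_topology)
qed

text \<open>The norm is a continuous function of the coefficients, and it is positive on the compact set of
  coefficients of maximum norm one. Coefficients are functions on \<open>B\<close> extended by zero,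
  with the product topology.\<close>

lemma coefficients_bounded:
  assumes X: "normed_space X" and B: "finite B" "B \<subseteq> carrier X" "\<not> module.dependent (smult X) B"
  obtains C where "0 < C" "\<And>c b. b \<in> B \<Longrightarrow> norm (c b) \<le> C * nrm X (\<Sum>b\<in>B. smult X (c b) b)"
proof (cases "B = {}")
  case True
  then show ?thesis using that[of 1] by simp
next
  case False
  interpret vector_space "smult X" using X by (rule normed_space_vs)
  let ?f = "\<lambda>c. nrm X (\<Sum>b\<in>B. smult X (c b) b)"
  let ?K = "PiE UNIV (\<lambda>b. if b \<in> B then cball 0 1 else {0}) :: ('b \<Rightarrow> 'a) set"
  \<comment> \<open>The coefficients of maximum norm one: all lie in the unit ball and one on the unit sphere.\<close>
  let ?T = "\<Union>b\<in>B. ?K \<inter> {c. norm (c b) = 1}"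
  have mem: "(\<Sum>b\<in>B. smult X (c b) b) \<in> carrier X" for c
    using B by (intro nrm_sum_le[OF X] normed_spaceD(4)[OF X]) auto
  have cont: "continuous_on UNIV ?f" using continuous_nrm_combination[OF X B(1,2), of 0] by simp
  have "closed {c :: 'b \<Rightarrow> 'a. norm (c b) = 1}" for b
    by (intro closed_Collect_eq continuous_intros) auto
  then have cT: "compact ?T" using B(1) compact_coefficient_box
    by (intro compact_UN compact_Int_closed) auto
  obtain b0 where b0: "b0 \<in> B" using False by blast
  have "(\<lambda>b. if b = b0 then 1 else 0) \<in> ?T" using b0 by (auto simp: PiE_def Pi_def)
  then have ne: "?T \<noteq> {}" by blast
  have "\<exists>c0\<in>?T. \<forall>c\<in>?T. ?f c0 \<le> ?f c"
    by (rule continuous_attains_inf[OF cT ne continuous_on_subset[OF cont subset_UNIV]])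
  then obtain c0 where c0: "c0 \<in> ?T" and min: "\<And>c. c \<in> ?T \<Longrightarrow> ?f c0 \<le> ?f c" by blast
  have pos: "0 < ?f c0"
  proof (rule ccontr)
    assume "\<not> 0 < ?f c0"
    then have "?f c0 = 0" using normed_spaceD(5)[OF X mem[of c0]] by simp
    then have "(\<Sum>b\<in>B. smult X (c0 b) b) = 0" using normed_spaceD(6)[OF X mem[of c0]] by simp
    then have "c0 b = 0" if "b \<in> B" for b
      using independentD[OF B(3) B(1) _ _ that] by blast
    then show False using c0 by force
  qed
  have "norm (c b) \<le> inverse (?f c0) * ?f c" if b: "b \<in> B" for c b
  proof -
    define m where "m = Max ((\<lambda>b. norm (c b)) ` B)"
    have m: "norm (c b) \<le> m" if "b \<in> B" for b using B(1) that by (simp add: m_def)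
    have "m \<in> (\<lambda>b. norm (c b)) ` B" unfolding m_def using B(1) False by (intro Max_in) auto
    then obtain b1 where b1: "b1 \<in> B" "norm (c b1) = m" by auto
    have m0: "0 \<le> m" using b1 norm_ge_zero by metis
    have "m * ?f c0 \<le> ?f c"
    proof (cases "m = 0")
      case True then show ?thesis using normed_spaceD(5)[OF X mem] by simp
    next
      case False
      with m0 have m0: "m > 0" by simp
      define c' where "c' b = (if b \<in> B then c b / of_real m else 0)" for b
      have "c' \<in> ?T" using m b1 m0 by (auto simp: c'_def PiE_def Pi_def norm_divide intro!: bexI[of _ b1])
      then have "?f c0 \<le> ?f c'" by (rule min)
      also have "(\<Sum>b\<in>B. smult X (c' b) b) = smult X (inverse (of_real m)) (\<Sum>b\<in>B. smult X (c b) b)"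
        unfolding scale_sum_right by (intro sum.cong) (auto simp: c'_def field_simps)
      also have "nrm X \<dots> = inverse m * ?f c"
        using normed_spaceD(7)[OF X mem] m0 by (simp add: norm_inverse)
      finally show ?thesis using m0 by (simp add: field_simps)
    qed
    then have "m \<le> inverse (?f c0) * ?f c" using pos by (simp add: field_simps)
    then show ?thesis using m[OF b] by simp
  qed
  then show ?thesis using pos by (intro that[of "inverse (?f c0)"]) auto
qed

lemma finite_dim_unit_ball_net:
  assumes X: "normed_space X" and M: "FIN X M" and \<delta>: "0 < \<delta>"
  obtains D where "finite D" "D \<subseteq> M" "\<And>d. d \<in> D \<Longrightarrow> nrm X d \<le> 1"
    "\<And>x. x \<in> M \<Longrightarrow> nrm X x \<le> 1 \<Longrightarrow> \<exists>d\<in>D. nrm X (x - d) \<le> \<delta>"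
proof -
  interpret vector_space "smult X" using X by (rule normed_space_vs)
  obtain B where B: "finite B" "B \<subseteq> carrier X" "independent B" and MB: "M = span B"
    using FIN_basis[OF X M] by blast
  obtain C where C: "0 < C" "\<And>c b. b \<in> B \<Longrightarrow> norm (c b) \<le> C * nrm X (\<Sum>b\<in>B. smult X (c b) b)"
    using coefficients_bounded[OF X B] by blast
  let ?F = "\<lambda>c. (\<Sum>b\<in>B. smult X (c b) b)"
  let ?K = "(PiE UNIV (\<lambda>b. if b \<in> B then cball 0 C else {0}) :: ('b \<Rightarrow> 'a) set) \<inter> {c. nrm X (?F c) \<le> 1}"
  let ?U = "\<lambda>a. {c. nrm X (\<Sum>b\<in>B. smult X (c b - a b) b) < \<delta>}"
  have "continuous_on UNIV (\<lambda>c. nrm X (?F c))" using continuous_nrm_combination[OF X B(1,2), of 0] by simp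
  then have "closed {c. nrm X (?F c) \<le> 1}" by (intro closed_Collect_le continuous_intros)
  then have cK: "compact ?K" by (intro compact_Int_closed compact_coefficient_box)
  have op: "open (?U a)" for a
    by (intro open_Collect_less continuous_nrm_combination[OF X B(1,2)] continuous_intros)
  have "a \<in> ?U a" for a using \<delta> normed_spaceD(2)[OF X] by simp
  then have cov: "?K \<subseteq> (\<Union>a\<in>?K. ?U a)" by blast
  obtain A where A: "A \<subseteq> ?K" "finite A" "?K \<subseteq> (\<Union>a\<in>A. ?U a)"
    by (rule compactE_image[OF cK op cov])
  show ?thesis
  proof (rule that[of "?F ` A"])
    have "?F c \<in> M" for c unfolding MB by (intro span_sum span_scale span_base)
    then show "?F ` A \<subseteq> M" by blast
    fix x assume x: "x \<in> M" "nrm X x \<le> 1"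
    define c where "c = representation B x"
    have xc: "x = ?F c"
      using sum_representation_eq[OF B(3) _ B(1) order_refl, of x] x by (simp add: MB c_def)
    have "c b = 0" if "b \<notin> B" for b
      using representation_ne_zero[of B x b] that by (auto simp: c_def)
    moreover have "norm (c b) \<le> C" if "b \<in> B" for b
      using C(2)[OF that, of c] mult_left_mono[OF x(2), of C] C(1) unfolding xc[symmetric] by linarith
    ultimately have "c \<in> ?K" using x xc by (auto simp: PiE_def Pi_def)
    then obtain a where a: "a \<in> A" "c \<in> ?U a" using A(3) by blast
    have "x - ?F a = (\<Sum>b\<in>B. smult X (c b - a b) b)"
      by (simp add: xc sum_subtractf scale_left_diff_distrib)
    then show "\<exists>d\<in>?F ` A. nrm X (x - d) \<le> \<delta>" using a by force
  qed (use A in auto)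
qed

section \<open>Bounded operators and functionals\<close>

lemma sum_fun_apply: "(\<Sum>i\<in>I. f i) x = (\<Sum>i\<in>I. f i x)"
  by (induction I rule: infinite_finite_induct) auto

lemma linear_on_sum:
  assumes X: "normed_space X" and Y: "normed_space Y" and T: "linear_on X Y T"
    and f: "\<And>i. i \<in> I \<Longrightarrow> f i \<in> carrier X"
  shows "T (\<Sum>i\<in>I. smult X (k i) (f i)) = (\<Sum>i\<in>I. smult Y (k i) (T (f i)))"
proof -
  have add: "T (x + y) = T x + T y" if "x \<in> carrier X" "y \<in> carrier X" for x y
    using T that by (simp add: linear_on_def)
  have "T (0 + 0) = T 0 + T 0" using normed_spaceD(1)[OF X] by (intro add) auto
  then have T0: "T 0 = 0" by simp
  show ?thesis using f
  proof (induction I rule: infinite_finite_induct)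
    case (insert i I)
    have c: "smult X (k i) (f i) \<in> carrier X" "(\<Sum>i\<in>I. smult X (k i) (f i)) \<in> carrier X"
      using insert.prems by (auto intro!: nrm_sum_le[OF X] normed_spaceD(4)[OF X])
    then show ?case using insert T by (simp add: add[OF c] linear_on_def)
  qed (use T0 in auto)
qed

lemma opnorm_bounded_linear:
  fixes X :: "('k::real_or_complex, 'v::ab_group_add) nspace" and Y :: "('k, 'w::ab_group_add) nspace"
  assumes X: "normed_space X" and Y: "normed_space Y" and T: "bounded_linear_on X Y T"
  shows "x \<in> carrier X \<Longrightarrow> nrm Y (T x) \<le> opnorm X Y T * nrm X x"
    and "0 \<le> opnorm X Y T"
    and "(\<And>x. x \<in> carrier X \<Longrightarrow> nrm X x \<le> 1 \<Longrightarrow> nrm Y (T x) \<le> C) \<Longrightarrow> opnorm X Y T \<le> C"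
proof -
  let ?S = "{nrm Y (T x) | x. x \<in> carrier X \<and> nrm X x \<le> 1}"
  have op: "opnorm X Y T = Sup ?S" by (simp add: opnorm_def)
  have lin: "linear_on X Y T" using T by (simp add: bounded_linear_on_def)
  have mem: "T x \<in> carrier Y" if "x \<in> carrier X" for x using lin that by (auto simp: linear_on_def)
  have sc: "T (smult X c x) = smult Y c (T x)" if "x \<in> carrier X" for x c
    using lin that by (simp add: linear_on_def)
  have T0: "T 0 = 0" using linear_on_sum[OF X Y lin, of "{}"] by simp
  obtain C0 where C0: "\<And>x. x \<in> carrier X \<Longrightarrow> nrm Y (T x) \<le> C0 * nrm X x"
    using T by (auto simp: bounded_linear_on_def)
  have bdd: "bdd_above ?S"
  proof (rule bdd_aboveI[of _ "\<bar>C0\<bar>"], clarify)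
    fix x assume x: "x \<in> carrier X" "nrm X x \<le> 1"
    have "C0 * nrm X x \<le> \<bar>C0\<bar> * 1"
      using x normed_spaceD(5)[OF X x(1)] by (intro mult_mono) auto
    with C0[OF x(1)] show "nrm Y (T x) \<le> \<bar>C0\<bar>" by simp
  qed
  have le: "nrm Y (T x) \<le> opnorm X Y T" if "x \<in> carrier X" "nrm X x \<le> 1" for x
    unfolding op using that bdd by (intro cSup_upper) auto
  show "0 \<le> opnorm X Y T"
    using le[of 0] normed_spaceD(1,2)[OF X] T0 normed_spaceD(2)[OF Y] by simp
  show "x \<in> carrier X \<Longrightarrow> nrm Y (T x) \<le> opnorm X Y T * nrm X x"
  proof (cases "x = 0")
    case True then show ?thesis using T0 normed_spaceD(2)[OF X] normed_spaceD(2)[OF Y] by simp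
  next
    case False
    assume x: "x \<in> carrier X"
    have pos: "0 < nrm X x" using False normed_spaceD(5,6)[OF X x] by auto
    let ?c = "inverse (of_real (nrm X x)) :: 'k"
    have nc: "norm ?c = inverse (nrm X x)" using pos by (simp add: norm_inverse)
    have "nrm Y (T (smult X ?c x)) \<le> opnorm X Y T"
      using pos nc x by (intro le) (simp_all add: normed_spaceD(4,7)[OF X])
    then have "inverse (nrm X x) * nrm Y (T x) \<le> opnorm X Y T"
      by (simp add: sc[OF x] normed_spaceD(7)[OF Y mem[OF x]] nc)
    then show ?thesis using pos by (simp add: field_simps)
  qed
  show "opnorm X Y T \<le> C" if "\<And>x. x \<in> carrier X \<Longrightarrow> nrm X x \<le> 1 \<Longrightarrow> nrm Y (T x) \<le> C"
    unfolding op using that normed_spaceD(1,2)[OF X]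
    by (intro cSup_least) (auto intro!: exI[of _ 0])
qed

lemma normed_space_subset:
  assumes "normed_space X" "M \<subseteq> carrier X" "module.subspace (smult X) M"
  shows "normed_space (X\<lparr>carrier := M\<rparr>)"
  using assms unfolding normed_space_def by (auto simp: subset_iff)

lemma normed_space_FIN:
  assumes X: "normed_space X" and M: "FIN X M"
  shows "normed_space (X\<lparr>carrier := M\<rparr>)"
proof -
  interpret vector_space "smult X" using X by (rule normed_space_vs)
  show ?thesis using M by (intro normed_space_subset X) (auto simp: FIN_def)
qed

lemma linear_on_FIN_bounded:
  assumes X: "normed_space X" and Y: "normed_space Y" and M: "FIN X M"
    and T: "linear_on (X\<lparr>carrier := M\<rparr>) Y T"
  shows "bounded_linear_on (X\<lparr>carrier := M\<rparr>) Y T"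
proof -
  interpret vector_space "smult X" using X by (rule normed_space_vs)
  obtain B where B: "finite B" "B \<subseteq> carrier X" "independent B" and MB: "M = span B"
    using FIN_basis[OF X M] by blast
  obtain C where C: "0 < C" "\<And>c b. b \<in> B \<Longrightarrow> norm (c b) \<le> C * nrm X (\<Sum>b\<in>B. smult X (c b) b)"
    using coefficients_bounded[OF X B] by blast
  have BM: "b \<in> M" if "b \<in> B" for b using that by (simp add: MB span_base)
  have TB: "T b \<in> carrier Y" if "b \<in> B" for b using T BM[OF that] by (auto simp: linear_on_def)
  have "nrm Y (T x) \<le> (C * (\<Sum>b\<in>B. nrm Y (T b))) * nrm X x" if x: "x \<in> M" for x
  proof -
    define c where "c = representation B x"
    have xc: "x = (\<Sum>b\<in>B. smult X (c b) b)"
      using sum_representation_eq[OF B(3) _ B(1) order_refl, of x] x by (simp add: MB c_def)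
    then have "T x = (\<Sum>b\<in>B. smult Y (c b) (T b))"
      using linear_on_sum[OF normed_space_FIN[OF X M] Y T, of B "\<lambda>b. b" c] BM by simp
    then have "nrm Y (T x) \<le> (\<Sum>b\<in>B. nrm Y (smult Y (c b) (T b)))"
      using nrm_sum_le(2)[OF Y, of B "\<lambda>b. smult Y (c b) (T b)"] TB normed_spaceD(4)[OF Y] by simp
    also have "\<dots> = (\<Sum>b\<in>B. norm (c b) * nrm Y (T b))"
      using TB by (intro sum.cong) (auto simp: normed_spaceD(7)[OF Y])
    also have "\<dots> \<le> (\<Sum>b\<in>B. (C * nrm X x) * nrm Y (T b))"
      using C(2)[of _ c] xc TB normed_spaceD(5)[OF Y] by (intro sum_mono mult_right_mono) auto
    finally show ?thesis by (simp add: sum_distrib_left sum_distrib_right mult_ac)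
  qed
  then show ?thesis using T unfolding bounded_linear_on_def by auto
qed

text \<open>If \<open>T\<close> is bounded by \<open>c\<close> on a \<open>\<delta>\<close>-net of the unit ball, its norm \<open>t\<close> satisfies
  \<open>t \<le> c + t \<delta>\<close>.\<close>

lemma opnorm_le_of_net:
  assumes X: "normed_space X" and Y: "normed_space Y" and T: "bounded_linear_on X Y T"
    and D: "D \<subseteq> carrier X" "\<And>x. x \<in> carrier X \<Longrightarrow> nrm X x \<le> 1 \<Longrightarrow> \<exists>d\<in>D. nrm X (x - d) \<le> \<delta>"
    and c: "\<And>d. d \<in> D \<Longrightarrow> nrm Y (T d) \<le> c" and \<delta>: "\<delta> < 1"
  shows "opnorm X Y T \<le> c / (1 - \<delta>)"
proof -
  note op = opnorm_bounded_linear[OF X Y T]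
  have mem: "T x \<in> carrier Y" if "x \<in> carrier X" for x
    using T that by (auto simp: bounded_linear_on_def linear_on_def)
  have "opnorm X Y T \<le> c + opnorm X Y T * \<delta>"
  proof (rule op(3))
    fix x assume x: "x \<in> carrier X" "nrm X x \<le> 1"
    obtain d where d: "d \<in> D" "nrm X (x - d) \<le> \<delta>" using D(2)[OF x] by blast
    have dc: "d \<in> carrier X" using d D by blast
    have xd: "x - d \<in> carrier X" by (rule nrm_minus_commute(1)[OF X x(1) dc])
    have "T (d + (x - d)) = T d + T (x - d)"
      using T dc xd unfolding bounded_linear_on_def linear_on_def by blast
    then have "nrm Y (T x) \<le> nrm Y (T d) + nrm Y (T (x - d))"
      using normed_spaceD(8)[OF Y mem[OF dc] mem[OF xd]] by simp
    also have "\<dots> \<le> c + opnorm X Y T * \<delta>"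
      using c[OF d(1)] op(1)[OF xd] mult_left_mono[OF d(2) op(2)] by simp
    finally show "nrm Y (T x) \<le> c + opnorm X Y T * \<delta>" .
  qed
  then show ?thesis using \<delta> by (simp add: field_simps)
qed

lemma dualD:
  assumes "\<phi> \<in> carrier (dual X)"
  shows "x \<in> carrier X \<Longrightarrow> y \<in> carrier X \<Longrightarrow> \<phi> (x + y) = \<phi> x + \<phi> y"
    "x \<in> carrier X \<Longrightarrow> \<phi> (smult X c x) = c * \<phi> x" "x \<notin> carrier X \<Longrightarrow> \<phi> x = 0"
    "bounded_linear_on X scalars \<phi>" "linear_on X scalars \<phi>"
  using assms by (simp_all add: dual_simps bounded_linear_on_scalars bounded_linear_on_def linear_on_def scalars_simps)

lemma dualI:
  assumes "\<And>x y. x \<in> carrier X \<Longrightarrow> y \<in> carrier X \<Longrightarrow> \<phi> (x + y) = \<phi> x + \<phi> y"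
    "\<And>c x. x \<in> carrier X \<Longrightarrow> \<phi> (smult X c x) = c * \<phi> x" "\<And>x. x \<notin> carrier X \<Longrightarrow> \<phi> x = 0"
    "\<And>x. x \<in> carrier X \<Longrightarrow> norm (\<phi> x) \<le> C * nrm X x"
  shows "\<phi> \<in> carrier (dual X)"
  unfolding dual_simps bounded_linear_on_scalars
  using assms by (intro conjI ballI allI impI exI[of _ C])

lemma dual_norm_le:
  assumes X: "normed_space X" and "\<phi> \<in> carrier (dual X)" and "x \<in> carrier X"
  shows "norm (\<phi> x) \<le> nrm (dual X) \<phi> * nrm X x"
  using opnorm_dual(1)[OF X dualD(4)[OF assms(2)] assms(3)] by (simp add: dual_simps)

lemma dual_norming_element:
  assumes X: "normed_space X" and \<phi>: "\<phi> \<in> carrier (dual X)" and \<gamma>: "0 < \<gamma>"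
  obtains v where "v \<in> carrier X" "nrm X v \<le> 1" "\<phi> v = of_real (norm (\<phi> v))"
    "nrm (dual X) \<phi> \<le> norm (\<phi> v) + \<gamma>"
proof -
  have "\<exists>v\<in>carrier X. nrm X v \<le> 1 \<and> nrm (dual X) \<phi> < norm (\<phi> v) + \<gamma>"
  proof (rule ccontr)
    assume "\<not> ?thesis"
    then have "opnorm X scalars \<phi> \<le> nrm (dual X) \<phi> - \<gamma>"
      by (intro opnorm_dual(3)[OF X dualD(4)[OF \<phi>]]) force
    then show False using \<gamma> by (simp add: dual_simps)
  qed
  then obtain v where v: "v \<in> carrier X" "nrm X v \<le> 1" "nrm (dual X) \<phi> \<le> norm (\<phi> v) + \<gamma>" by force
  show ?thesis
  proof (cases "\<phi> v = 0")
    case True then show ?thesis using v that[of v] by simp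
  next
    case False
    define u where "u = of_real (norm (\<phi> v)) / \<phi> v"
    have u: "norm u = 1" using False by (simp add: u_def norm_divide)
    have "\<phi> (smult X u v) = of_real (norm (\<phi> v))"
      using False by (simp add: dualD(2)[OF \<phi> v(1)] u_def)
    then show ?thesis using v u
      by (intro that[of "smult X u v"]) (simp_all add: normed_spaceD(4,7)[OF X])
  qed
qed

section \<open>Local reflexivity\<close>

lemma bidual_embedding:
  assumes E: "normed_space E" and F: "normed_space F" and \<rho>: "isometric_iso F (bidual E) \<rho>"
  shows "x \<in> carrier F \<Longrightarrow> \<rho> x \<in> carrier (dual (dual E))"
    "x \<in> carrier F \<Longrightarrow> nrm (dual (dual E)) (\<rho> x) = nrm F x"
    "\<phi> \<in> carrier (dual E) \<Longrightarrow> linear_on F scalars (\<lambda>x. \<rho> x \<phi>)"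
    "x \<in> carrier F \<Longrightarrow> \<phi> \<in> carrier (dual E) \<Longrightarrow> norm (\<rho> x \<phi>) \<le> nrm F x * nrm (dual E) \<phi>"
proof -
  show 1: "x \<in> carrier F \<Longrightarrow> \<rho> x \<in> carrier (dual (dual E))" for x
    using \<rho> by (auto simp: isometric_iso_def bidual_def)
  show 2: "x \<in> carrier F \<Longrightarrow> nrm (dual (dual E)) (\<rho> x) = nrm F x" for x
    using \<rho> by (auto simp: isometric_iso_def bidual_def)
  show "linear_on F scalars (\<lambda>x. \<rho> x \<phi>)" if "\<phi> \<in> carrier (dual E)"
    using \<rho> by (auto simp: isometric_iso_def linear_on_def bidual_def dual_simps fscale_def scalars_simps)
  show "norm (\<rho> x \<phi>) \<le> nrm F x * nrm (dual E) \<phi>" if "x \<in> carrier F" "\<phi> \<in> carrier (dual E)"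
    using dual_norm_le[OF normed_space_dual[OF E] 1[OF that(1)] that(2)] 2[OF that(1)] by simp
qed

lemma dual_sum:
  assumes X: "normed_space X" and "\<phi> \<in> carrier (dual X)" and "\<And>i. i \<in> I \<Longrightarrow> f i \<in> carrier X"
  shows "\<phi> (\<Sum>i\<in>I. smult X (k i) (f i)) = (\<Sum>i\<in>I. k i * \<phi> (f i))"
proof -
  interpret vector_space "smult X" using X by (rule normed_space_vs)
  have sc: "normed_space (scalars :: ('a, 'a) nspace)"
    unfolding normed_space_def scalars_simps
  proof (intro conjI)
    show v: "vector_space ((*) :: 'a \<Rightarrow> 'a \<Rightarrow> 'a)" by unfold_locales (auto simp: algebra_simps)
    show "module.subspace ((*) :: 'a \<Rightarrow> 'a \<Rightarrow> 'a) UNIV"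
      using v by (simp add: module.subspace_def module_iff_vector_space)
  qed (auto simp: norm_triangle_ineq norm_mult)
  show ?thesis using linear_on_sum[OF X sc dualD(5)[OF assms(2)] assms(3)] by (simp add: scalars_simps)
qed

text \<open>An operator \<open>R\<close> is described by its values on \<open>D\<close> and by the scalars \<open>\<phi> (R x)\<close>, a point of the
  space of pairs \<open>(y, t)\<close> of an \<open>E\<close>-valued and a scalar function. Let \<open>Q (y, t)\<close> be the distance of
  \<open>(y, t)\<close> to the points described by operators, with \<open>c\<close> and \<open>\<delta>\<close> as units of length. The claim
  is implied by \<open>Q v < 1\<close>, where \<open>v\<close> has zero values on \<open>D\<close> and the desired scalars \<open>\<rho> x \<phi>\<close>.

  If \<open>1 \<le> Q v\<close>, take a functional \<open>h\<close> dominated by \<open>Q\<close> with \<open>h v = Q v\<close>. It consists of functionals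
  \<open>\<theta> d\<close> on \<open>E\<close> and scalars \<open>a\<close>, and it vanishes on all operators. The rank one operators turn this
  into linear relations in the dual of \<open>E\<close>; applying elements of the bidual to them shows that \<open>h\<close> also
  vanishes on the inclusion of \<open>M\<close> into the bidual. Hence \<open>h v = - (\<Sum>d\<in>D. \<rho> d (\<theta> d))\<close>, which is at
  most the sum of the norms of the \<open>\<theta> d\<close>, and domination by \<open>Q\<close> bounds this sum by \<open>1 / c < 1\<close>.\<close>

lemma helly_on_net:
  fixes E :: "('k::real_or_complex, 'v::ab_group_add) nspace" and F :: "('k, 'w::ab_group_add) nspace"
  assumes E: "normed_space E" and F: "normed_space F" and \<rho>: "isometric_iso F (bidual E) \<rho>"
    and M: "FIN F M" and D: "finite D" "D \<subseteq> M" "\<And>d. d \<in> D \<Longrightarrow> nrm F d \<le> 1"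
    and \<Phi>: "finite \<Phi>" "\<Phi> \<subseteq> carrier (dual E)" and Z: "finite Z" "Z \<subseteq> M"
    and \<delta>: "0 < \<delta>" and c: "1 < c"
  obtains R where "linear_on (F\<lparr>carrier := M\<rparr>) E R" "\<And>d. d \<in> D \<Longrightarrow> nrm E (R d) \<le> c"
    "\<And>\<phi> x. \<phi> \<in> \<Phi> \<Longrightarrow> x \<in> Z \<Longrightarrow> norm (\<rho> x \<phi> - \<phi> (R x)) \<le> \<delta>"
proof (rule ccontr)
  assume neg: "\<not> thesis"
  interpret E: vector_space "smult E" using E by (rule normed_space_vs)
  interpret F: vector_space "smult F" using F by (rule normed_space_vs)
  obtain B where B: "finite B" "B \<subseteq> carrier F" "F.independent B" and MB: "M = F.span B"
    using FIN_basis[OF F M] by blast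
  have MF: "M \<subseteq> carrier F" using M by (simp add: FIN_def)
  define L where "L = {R. linear_on (F\<lparr>carrier := M\<rparr>) E R}"
  have LE: "R x \<in> carrier E" if "R \<in> L" "x \<in> M" for R x using that by (auto simp: L_def linear_on_def)
  have L0: "(\<lambda>_. 0) \<in> L" using normed_spaceD(1)[OF E] by (auto simp: L_def linear_on_def)
  have Ladd: "(\<lambda>x. R x + R' x) \<in> L" if "R \<in> L" "R' \<in> L" for R R'
    using that unfolding L_def linear_on_def
    by (auto simp: E.scale_right_distrib algebra_simps intro!: normed_spaceD(3)[OF E])
  have Lsc: "(\<lambda>x. smult E k (R x)) \<in> L" if "R \<in> L" for k R
    using that unfolding L_def linear_on_def
    by (auto simp: E.scale_right_distrib mult.commute intro!: normed_spaceD(4)[OF E])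
  note Eadd = normed_spaceD(3)[OF E] and Esc = normed_spaceD(4)[OF E]
    and E0 = normed_spaceD(1)[OF E] and Ediff = nrm_minus_commute(1)[OF E]
  have \<Phi>0: "\<phi> 0 = 0" if "\<phi> \<in> \<Phi>" for \<phi> using \<Phi> that dual_sum[OF E, of \<phi> "{}"] by auto
  have \<Phi>0_le: "norm (\<phi> 0) \<le> r" if "\<phi> \<in> \<Phi>" "0 \<le> r" for \<phi> r using \<Phi>0[OF that(1)] that(2) by simp
  have c_cancel: "inverse c * t * c = t" for t using c by simp
  define s where "s = (\<lambda>k (y :: 'w \<Rightarrow> 'v, t :: ('v \<Rightarrow> 'k) \<times> 'w \<Rightarrow> 'k). (\<lambda>d. smult E k (y d), \<lambda>z. k * t z))"
  define S :: "(('w \<Rightarrow> 'v) \<times> (('v \<Rightarrow> 'k) \<times> 'w \<Rightarrow> 'k)) set" where "S = {w. \<forall>d. fst w d \<in> carrier E}"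
  have vs: "vector_space s"
    by unfold_locales (auto simp: s_def fun_eq_iff E.scale_right_distrib E.scale_left_distrib algebra_simps)
  then interpret V: vector_space s .
  have S: "V.subspace S" unfolding V.subspace_def S_def by (auto simp: s_def E0 Eadd Esc)
  \<comment> \<open>\<open>G w \<tau> R\<close>: the operator \<open>R\<close> is within distance \<open>\<tau>\<close> of \<open>w\<close>.\<close>
  define G where "G w \<tau> R \<longleftrightarrow> 0 \<le> \<tau> \<and> R \<in> L \<and> (\<forall>d\<in>D. nrm E (fst w d - R d) \<le> \<tau> * c) \<and>
    (\<forall>\<phi>\<in>\<Phi>. \<forall>x\<in>Z. norm (snd w (\<phi>, x) - \<phi> (R x)) \<le> \<tau> * \<delta>)" for w \<tau> R
  define T where "T w = {\<tau>. \<exists>R. G w \<tau> R}" for w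
  define Q where "Q w = Inf (T w)" for w
  have bdd: "bdd_below (T w)" for w by (auto simp: T_def G_def intro!: bdd_belowI[of _ 0])
  have Qle: "Q w \<le> \<tau>" if "G w \<tau> R" for w \<tau> R
    unfolding Q_def using that bdd by (intro cInf_lower) (auto simp: T_def)
  have ne: "T w \<noteq> {}" if w: "w \<in> S" for w
  proof -
    let ?a = "\<Sum>d\<in>D. nrm E (fst w d)" and ?b = "\<Sum>z\<in>\<Phi> \<times> Z. norm (snd w z)"
    have a: "nrm E (fst w d) \<le> ?a" "0 \<le> ?a" if "d \<in> D" for d
      using w D(1) that normed_spaceD(5)[OF E] by (auto simp: S_def intro!: member_le_sum sum_nonneg)
    have a0: "0 \<le> ?a" using w normed_spaceD(5)[OF E] by (auto simp: S_def intro!: sum_nonneg)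
    have b: "norm (snd w (\<phi>, x)) \<le> ?b" if "\<phi> \<in> \<Phi>" "x \<in> Z" for \<phi> x
      using that \<Phi>(1) Z(1) member_le_sum[of "(\<phi>, x)" "\<Phi> \<times> Z" "\<lambda>z. norm (snd w z)"] by auto
    have b0: "0 \<le> ?b" by (intro sum_nonneg) auto
    have "G w (?a / c + ?b / \<delta>) (\<lambda>_. 0)" unfolding G_def
    proof (intro conjI ballI)
      fix d assume "d \<in> D"
      then have "nrm E (fst w d - 0) \<le> ?a" using a by simp
      also have "?a \<le> ?a + ?b / \<delta> * c" using b0 c \<delta> by simp
      also have "\<dots> = (?a / c + ?b / \<delta>) * c" using c by (simp add: distrib_right)
      finally show "nrm E (fst w d - 0) \<le> (?a / c + ?b / \<delta>) * c" .
    next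
      fix \<phi> x assume "\<phi> \<in> \<Phi>" "x \<in> Z"
      then have "norm (snd w (\<phi>, x) - \<phi> 0) \<le> ?b" using b[of \<phi> x] \<Phi>0[of \<phi>] by simp
      also have "?b \<le> ?b + ?a / c * \<delta>" using a0 c \<delta> by simp
      also have "\<dots> = (?a / c + ?b / \<delta>) * \<delta>" using \<delta> by (simp add: distrib_right)
      finally show "norm (snd w (\<phi>, x) - \<phi> 0) \<le> (?a / c + ?b / \<delta>) * \<delta>" .
    qed (use L0 a0 b0 c \<delta> in auto)
    then show ?thesis by (auto simp: T_def)
  qed
  have Qge: "a \<le> Q w" if "w \<in> S" "\<And>\<tau> R. G w \<tau> R \<Longrightarrow> a \<le> \<tau>" for a w
    unfolding Q_def using that ne by (intro cInf_greatest) (auto simp: T_def)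
  have Gadd: "G (w + w') (\<tau> + \<tau>') (\<lambda>x. R x + R' x)"
    if w: "w \<in> S" and w': "w' \<in> S" and g: "G w \<tau> R" "G w' \<tau>' R'" for w w' \<tau> \<tau>' R R'
    unfolding G_def
  proof (intro conjI ballI)
    fix d assume d: "d \<in> D"
    then have "d \<in> M" using D by blast
    then have m: "fst w d - R d \<in> carrier E" "fst w' d - R' d \<in> carrier E"
      using w w' g LE by (auto simp: S_def G_def intro!: Ediff)
    have eq: "fst (w + w') d - (R d + R' d) = (fst w d - R d) + (fst w' d - R' d)" by simp
    have "nrm E (fst w d - R d) \<le> \<tau> * c" "nrm E (fst w' d - R' d) \<le> \<tau>' * c"
      using g d by (auto simp: G_def)
    then show "nrm E (fst (w + w') d - (R d + R' d)) \<le> (\<tau> + \<tau>') * c"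
      unfolding eq distrib_right using normed_spaceD(8)[OF E m] by linarith
  next
    fix \<phi> x assume z: "\<phi> \<in> \<Phi>" "x \<in> Z"
    then have "\<phi> (R x + R' x) = \<phi> (R x) + \<phi> (R' x)"
      using g LE \<Phi> Z by (intro dualD(1)[of \<phi> E]) (auto simp: G_def)
    then have "snd (w + w') (\<phi>, x) - \<phi> (R x + R' x) =
      (snd w (\<phi>, x) - \<phi> (R x)) + (snd w' (\<phi>, x) - \<phi> (R' x))" by simp
    moreover have "norm (snd w (\<phi>, x) - \<phi> (R x)) \<le> \<tau> * \<delta>" "norm (snd w' (\<phi>, x) - \<phi> (R' x)) \<le> \<tau>' * \<delta>"
      using g z by (auto simp: G_def)
    ultimately show "norm (snd (w + w') (\<phi>, x) - \<phi> (R x + R' x)) \<le> (\<tau> + \<tau>') * \<delta>"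
      unfolding distrib_right by (metis norm_triangle_mono)
  qed (use g Ladd in \<open>auto simp: G_def\<close>)
  have Qadd: "Q (w + w') \<le> Q w + Q w'" if w: "w \<in> S" and w': "w' \<in> S" for w w'
  proof -
    have "Q (w + w') - \<tau> \<le> Q w'" if "G w \<tau> R" for \<tau> R
      using Qle[OF Gadd[OF w w' that]] by (intro Qge[OF w']) (auto simp: algebra_simps)
    then have "Q (w + w') - Q w' \<le> Q w" by (intro Qge[OF w]) (auto simp: algebra_simps)
    then show ?thesis by simp
  qed
  have Gsc: "G (s k w) (norm k * \<tau>) (\<lambda>x. smult E k (R x))" if w: "w \<in> S" and g: "G w \<tau> R" for k w \<tau> R
    unfolding G_def
  proof (intro conjI ballI)
    fix d assume d: "d \<in> D"
    then have "d \<in> M" using D by blast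
    then have m: "fst w d - R d \<in> carrier E"
      using w g LE by (auto simp: S_def G_def intro!: Ediff)
    have "fst (s k w) d - smult E k (R d) = smult E k (fst w d - R d)"
      by (simp add: s_def case_prod_beta E.scale_right_diff_distrib)
    then have "nrm E (fst (s k w) d - smult E k (R d)) = norm k * nrm E (fst w d - R d)"
      using normed_spaceD(7)[OF E m] by simp
    also have "\<dots> \<le> norm k * (\<tau> * c)" using g d by (intro mult_left_mono) (auto simp: G_def)
    finally show "nrm E (fst (s k w) d - smult E k (R d)) \<le> norm k * \<tau> * c" by simp
  next
    fix \<phi> x assume z: "\<phi> \<in> \<Phi>" "x \<in> Z"
    then have "\<phi> (smult E k (R x)) = k * \<phi> (R x)"
      using g LE \<Phi> Z by (intro dualD(2)[of \<phi> E]) (auto simp: G_def)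
    then have "snd (s k w) (\<phi>, x) - \<phi> (smult E k (R x)) = k * (snd w (\<phi>, x) - \<phi> (R x))"
      by (simp add: s_def case_prod_beta algebra_simps)
    then have "norm (snd (s k w) (\<phi>, x) - \<phi> (smult E k (R x))) = norm k * norm (snd w (\<phi>, x) - \<phi> (R x))"
      by (simp add: norm_mult)
    also have "\<dots> \<le> norm k * (\<tau> * \<delta>)" using g z by (intro mult_left_mono) (auto simp: G_def)
    finally show "norm (snd (s k w) (\<phi>, x) - \<phi> (smult E k (R x))) \<le> norm k * \<tau> * \<delta>" by simp
  qed (use g Lsc in \<open>auto simp: G_def\<close>)
  have Q_nonneg: "0 \<le> Q w" if "w \<in> S" for w using that by (intro Qge) (auto simp: G_def)
  have Qsc_le: "Q (s k w) \<le> norm k * Q w" if w: "w \<in> S" and k: "k \<noteq> 0" for k w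
  proof -
    have "inverse (norm k) * Q (s k w) \<le> Q w"
      using Qle[OF Gsc[OF w]] k by (intro Qge[OF w]) (simp add: field_simps)
    then show ?thesis using k by (simp add: field_simps)
  qed
  have Qsc: "Q (s k w) = norm k * Q w" if w: "w \<in> S" for k w
  proof (cases "k = 0")
    case True
    obtain \<tau> R where "G w \<tau> R" using ne[OF w] by (auto simp: T_def)
    then have "Q (s 0 w) \<le> 0" using Qle[OF Gsc[OF w, of \<tau> R 0]] by simp
    moreover have "0 \<le> Q (s 0 w)" by (intro Q_nonneg V.subspace_scale[OF S w])
    ultimately show ?thesis using True by simp
  next
    case False
    have "Q (s (inverse k) (s k w)) \<le> norm (inverse k) * Q (s k w)"
      using False by (intro Qsc_le V.subspace_scale[OF S w]) auto
    then have "norm k * Q w \<le> Q (s k w)" using False by (simp add: norm_divide field_simps)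
    then show ?thesis using Qsc_le[OF w False] by simp
  qed
  define v where "v = ((\<lambda>_ :: 'w. 0 :: 'v), \<lambda>(\<phi>, x). if \<phi> \<in> \<Phi> \<and> x \<in> Z then \<rho> x \<phi> else 0)"
  have v: "v \<in> S" by (simp add: v_def S_def E0)
  have Qv: "1 \<le> Q v"
  proof (rule Qge[OF v], rule ccontr)
    fix \<tau> R assume g: "G v \<tau> R" and "\<not> 1 \<le> \<tau>"
    then have \<tau>: "\<tau> * c \<le> c" "\<tau> * \<delta> \<le> \<delta>" using c \<delta> by auto
    have "nrm E (R d) \<le> c" if "d \<in> D" for d
    proof -
      have "R d \<in> carrier E" using g that D LE by (auto simp: G_def)
      then have "nrm E (R d) = nrm E (0 - R d)" using nrm_minus_commute(2)[OF E _ E0] by force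
      then show ?thesis using g that \<tau> by (force simp: G_def v_def)
    qed
    moreover have "norm (\<rho> x \<phi> - \<phi> (R x)) \<le> \<delta>" if "\<phi> \<in> \<Phi>" "x \<in> Z" for \<phi> x
      using g that \<tau> by (force simp: G_def v_def)
    ultimately show False using g neg that[of R] by (auto simp: G_def L_def)
  qed
  obtain h where hadd: "\<And>x y. x \<in> S \<Longrightarrow> y \<in> S \<Longrightarrow> h (x + y) = h x + h y"
    and hsc: "\<And>k x. x \<in> S \<Longrightarrow> h (s k x) = k * h x" and hQ: "\<And>x. x \<in> S \<Longrightarrow> norm (h x) \<le> Q x"
    and hv: "h v = of_real (Q v)"
    using hahn_banach_seminorm[OF vs S Qadd Qsc v] by metis
  have h0: "h 0 = 0" using hsc[of 0 0] V.subspace_0[OF S] by simp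
  define \<theta> where "\<theta> d u = (if u \<in> carrier E then h (\<lambda>d'. if d' = d then u else 0, \<lambda>_. 0) else 0)" for d u
  define a where "a z = h (\<lambda>_. 0, \<lambda>z'. if z' = z then 1 else 0)" for z
  have decomp_y: "h (\<lambda>d. if d \<in> D' then y d else 0, \<lambda>_. 0) = (\<Sum>d\<in>D'. \<theta> d (y d))"
    if "finite D'" "\<And>d. d \<in> D' \<Longrightarrow> y d \<in> carrier E" for D' y
    using that
  proof (induction D')
    case empty then show ?case using h0 by (simp add: zero_prod_def zero_fun_def)
  next
    case (insert d D')
    have eq: "(\<lambda>d'. if d' \<in> insert d D' then y d' else 0, \<lambda>_. 0 :: 'k) =
      (\<lambda>d'. if d' = d then y d else 0, \<lambda>_. 0) + (\<lambda>d'. if d' \<in> D' then y d' else 0, \<lambda>_. 0)"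
      using insert.hyps by (auto simp: fun_eq_iff)
    have "h (\<lambda>d'. if d' \<in> insert d D' then y d' else 0, \<lambda>_. 0) =
      h (\<lambda>d'. if d' = d then y d else 0, \<lambda>_. 0) + h (\<lambda>d'. if d' \<in> D' then y d' else 0, \<lambda>_. 0)"
      unfolding eq using insert.prems by (intro hadd) (auto simp: S_def E0)
    also have "h (\<lambda>d'. if d' = d then y d else 0, \<lambda>_. 0) = \<theta> d (y d)"
      using insert.prems by (simp add: \<theta>_def)
    finally show ?case using insert by simp
  qed
  have decomp_t: "h (\<lambda>_. 0, \<lambda>z. if z \<in> I then t z else 0) = (\<Sum>z\<in>I. t z * a z)"
    if "finite I" for I t
    using that
  proof (induction I)
    case empty then show ?case using h0 by (simp add: zero_prod_def zero_fun_def)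
  next
    case (insert z I)
    have eq: "(\<lambda>_. 0 :: 'v, \<lambda>z'. if z' \<in> insert z I then t z' else 0) =
      s (t z) (\<lambda>_. 0, \<lambda>z'. if z' = z then 1 else 0) + (\<lambda>_. 0, \<lambda>z'. if z' \<in> I then t z' else 0)"
      using insert.hyps by (auto simp: fun_eq_iff s_def)
    have "h (\<lambda>_. 0, \<lambda>z'. if z' \<in> insert z I then t z' else 0) =
      h (s (t z) (\<lambda>_. 0, \<lambda>z'. if z' = z then 1 else 0)) + h (\<lambda>_. 0, \<lambda>z'. if z' \<in> I then t z' else 0)"
      unfolding eq by (intro hadd V.subspace_scale[OF S]) (auto simp: S_def E0)
    also have "h (s (t z) (\<lambda>_. 0, \<lambda>z'. if z' = z then 1 else 0)) = t z * a z"
      unfolding a_def by (intro hsc) (simp add: S_def E0)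
    finally show ?case using insert by simp
  qed
  have \<theta>: "\<theta> d \<in> carrier (dual E)" if d: "d \<in> D" for d
  proof (rule dualI[where C = "inverse c"])
    fix u u' assume u: "u \<in> carrier E" "u' \<in> carrier E"
    have eq: "(\<lambda>d'. if d' = d then u + u' else 0, \<lambda>_. 0 :: 'k) =
      (\<lambda>d'. if d' = d then u else 0, \<lambda>_. 0) + (\<lambda>d'. if d' = d then u' else 0, \<lambda>_. 0)"
      by (auto simp: fun_eq_iff)
    have "h (\<lambda>d'. if d' = d then u + u' else 0, \<lambda>_. 0) =
      h (\<lambda>d'. if d' = d then u else 0, \<lambda>_. 0) + h (\<lambda>d'. if d' = d then u' else 0, \<lambda>_. 0)"
      unfolding eq using u by (intro hadd) (auto simp: S_def E0)
    then show "\<theta> d (u + u') = \<theta> d u + \<theta> d u'" using u by (simp add: \<theta>_def Eadd)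
  next
    fix k u assume u: "u \<in> carrier E"
    have eq: "(\<lambda>d'. if d' = d then smult E k u else 0, \<lambda>_. 0 :: 'k) = s k (\<lambda>d'. if d' = d then u else 0, \<lambda>_. 0)"
      by (auto simp: fun_eq_iff s_def)
    have "h (\<lambda>d'. if d' = d then smult E k u else 0, \<lambda>_. 0) = k * h (\<lambda>d'. if d' = d then u else 0, \<lambda>_. 0)"
      unfolding eq using u by (intro hsc) (auto simp: S_def E0)
    then show "\<theta> d (smult E k u) = k * \<theta> d u" using u by (simp add: \<theta>_def Esc)
  next
    fix u assume u: "u \<in> carrier E"
    have "G (\<lambda>d'. if d' = d then u else 0, \<lambda>_. 0) (inverse c * nrm E u) (\<lambda>_. 0)"
      using L0 c normed_spaceD(2)[OF E] normed_spaceD(5)[OF E u] \<delta>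
      by (auto simp: G_def c_cancel intro!: \<Phi>0_le)
    then have "Q (\<lambda>d'. if d' = d then u else 0, \<lambda>_. 0) \<le> inverse c * nrm E u" by (rule Qle)
    moreover have "norm (h (\<lambda>d'. if d' = d then u else 0, \<lambda>_. 0)) \<le> Q (\<lambda>d'. if d' = d then u else 0, \<lambda>_. 0)"
      using u by (intro hQ) (auto simp: S_def E0)
    ultimately show "norm (\<theta> d u) \<le> inverse c * nrm E u" using u by (simp add: \<theta>_def)
  qed (simp add: \<theta>_def)
  have vanish: "(\<Sum>d\<in>D. \<theta> d (R d)) + (\<Sum>z\<in>\<Phi> \<times> Z. fst z (R (snd z)) * a z) = 0" if R: "R \<in> L" for R
  proof -
    let ?y = "\<lambda>d. if d \<in> D then R d else 0" and ?t = "\<lambda>z. if z \<in> \<Phi> \<times> Z then fst z (R (snd z)) else 0"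
    have RE: "R d \<in> carrier E" if "d \<in> D" for d using LE[OF R] D that by blast
    have S1: "(?y, ?t) \<in> S" "(?y, \<lambda>_. 0) \<in> S" "(\<lambda>_. 0, ?t) \<in> S" using RE by (auto simp: S_def E0)
    have "G (?y, ?t) 0 R" using R normed_spaceD(2)[OF E] by (auto simp: G_def)
    then have "norm (h (?y, ?t)) \<le> 0" using Qle hQ[OF S1(1)] order_trans by blast
    moreover have eq: "(?y, ?t) = (?y, \<lambda>_. 0) + (\<lambda>_. 0, ?t)" by (auto simp: fun_eq_iff)
    have "h (?y, ?t) = h (?y, \<lambda>_. 0) + h (\<lambda>_. 0, ?t)" by (subst eq) (rule hadd[OF S1(2,3)])
    ultimately have "h (?y, \<lambda>_. 0) + h (\<lambda>_. 0, ?t) = 0" by simp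
    then show ?thesis using decomp_y[OF D(1) RE] decomp_t[of "\<Phi> \<times> Z"] \<Phi>(1) Z(1) by simp
  qed
  let ?rep = "F.representation B"
  \<comment> \<open>The operator \<open>x \<mapsto> b\<^sup>* x e\<close> for a coordinate functional \<open>b\<^sup>*\<close> of the basis.\<close>
  have rank_one: "(\<lambda>x. smult E (?rep x b) e) \<in> L" if "e \<in> carrier E" for b e
    using that B(3) unfolding L_def linear_on_def MB
    by (auto simp: F.representation_add F.representation_scale E.scale_left_distrib Esc)
  have D': "normed_space (dual E)" by (rule normed_space_dual[OF E])
  \<comment> \<open>The relation that expresses that \<open>h\<close> vanishes on the rank one operators belonging to \<open>b\<close>.\<close>
  have functional: "(\<Sum>d\<in>D. fscale (?rep d b) (\<theta> d)) + (\<Sum>z\<in>\<Phi> \<times> Z. fscale (?rep (snd z) b * a z) (fst z)) = 0" for b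
  proof
    fix e
    show "((\<Sum>d\<in>D. fscale (?rep d b) (\<theta> d)) + (\<Sum>z\<in>\<Phi> \<times> Z. fscale (?rep (snd z) b * a z) (fst z))) e = 0 e"
    proof (cases "e \<in> carrier E")
      case True
      have "\<theta> d (smult E k e) = k * \<theta> d e" if "d \<in> D" for k d using dualD(2)[OF \<theta>[OF that] True] .
      moreover have "fst z (smult E k e) = k * fst z e" if "z \<in> \<Phi> \<times> Z" for k z
        using \<Phi> that by (intro dualD(2)[OF _ True]) auto
      ultimately show ?thesis using vanish[OF rank_one[OF True, of b]]
        by (simp add: sum_fun_apply fscale_def mult_ac)
    next
      case False
      have "\<theta> d e = 0" for d using False by (simp add: \<theta>_def)
      moreover have "fst z e = 0" if "z \<in> \<Phi> \<times> Z" for z using \<Phi> that False dualD(3) by (metis mem_Times_iff subsetD)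
      ultimately show ?thesis by (simp add: sum_fun_apply fscale_def)
    qed
  qed
  have expand: "\<rho> x \<phi> = (\<Sum>b\<in>B. ?rep x b * \<rho> b \<phi>)" if x: "x \<in> M" and \<phi>: "\<phi> \<in> carrier (dual E)" for x \<phi>
  proof -
    let ?\<phi> = "\<lambda>x. if x \<in> carrier F then \<rho> x \<phi> else 0"
    note be = bidual_embedding[OF E F \<rho>]
    have "?\<phi> \<in> carrier (dual F)"
    proof (rule dualI[where C = "nrm (dual E) \<phi>"])
      show "norm (?\<phi> x) \<le> nrm (dual E) \<phi> * nrm F x" if "x \<in> carrier F" for x
        using be(4)[OF that \<phi>] that by (simp add: mult.commute)
    qed (use be(3)[OF \<phi>] in \<open>auto simp: linear_on_def scalars_simps normed_spaceD(3,4)[OF F]\<close>)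
    then have "?\<phi> (\<Sum>b\<in>B. smult F (?rep x b) b) = (\<Sum>b\<in>B. ?rep x b * ?\<phi> b)"
      using B(2) by (intro dual_sum[OF F]) auto
    moreover have "(\<Sum>b\<in>B. smult F (?rep x b) b) = x"
      using F.sum_representation_eq[OF B(3) _ B(1) order_refl, of x] x by (simp add: MB)
    moreover have "(\<Sum>b\<in>B. ?rep x b * ?\<phi> b) = (\<Sum>b\<in>B. ?rep x b * \<rho> b \<phi>)"
      using B(2) by (intro sum.cong) auto
    ultimately show ?thesis using x MF by auto
  qed
  have "(\<Sum>d\<in>D. ?rep d b * \<rho> b (\<theta> d)) + (\<Sum>z\<in>\<Phi> \<times> Z. ?rep (snd z) b * a z * \<rho> b (fst z)) = 0" if b: "b \<in> B" for b
  proof -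
    have \<rho>b: "\<rho> b \<in> carrier (dual (dual E))" using bidual_embedding(1)[OF E F \<rho>] B(2) b by blast
    let ?p = "\<Sum>d\<in>D. fscale (?rep d b) (\<theta> d)" and ?q = "\<Sum>z\<in>\<Phi> \<times> Z. fscale (?rep (snd z) b * a z) (fst z)"
    have sm: "smult (dual E) = fscale" by (simp add: dual_simps)
    have p: "?p \<in> carrier (dual E)" "\<rho> b ?p = (\<Sum>d\<in>D. ?rep d b * \<rho> b (\<theta> d))"
      using dual_sum[OF D' \<rho>b \<theta>, of D "\<lambda>d. d" "\<lambda>d. ?rep d b"] \<theta>
        nrm_sum_le(1)[OF D', of D "\<lambda>d. smult (dual E) (?rep d b) (\<theta> d)"] normed_spaceD(4)[OF D']
      by (simp_all add: sm)
    have z: "fst z \<in> carrier (dual E)" if "z \<in> \<Phi> \<times> Z" for z using \<Phi> that by auto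
    have q: "?q \<in> carrier (dual E)" "\<rho> b ?q = (\<Sum>z\<in>\<Phi> \<times> Z. ?rep (snd z) b * a z * \<rho> b (fst z))"
      using dual_sum[OF D' \<rho>b z, of "\<Phi> \<times> Z" "\<lambda>d. d" "\<lambda>z. ?rep (snd z) b * a z"] z
        nrm_sum_le(1)[OF D', of "\<Phi> \<times> Z" "\<lambda>z. smult (dual E) (?rep (snd z) b * a z) (fst z)"] normed_spaceD(4)[OF D']
      by (simp_all add: sm)
    have "\<rho> b (?p + ?q) = \<rho> b ?p + \<rho> b ?q" by (rule dualD(1)[OF \<rho>b p(1) q(1)])
    moreover have "\<rho> b 0 = 0" using dual_sum[OF D' \<rho>b, of "{}"] by simp
    ultimately show ?thesis using functional[of b] p(2) q(2) by simp
  qed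
  then have "(\<Sum>b\<in>B. (\<Sum>d\<in>D. ?rep d b * \<rho> b (\<theta> d)) + (\<Sum>z\<in>\<Phi> \<times> Z. ?rep (snd z) b * a z * \<rho> b (fst z))) = 0"
    by simp
  then have "(\<Sum>d\<in>D. \<Sum>b\<in>B. ?rep d b * \<rho> b (\<theta> d)) +
      (\<Sum>z\<in>\<Phi> \<times> Z. \<Sum>b\<in>B. ?rep (snd z) b * a z * \<rho> b (fst z)) = 0"
    by (simp add: sum.distrib sum.swap[of _ _ B])
  moreover have "(\<Sum>d\<in>D. \<Sum>b\<in>B. ?rep d b * \<rho> b (\<theta> d)) = (\<Sum>d\<in>D. \<rho> d (\<theta> d))"
    using D \<theta> by (intro sum.cong expand[symmetric]) auto
  moreover have "(\<Sum>z\<in>\<Phi> \<times> Z. \<Sum>b\<in>B. ?rep (snd z) b * a z * \<rho> b (fst z)) =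
      (\<Sum>z\<in>\<Phi> \<times> Z. \<rho> (snd z) (fst z) * a z)"
  proof (intro sum.cong refl)
    fix z assume "z \<in> \<Phi> \<times> Z"
    then have "\<rho> (snd z) (fst z) = (\<Sum>b\<in>B. ?rep (snd z) b * \<rho> b (fst z))"
      using \<Phi> Z by (intro expand) auto
    then show "(\<Sum>b\<in>B. ?rep (snd z) b * a z * \<rho> b (fst z)) = \<rho> (snd z) (fst z) * a z"
      by (simp add: sum_distrib_left sum_distrib_right mult_ac)
  qed
  moreover have "h v = (\<Sum>z\<in>\<Phi> \<times> Z. \<rho> (snd z) (fst z) * a z)"
  proof -
    have "v = (\<lambda>_. 0, \<lambda>z. if z \<in> \<Phi> \<times> Z then \<rho> (snd z) (fst z) else 0)"
      by (auto simp: v_def fun_eq_iff)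
    then show ?thesis using decomp_t[of "\<Phi> \<times> Z"] \<Phi>(1) Z(1) by simp
  qed
  ultimately have hv': "h v = - (\<Sum>d\<in>D. \<rho> d (\<theta> d))" by (simp add: eq_neg_iff_add_eq_0 add.commute)
  have "norm (h v) \<le> (\<Sum>d\<in>D. nrm (dual E) (\<theta> d))"
  proof -
    have "norm (\<rho> d (\<theta> d)) \<le> nrm (dual E) (\<theta> d)" if d: "d \<in> D" for d
    proof -
      have "norm (\<rho> d (\<theta> d)) \<le> nrm F d * nrm (dual E) (\<theta> d)"
        using d D MF \<theta> by (intro bidual_embedding(4)[OF E F \<rho>]) auto
      also have "\<dots> \<le> 1 * nrm (dual E) (\<theta> d)"
        using D(3)[OF d] normed_spaceD(5)[OF D' \<theta>[OF d]] by (intro mult_right_mono) auto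
      finally show ?thesis by simp
    qed
    then show ?thesis unfolding hv' by (auto intro: sum_norm_le)
  qed
  moreover have "(\<Sum>d\<in>D. nrm (dual E) (\<theta> d)) \<le> inverse c"
  proof (rule field_le_epsilon)
    fix e :: real assume e: "0 < e"
    define \<gamma> where "\<gamma> = e / (real (card D) + 1)"
    have \<gamma>: "0 < \<gamma>" "real (card D) * \<gamma> \<le> e" using e by (auto simp: \<gamma>_def field_simps)
    have "\<exists>u. u \<in> carrier E \<and> nrm E u \<le> 1 \<and> \<theta> d u = of_real (norm (\<theta> d u)) \<and>
        nrm (dual E) (\<theta> d) \<le> norm (\<theta> d u) + \<gamma>" if "d \<in> D" for d
      using dual_norming_element[OF E \<theta>[OF that] \<gamma>(1)] by metis
    then obtain u where u: "\<And>d. d \<in> D \<Longrightarrow> u d \<in> carrier E" "\<And>d. d \<in> D \<Longrightarrow> nrm E (u d) \<le> 1"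
      "\<And>d. d \<in> D \<Longrightarrow> \<theta> d (u d) = of_real (norm (\<theta> d (u d)))"
      "\<And>d. d \<in> D \<Longrightarrow> nrm (dual E) (\<theta> d) \<le> norm (\<theta> d (u d)) + \<gamma>"
      by metis
    let ?w = "(\<lambda>d. if d \<in> D then u d else 0, \<lambda>_. 0 :: 'k)"
    have "G ?w (inverse c) (\<lambda>_. 0)"
      using u L0 c \<delta> by (auto simp: G_def intro!: \<Phi>0_le)
    then have "Q ?w \<le> inverse c" by (rule Qle)
    moreover have "norm (h ?w) \<le> Q ?w" using u(1) by (intro hQ) (auto simp: S_def E0)
    ultimately have "norm (h ?w) \<le> inverse c" by simp
    moreover have "h ?w = (\<Sum>d\<in>D. \<theta> d (u d))" by (rule decomp_y[OF D(1) u(1)])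
    also have "\<dots> = of_real (\<Sum>d\<in>D. norm (\<theta> d (u d)))" using u(3) by (simp add: of_real_sum)
    ultimately have "(\<Sum>d\<in>D. norm (\<theta> d (u d))) \<le> inverse c" by (simp only: norm_of_real)
    moreover have "(\<Sum>d\<in>D. nrm (dual E) (\<theta> d)) \<le> (\<Sum>d\<in>D. norm (\<theta> d (u d))) + real (card D) * \<gamma>"
      using sum_mono[of D "\<lambda>d. nrm (dual E) (\<theta> d)" "\<lambda>d. norm (\<theta> d (u d)) + \<gamma>"] u(4) by (simp add: sum.distrib)
    ultimately show "(\<Sum>d\<in>D. nrm (dual E) (\<theta> d)) \<le> inverse c + e" using \<gamma>(2) by simp
  qed
  ultimately have "Q v \<le> inverse c" using Qv by (simp add: hv)
  moreover have "inverse c < 1" using c by (simp add: field_simps)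
  ultimately show False using Qv by simp
qed

text \<open>The bound on the norm of \<open>R\<close> is distributed evenly: \<open>sqrt c\<close> on a net of the unit ball, and
  another factor \<open>sqrt c\<close> for passing from the net to the whole ball.\<close>

lemma local_reflexivity:
  assumes E: "normed_space E" and F: "normed_space F" and \<rho>: "isometric_iso F (bidual E) \<rho>"
    and M: "FIN F M" and \<Phi>: "finite \<Phi>" "\<Phi> \<subseteq> carrier (dual E)" and Z: "finite Z" "Z \<subseteq> M"
    and \<delta>: "0 < \<delta>" and c: "1 < c"
  obtains R where "bounded_linear_on (F\<lparr>carrier := M\<rparr>) E R" "opnorm (F\<lparr>carrier := M\<rparr>) E R \<le> c"
    "\<And>\<phi> x. \<phi> \<in> \<Phi> \<Longrightarrow> x \<in> Z \<Longrightarrow> norm (\<rho> x \<phi> - \<phi> (R x)) \<le> \<delta>"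
proof -
  define q where "q = sqrt c"
  have q: "1 < q" "q * q = c" using c by (auto simp: q_def)
  define \<eta> where "\<eta> = 1 - inverse q"
  have \<eta>: "0 < \<eta>" "\<eta> < 1" using q by (auto simp: \<eta>_def field_simps)
  obtain D where D: "finite D" "D \<subseteq> M" "\<And>d. d \<in> D \<Longrightarrow> nrm F d \<le> 1"
    "\<And>x. x \<in> M \<Longrightarrow> nrm F x \<le> 1 \<Longrightarrow> \<exists>d\<in>D. nrm F (x - d) \<le> \<eta>"
    using finite_dim_unit_ball_net[OF F M \<eta>(1)] by metis
  obtain R where R: "linear_on (F\<lparr>carrier := M\<rparr>) E R" "\<And>d. d \<in> D \<Longrightarrow> nrm E (R d) \<le> q"
    "\<And>\<phi> x. \<phi> \<in> \<Phi> \<Longrightarrow> x \<in> Z \<Longrightarrow> norm (\<rho> x \<phi> - \<phi> (R x)) \<le> \<delta>"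
    using helly_on_net[OF E F \<rho> M D(1-3) \<Phi> Z \<delta> q(1)] by metis
  have bl: "bounded_linear_on (F\<lparr>carrier := M\<rparr>) E R" by (rule linear_on_FIN_bounded[OF F E M R(1)])
  have "opnorm (F\<lparr>carrier := M\<rparr>) E R \<le> q / (1 - \<eta>)"
    using D R(2) \<eta> by (intro opnorm_le_of_net[OF normed_space_FIN[OF F M] E bl, of D]) auto
  also have "\<dots> = c" using q by (simp add: \<eta>_def divide_inverse)
  finally show ?thesis using that bl R(3) by blast
qed

section \<open>Extending multilinear forms to the bidual\<close>

text \<open>A slot is singled out by splitting the argument list around it; this form goes better with
  recursion on lists than the update of a list.\<close>

lemma multilinear_formI:
  assumes "\<And>us x y vs c. set us \<subseteq> carrier X \<Longrightarrow> set vs \<subseteq> carrier X \<Longrightarrow> x \<in> carrier X \<Longrightarrow> y \<in> carrier X \<Longrightarrow>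
      Suc (length us + length vs) = n \<Longrightarrow>
      A (us @ (x + y) # vs) = A (us @ x # vs) + A (us @ y # vs) \<and> A (us @ smult X c x # vs) = c * A (us @ x # vs)"
  shows "multilinear_form n X A"
  unfolding multilinear_form_def
proof (intro ballI impI allI)
  fix xs i x y c assume xs: "xs \<in> lists (carrier X)" "length xs = n" "i < n" and x: "x \<in> carrier X" "y \<in> carrier X"
  have "set (take i xs) \<subseteq> carrier X" "set (drop (Suc i) xs) \<subseteq> carrier X"
    using xs set_take_subset set_drop_subset by fastforce+
  then show "A (xs[i := x + y]) = A (xs[i := x]) + A (xs[i := y]) \<and> A (xs[i := smult X c x]) = c * A (xs[i := x])"
    using assms[of "take i xs" "drop (Suc i) xs" x y c] x xs by (simp add: upd_conv_take_nth_drop)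
qed

lemma multilinear_form_slot:
  assumes "multilinear_form n X A" "set us \<subseteq> carrier X" "set vs \<subseteq> carrier X" "Suc (length us + length vs) = n"
    "x \<in> carrier X"
  shows "y \<in> carrier X \<Longrightarrow> A (us @ (x + y) # vs) = A (us @ x # vs) + A (us @ y # vs)"
    and "A (us @ smult X c x # vs) = c * A (us @ x # vs)"
proof -
  have l: "us @ x # vs \<in> lists (carrier X)" "length (us @ x # vs) = n" "length us < n" using assms by auto
  have 1: "A ((us @ x # vs)[length us := x + y]) = A ((us @ x # vs)[length us := x]) + A ((us @ x # vs)[length us := y])"
    if "y \<in> carrier X" for y
    using assms(1,5) l that unfolding multilinear_form_def by blast
  have 2: "A ((us @ x # vs)[length us := smult X c x]) = c * A ((us @ x # vs)[length us := x])"
    using assms(1,5) l unfolding multilinear_form_def by blast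
  show "y \<in> carrier X \<Longrightarrow> A (us @ (x + y) # vs) = A (us @ x # vs) + A (us @ y # vs)" using 1 by simp
  show "A (us @ smult X c x # vs) = c * A (us @ x # vs)" using 2 by simp
qed

definition bounded_form :: "nat \<Rightarrow> ('k::real_or_complex, 'v::ab_group_add) nspace \<Rightarrow> real \<Rightarrow> ('v list \<Rightarrow> 'k) \<Rightarrow> bool" where
  "bounded_form n X C A \<longleftrightarrow> multilinear_form n X A \<and> 0 \<le> C \<and>
     (\<forall>xs. set xs \<subseteq> carrier X \<longrightarrow> length xs = n \<longrightarrow> norm (A xs) \<le> C * prod_list (map (nrm X) xs))"

lemma bounded_form_Cons:
  assumes X: "normed_space X" and A: "bounded_form (Suc n) X C A" and x: "x \<in> carrier X"
  shows "bounded_form n X (C * nrm X x) (\<lambda>xs. A (x # xs))"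
  unfolding bounded_form_def
proof (intro conjI allI impI)
  have m: "multilinear_form (Suc n) X A" using A by (simp add: bounded_form_def)
  show "multilinear_form n X (\<lambda>xs. A (x # xs))"
  proof (rule multilinear_formI)
    fix us y z vs c
    assume "set us \<subseteq> carrier X" "set vs \<subseteq> carrier X" "y \<in> carrier X" "z \<in> carrier X" "Suc (length us + length vs) = n"
    then show "A (x # us @ (y + z) # vs) = A (x # us @ y # vs) + A (x # us @ z # vs) \<and>
        A (x # us @ smult X c y # vs) = c * A (x # us @ y # vs)"
      using multilinear_form_slot[OF m, of "x # us" vs y] x by simp
  qed
  show "0 \<le> C * nrm X x" using A normed_spaceD(5)[OF X x] by (simp add: bounded_form_def)
  fix xs assume "set xs \<subseteq> carrier X" "length xs = n"
  then show "norm (A (x # xs)) \<le> C * nrm X x * prod_list (map (nrm X) xs)"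
    using A x unfolding bounded_form_def by (force simp: mult.assoc dest: spec[of _ "x # xs"])
qed

text \<open>The value of the iterated extension without limits: the limit along a net converging weak-star
  to \<open>f\<close> of the values of a functional is \<open>f\<close> applied to that functional. The value zero outside the
  carrier is the normalisation of elements of the dual.\<close>

primrec bidual_ext :: "('k::real_or_complex, 'v::ab_group_add) nspace \<Rightarrow> (('v \<Rightarrow> 'k) \<Rightarrow> 'k) list \<Rightarrow> ('v list \<Rightarrow> 'k) \<Rightarrow> 'k" where
  "bidual_ext X [] A = A []"
| "bidual_ext X (f # fs) A = f (\<lambda>x. if x \<in> carrier X then bidual_ext X fs (\<lambda>xs. A (x # xs)) else 0)"

lemma bidual_ext_cong:
  assumes "\<And>xs. set xs \<subseteq> carrier X \<Longrightarrow> length xs = length fs \<Longrightarrow> A xs = B xs"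
  shows "bidual_ext X fs A = bidual_ext X fs B"
  using assms
proof (induction fs arbitrary: A B)
  case (Cons f fs)
  have "bidual_ext X fs (\<lambda>xs. A (x # xs)) = bidual_ext X fs (\<lambda>xs. B (x # xs))" if "x \<in> carrier X" for x
    using that by (intro Cons.IH Cons.prems) auto
  then show ?case by (simp cong: if_cong)
qed simp

text \<open>Both properties come from a single induction, together with linearity of the extension in the
  form: that the functional of the first slot belongs to the dual follows from linearity and
  boundedness of the extension in the remaining slots, and is used in turn for both with one slot
  more.\<close>

lemma
  fixes X :: "('k::real_or_complex, 'v::ab_group_add) nspace"
  assumes X: "normed_space X" and fs: "set fs \<subseteq> carrier (dual (dual X))"
  shows bidual_ext_bound: "bounded_form (length fs) X C A \<Longrightarrow>
      norm (bidual_ext X fs A) \<le> C * prod_list (map (nrm (dual (dual X))) fs)"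
    and bidual_ext_slice: "bounded_form (Suc (length fs)) X C A \<Longrightarrow>
      (\<lambda>x. if x \<in> carrier X then bidual_ext X fs (\<lambda>xs. A (x # xs)) else 0) \<in> carrier (dual X)"
proof -
  have D: "normed_space (dual X)" "normed_space (dual (dual X))"
    using normed_space_dual normed_space_dual[OF X] by auto
  let ?P = "\<lambda>fs. prod_list (map (nrm (dual (dual X))) fs)"
  have P_nonneg: "0 \<le> ?P fs" if "set fs \<subseteq> carrier (dual (dual X))" for fs
    using that normed_spaceD(5)[OF D(2)] by (induction fs) auto
  define good where "good fs \<longleftrightarrow>
     (\<forall>C A. bounded_form (length fs) X C A \<longrightarrow> norm (bidual_ext X fs A) \<le> C * ?P fs) \<and>
     (\<forall>C A C' B. bounded_form (length fs) X C A \<longrightarrow> bounded_form (length fs) X C' B \<longrightarrow>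
        bidual_ext X fs (\<lambda>xs. A xs + B xs) = bidual_ext X fs A + bidual_ext X fs B) \<and>
     (\<forall>C A c. bounded_form (length fs) X C A \<longrightarrow> bidual_ext X fs (\<lambda>xs. c * A xs) = c * bidual_ext X fs A)" for fs
  define sl where "sl fs A = (\<lambda>x. if x \<in> carrier X then bidual_ext X fs (\<lambda>xs. A (x # xs)) else 0)"
    for fs and A :: "'v list \<Rightarrow> 'k"
  have slice: "sl fs A \<in> carrier (dual X) \<and> nrm (dual X) (sl fs A) \<le> C * ?P fs"
    if fs: "set fs \<subseteq> carrier (dual (dual X))" and g: "good fs" and A: "bounded_form (Suc (length fs)) X C A" for fs A C
  proof -
    note bC = bounded_form_Cons[OF X A]
    have m: "multilinear_form (Suc (length fs)) X A" using A by (simp add: bounded_form_def)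
    have C: "0 \<le> C" using A by (simp add: bounded_form_def)
    have le: "norm (sl fs A x) \<le> (C * ?P fs) * nrm X x" if "x \<in> carrier X" for x
    proof -
      have "norm (sl fs A x) \<le> (C * nrm X x) * ?P fs"
        using g bC[OF that] that unfolding good_def sl_def by auto
      then show ?thesis by (simp add: mult_ac)
    qed
    have mem: "sl fs A \<in> carrier (dual X)"
    proof (rule dualI[OF _ _ _ le])
      fix x y assume x: "x \<in> carrier X" and y: "y \<in> carrier X"
      have "bidual_ext X fs (\<lambda>xs. A ((x + y) # xs)) = bidual_ext X fs (\<lambda>xs. A (x # xs) + A (y # xs))"
        using multilinear_form_slot(1)[OF m, of "[]"] x y by (intro bidual_ext_cong) simp
      also have "\<dots> = bidual_ext X fs (\<lambda>xs. A (x # xs)) + bidual_ext X fs (\<lambda>xs. A (y # xs))"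
        using g bC[OF x] bC[OF y] unfolding good_def by blast
      finally show "sl fs A (x + y) = sl fs A x + sl fs A y"
        using x y normed_spaceD(3)[OF X x y] by (simp add: sl_def)
    next
      fix c x assume x: "x \<in> carrier X"
      have "bidual_ext X fs (\<lambda>xs. A (smult X c x # xs)) = bidual_ext X fs (\<lambda>xs. c * A (x # xs))"
        using multilinear_form_slot(2)[OF m, of "[]"] x by (intro bidual_ext_cong) simp
      also have "\<dots> = c * bidual_ext X fs (\<lambda>xs. A (x # xs))"
        using g bC[OF x] unfolding good_def by blast
      finally show "sl fs A (smult X c x) = c * sl fs A x"
        using x normed_spaceD(4)[OF X x] by (simp add: sl_def)
    qed (simp add: sl_def)
    moreover have "opnorm X scalars (sl fs A) \<le> C * ?P fs"
    proof (rule opnorm_dual(3)[OF X dualD(4)[OF mem]])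
      fix x assume x: "x \<in> carrier X" "nrm X x \<le> 1"
      have "C * ?P fs * nrm X x \<le> C * ?P fs * 1"
        using x(2) C P_nonneg[OF fs] by (intro mult_left_mono) auto
      then show "norm (sl fs A x) \<le> C * ?P fs" using le[OF x(1)] by simp
    qed
    ultimately show ?thesis by (simp add: dual_simps)
  qed
  have good: "good fs" if "set fs \<subseteq> carrier (dual (dual X))" for fs
    using that
  proof (induction fs)
    case Nil then show ?case by (simp add: good_def bounded_form_def)
  next
    case (Cons f fs)
    then have f: "f \<in> carrier (dual (dual X))" and fs: "set fs \<subseteq> carrier (dual (dual X))" and g: "good fs" by auto
    note sl = slice[OF fs g]
    have e: "bidual_ext X (f # fs) A = f (sl fs A)" for A by (simp add: sl_def)
    note bC = bounded_form_Cons[OF X]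
    show ?case unfolding good_def e
    proof (intro conjI allI impI)
      fix C A assume A: "bounded_form (length (f # fs)) X C A"
      have "norm (f (sl fs A)) \<le> nrm (dual (dual X)) f * nrm (dual X) (sl fs A)"
        using sl A by (intro dual_norm_le[OF D(1) f]) auto
      also have "\<dots> \<le> nrm (dual (dual X)) f * (C * ?P fs)"
        using sl A normed_spaceD(5)[OF D(2) f] by (intro mult_left_mono) auto
      finally show "norm (f (sl fs A)) \<le> C * ?P (f # fs)" by (simp add: mult_ac)
    next
      fix C A C' B assume A: "bounded_form (length (f # fs)) X C A" and B: "bounded_form (length (f # fs)) X C' B"
      have "sl fs (\<lambda>xs. A xs + B xs) = sl fs A + sl fs B"
      proof
        fix x show "sl fs (\<lambda>xs. A xs + B xs) x = (sl fs A + sl fs B) x"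
        proof (cases "x \<in> carrier X")
          case True
          have "bounded_form (length fs) X (C * nrm X x) (\<lambda>xs. A (x # xs))"
            "bounded_form (length fs) X (C' * nrm X x) (\<lambda>xs. B (x # xs))" using A B bC[OF _ True] by auto
          then show ?thesis using g True unfolding good_def sl_def plus_fun_apply by presburger
        qed (simp add: sl_def)
      qed
      moreover have "f (sl fs A + sl fs B) = f (sl fs A) + f (sl fs B)"
        using sl A B by (intro dualD(1)[OF f]) auto
      ultimately show "f (sl fs (\<lambda>xs. A xs + B xs)) = f (sl fs A) + f (sl fs B)" by simp
    next
      fix C A c assume A: "bounded_form (length (f # fs)) X C A"
      have "sl fs (\<lambda>xs. c * A xs) = fscale c (sl fs A)"
      proof
        fix x show "sl fs (\<lambda>xs. c * A xs) x = fscale c (sl fs A) x"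
        proof (cases "x \<in> carrier X")
          case True
          have "bounded_form (length fs) X (C * nrm X x) (\<lambda>xs. A (x # xs))" using A bC[OF _ True] by auto
          then show ?thesis using g True unfolding good_def sl_def fscale_def by presburger
        qed (simp add: sl_def fscale_def)
      qed
      moreover have "f (smult (dual X) c (sl fs A)) = c * f (sl fs A)"
        using sl A by (intro dualD(2)[OF f]) auto
      ultimately show "f (sl fs (\<lambda>xs. c * A xs)) = c * f (sl fs A)" by (simp add: dual_simps)
    qed
  qed
  show "bounded_form (length fs) X C A \<Longrightarrow> norm (bidual_ext X fs A) \<le> C * ?P fs"
    using good[OF fs] unfolding good_def by blast
  show "bounded_form (Suc (length fs)) X C A \<Longrightarrow>
      (\<lambda>x. if x \<in> carrier X then bidual_ext X fs (\<lambda>xs. A (x # xs)) else 0) \<in> carrier (dual X)"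
    using slice[OF fs good[OF fs]] by (auto simp: sl_def)
qed

lemma bidual_ext_multilinear:
  assumes X: "normed_space X" and A: "bounded_form (Suc (length gs + length fs)) X C A"
    and gs: "set gs \<subseteq> carrier (dual (dual X))" and fs: "set fs \<subseteq> carrier (dual (dual X))"
    and f: "f \<in> carrier (dual (dual X))" "f' \<in> carrier (dual (dual X))"
  shows "bidual_ext X (gs @ (f + f') # fs) A = bidual_ext X (gs @ f # fs) A + bidual_ext X (gs @ f' # fs) A"
    and "bidual_ext X (gs @ fscale c f # fs) A = c * bidual_ext X (gs @ f # fs) A"
proof -
  have D: "normed_space (dual (dual X))" by (intro normed_space_dual X)
  have c: "f + f' \<in> carrier (dual (dual X))" "fscale c f \<in> carrier (dual (dual X))"
    using normed_spaceD(3)[OF D f] normed_spaceD(4)[OF D f(1), of c] by (simp_all add: dual_simps(2))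
  have "bidual_ext X (gs @ (f + f') # fs) A = bidual_ext X (gs @ f # fs) A + bidual_ext X (gs @ f' # fs) A \<and>
    bidual_ext X (gs @ fscale c f # fs) A = c * bidual_ext X (gs @ f # fs) A"
    using A gs
  proof (induction gs arbitrary: A C)
    case Nil then show ?case by (simp add: fscale_def)
  next
    case (Cons g gs)
    then have g: "g \<in> carrier (dual (dual X))" and gs: "set gs \<subseteq> carrier (dual (dual X))" by auto
    let ?sl = "\<lambda>f x. if x \<in> carrier X then bidual_ext X (gs @ f # fs) (\<lambda>xs. A (x # xs)) else 0"
    have sl: "?sl h \<in> carrier (dual X)" if "h \<in> carrier (dual (dual X))" for h
      using that gs fs Cons.prems by (intro bidual_ext_slice[OF X]) auto
    have IH: "bidual_ext X (gs @ (f + f') # fs) (\<lambda>xs. A (x # xs)) =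
        bidual_ext X (gs @ f # fs) (\<lambda>xs. A (x # xs)) + bidual_ext X (gs @ f' # fs) (\<lambda>xs. A (x # xs)) \<and>
        bidual_ext X (gs @ fscale c f # fs) (\<lambda>xs. A (x # xs)) = c * bidual_ext X (gs @ f # fs) (\<lambda>xs. A (x # xs))"
      if "x \<in> carrier X" for x
      using bounded_form_Cons[OF X _ that] Cons.prems gs by (intro Cons.IH) auto
    have "?sl (f + f') = ?sl f + ?sl f'" "?sl (fscale c f) = smult (dual X) c (?sl f)"
      using IH by (auto simp: fun_eq_iff dual_simps fscale_def)
    then show ?case unfolding append_Cons bidual_ext.simps
      using dualD(1)[OF g sl[OF f(1)] sl[OF f(2)]] dualD(2)[OF g sl[OF f(1)], of c] by (simp only:)
  qed
  then show "bidual_ext X (gs @ (f + f') # fs) A = bidual_ext X (gs @ f # fs) A + bidual_ext X (gs @ f' # fs) A"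
    "bidual_ext X (gs @ fscale c f # fs) A = c * bidual_ext X (gs @ f # fs) A" by auto
qed

lemma wstar_to_tendsto: "\<phi> \<in> carrier (dual X) \<Longrightarrow> (\<phi> \<longlongrightarrow> f \<phi>) (wstar_to X f)"
  unfolding wstar_to_def filterlim_iff_le_filtercomap by (intro le_infI2 INF_lower)

lemma eventually_wstar_to_carrier: "eventually (\<lambda>x. x \<in> carrier X) (wstar_to X f)"
  unfolding wstar_to_def by (subst inf_commute) (simp add: eventually_inf_principal)

text \<open>A base of the filter is given by finitely many functionals and a tolerance, so a filter that fails
  to be proper contains an empty set of this form.\<close>

lemma wstar_to_nontrivial:
  assumes approx: "\<And>\<Phi> \<delta>. finite \<Phi> \<Longrightarrow> \<Phi> \<subseteq> carrier (dual X) \<Longrightarrow> 0 < \<delta> \<Longrightarrow>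
      \<exists>x\<in>carrier X. \<forall>\<phi>\<in>\<Phi>. norm (f \<phi> - \<phi> x) < \<delta>"
  shows "wstar_to X f \<noteq> bot"
proof
  assume "wstar_to X f = bot"
  then have "eventually (\<lambda>_. False) (wstar_to X f)" by simp
  then have "eventually (\<lambda>x. x \<notin> carrier X) (INF \<phi>\<in>carrier (dual X). filtercomap \<phi> (nhds (f \<phi>)))"
    unfolding wstar_to_def by (subst (asm) inf_commute) (simp add: eventually_inf_principal)
  then obtain \<Phi> where \<Phi>: "\<Phi> \<subseteq> carrier (dual X)" "finite \<Phi>"
    and ev: "eventually (\<lambda>x. x \<notin> carrier X) (INF \<phi>\<in>\<Phi>. filtercomap \<phi> (nhds (f \<phi>)))"
    unfolding eventually_INF[of _ _ "carrier (dual X)"] by blast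
  obtain Q where Q: "\<And>\<phi>. \<phi> \<in> \<Phi> \<Longrightarrow> eventually (Q \<phi>) (filtercomap \<phi> (nhds (f \<phi>)))"
    and no: "\<And>x. (\<forall>\<phi>\<in>\<Phi>. Q \<phi> x) \<Longrightarrow> x \<notin> carrier X"
    using ev unfolding eventually_INF_finite[OF \<Phi>(2)] by blast
  have "\<exists>d>0. \<forall>x. dist (\<phi> x) (f \<phi>) < d \<longrightarrow> Q \<phi> x" if "\<phi> \<in> \<Phi>" for \<phi>
    using Q[OF that] unfolding eventually_filtercomap eventually_nhds_metric by blast
  then obtain d where d: "\<And>\<phi>. \<phi> \<in> \<Phi> \<Longrightarrow> d \<phi> > (0::real)"
    "\<And>\<phi> x. \<phi> \<in> \<Phi> \<Longrightarrow> dist (\<phi> x) (f \<phi>) < d \<phi> \<Longrightarrow> Q \<phi> x" by metis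
  define \<delta> where "\<delta> = Min (insert 1 (d ` \<Phi>))"
  have "0 < \<delta>" unfolding \<delta>_def using \<Phi>(2) d(1) by (subst Min_gr_iff) auto
  then obtain x where x: "x \<in> carrier X" "\<And>\<phi>. \<phi> \<in> \<Phi> \<Longrightarrow> norm (f \<phi> - \<phi> x) < \<delta>"
    using approx[OF \<Phi>(2,1)] by blast
  have "Q \<phi> x" if "\<phi> \<in> \<Phi>" for \<phi>
  proof -
    have "\<delta> \<le> d \<phi>" unfolding \<delta>_def using \<Phi>(2) that by (intro Min_le) auto
    then show ?thesis using x(2)[OF that] d(2)[OF that, of x] by (simp add: dist_norm norm_minus_commute)
  qed
  then show False using no x(1) by blast
qed

lemma iter_lim_eq_bidual_ext:
  assumes X: "normed_space X" and fs: "set fs \<subseteq> carrier (dual (dual X))"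
    and nt: "\<And>f. f \<in> set fs \<Longrightarrow> wstar_to X f \<noteq> bot" and A: "bounded_form (length fs) X C A"
  shows "iter_lim (map (wstar_to X) fs) A = bidual_ext X fs A"
  using fs nt A
proof (induction fs arbitrary: A C)
  case (Cons f fs)
  let ?sl = "\<lambda>x. if x \<in> carrier X then bidual_ext X fs (\<lambda>xs. A (x # xs)) else 0"
  have "?sl \<in> carrier (dual X)" using Cons.prems by (intro bidual_ext_slice[OF X]) auto
  then have "(?sl \<longlongrightarrow> f ?sl) (wstar_to X f)" by (rule wstar_to_tendsto)
  moreover have "eventually (\<lambda>x. ?sl x = iter_lim (map (wstar_to X) fs) (\<lambda>xs. A (x # xs))) (wstar_to X f)"
    using eventually_wstar_to_carrier
  proof eventually_elim
    case (elim x)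
    have "iter_lim (map (wstar_to X) fs) (\<lambda>xs. A (x # xs)) = bidual_ext X fs (\<lambda>xs. A (x # xs))"
      using Cons.prems bounded_form_Cons[OF X _ elim] by (intro Cons.IH) auto
    then show ?case using elim by simp
  qed
  ultimately have "((\<lambda>x. iter_lim (map (wstar_to X) fs) (\<lambda>xs. A (x # xs))) \<longlongrightarrow> f ?sl) (wstar_to X f)"
    by (rule Lim_transform_eventually)
  then show ?case using Cons.prems(2)[of f] by (simp add: tendsto_Lim)
qed simp

lemma bidual_ext_evaluation:
  assumes X: "normed_space X" and A: "bounded_form (length xs) X C A" and xs: "set xs \<subseteq> carrier X"
  shows "bidual_ext X (map (\<lambda>x \<phi>. if \<phi> \<in> carrier (dual X) then \<phi> x else 0) xs) A = A xs"
  using A xs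
proof (induction xs arbitrary: A C)
  case (Cons x xs)
  let ?ev = "\<lambda>x \<phi>. if \<phi> \<in> carrier (dual X) then \<phi> x else 0"
  have ev: "?ev x \<in> carrier (dual (dual X))" if "x \<in> carrier X" for x
    using dual_norm_le[OF X _ that] normed_spaceD(3,4)[OF normed_space_dual[OF X]]
    by (intro dualI[where C = "nrm X x"]) (auto simp: dual_simps(2) fscale_def mult.commute)
  let ?sl = "\<lambda>x. if x \<in> carrier X then bidual_ext X (map ?ev xs) (\<lambda>xs. A (x # xs)) else 0"
  have "?sl \<in> carrier (dual X)" using Cons.prems ev by (intro bidual_ext_slice[OF X]) auto
  moreover have "bidual_ext X (map ?ev xs) (\<lambda>xs. A (x # xs)) = A (x # xs)"
    using Cons.prems bounded_form_Cons[OF X] by (intro Cons.IH) auto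
  ultimately show ?case using Cons.prems by simp
qed simp

section \<open>Averages of operators into the space\<close>

lemma prod_list_nonneg:
  fixes f :: "'a \<Rightarrow> real"
  assumes "\<And>x. x \<in> set xs \<Longrightarrow> 0 \<le> f x"
  shows "0 \<le> prod_list (map f xs)"
  using assms by (induction xs) auto

lemma prod_list_le_power:
  fixes f :: "'a \<Rightarrow> real"
  assumes "\<And>x. x \<in> set xs \<Longrightarrow> 0 \<le> f x" "\<And>x. x \<in> set xs \<Longrightarrow> f x \<le> r"
  shows "prod_list (map f xs) \<le> r ^ length xs"
  using assms
proof (induction xs)
  case (Cons x xs)
  then have "f x * prod_list (map f xs) \<le> r * r ^ length xs"
    using prod_list_nonneg[of xs f] by (intro mult_mono) (auto intro: order_trans)
  then show ?case by simp
qed simp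

text \<open>The average of \<open>B\<close> over all permutations of its arguments is symmetric and has the same diagonal.\<close>

lemma symmetrization_cont_polynomial:
  fixes X :: "('k::real_or_complex, 'v::ab_group_add) nspace"
  assumes X: "normed_space X" and B: "bounded_form n X C B"
  shows "cont_polynomial n X (\<lambda>y. B (replicate n y))"
proof -
  let ?P = "{\<sigma>. \<sigma> permutes {..<n}}"
  define S where "S xs = (\<Sum>\<sigma>\<in>?P. B (permute_list \<sigma> xs)) / of_nat (fact n)" for xs
  have card: "card ?P = fact n" by (intro card_permutations) auto
  have "multilinear_form n X S" unfolding multilinear_form_def
  proof (intro ballI impI allI)
    fix xs i x y c assume xs: "xs \<in> lists (carrier X)" "length xs = n" "i < n" and x: "x \<in> carrier X" "y \<in> carrier X"
    have upd: "permute_list \<sigma> (xs[i := z]) = (permute_list \<sigma> xs)[inv \<sigma> i := z]" if \<sigma>: "\<sigma> permutes {..<n}" for \<sigma> z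
    proof (rule nth_equalityI)
      fix k assume "k < length (permute_list \<sigma> (xs[i := z]))"
      then have k: "k < n" using xs by simp
      have "\<sigma> k < n" using permutes_in_image[OF \<sigma>, of k] k by simp
      moreover have "\<sigma> k = i \<longleftrightarrow> k = inv \<sigma> i" using \<sigma> by (metis permutes_inverses)
      ultimately show "permute_list \<sigma> (xs[i := z]) ! k = (permute_list \<sigma> xs)[inv \<sigma> i := z] ! k"
        using k xs \<sigma> by (auto simp: permute_list_nth nth_list_update)
    qed simp
    have B': "B (permute_list \<sigma> (xs[i := x + y])) = B (permute_list \<sigma> (xs[i := x])) + B (permute_list \<sigma> (xs[i := y])) \<and>
        B (permute_list \<sigma> (xs[i := smult X c x])) = c * B (permute_list \<sigma> (xs[i := x]))" if \<sigma>: "\<sigma> permutes {..<n}" for \<sigma>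
    proof -
      have "permute_list \<sigma> xs \<in> lists (carrier X)" using xs \<sigma> by (simp add: in_lists_conv_set)
      moreover have "inv \<sigma> i < n" using permutes_in_image[OF permutes_inv[OF \<sigma>], of i] xs by simp
      ultimately show ?thesis using B x xs unfolding upd[OF \<sigma>] bounded_form_def multilinear_form_def by simp
    qed
    show "S (xs[i := x + y]) = S (xs[i := x]) + S (xs[i := y]) \<and> S (xs[i := smult X c x]) = c * S (xs[i := x])"
      unfolding S_def using B' by (simp add: sum.distrib sum_distrib_left add_divide_distrib)
  qed
  moreover have "S ys = S xs" if xs: "length xs = n" and m: "mset ys = mset xs" for xs ys
  proof -
    obtain q where q: "q permutes {..<length xs}" "permute_list q xs = ys" using mset_eq_permutation[OF m] .
    have "(\<Sum>\<sigma>\<in>?P. B (permute_list \<sigma> xs)) = (\<Sum>\<sigma>\<in>?P. B (permute_list (q \<circ> \<sigma>) xs))"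
      using q xs by (intro setum_permutations_compose_left) simp
    also have "\<dots> = (\<Sum>\<sigma>\<in>?P. B (permute_list \<sigma> ys))"
      using q xs by (intro sum.cong) (auto simp: permute_list_compose)
    finally show ?thesis by (simp add: S_def)
  qed
  moreover have "norm (S xs) \<le> C * prod_list (map (nrm X) xs)" if xs: "xs \<in> lists (carrier X)" "length xs = n" for xs
  proof -
    have "norm (B (permute_list \<sigma> xs)) \<le> C * prod_list (map (nrm X) xs)" if "\<sigma> permutes {..<n}" for \<sigma>
    proof -
      have m: "mset (permute_list \<sigma> xs) = mset xs" using that xs by simp
      then have "set (permute_list \<sigma> xs) \<subseteq> carrier X" using xs by (metis in_lists_conv_set mset_eq_setD subsetI)
      then have "norm (B (permute_list \<sigma> xs)) \<le> C * prod_list (map (nrm X) (permute_list \<sigma> xs))"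
        using B xs by (simp add: bounded_form_def)
      also have "prod_list (map (nrm X) (permute_list \<sigma> xs)) = prod_list (map (nrm X) xs)"
        using m by (metis mset_map prod_mset_prod_list)
      finally show ?thesis .
    qed
    then have "norm (\<Sum>\<sigma>\<in>?P. B (permute_list \<sigma> xs)) \<le> (\<Sum>\<sigma>\<in>?P. C * prod_list (map (nrm X) xs))"
      by (intro sum_norm_le) auto
    also have "\<dots> = fact n * (C * prod_list (map (nrm X) xs))" using card by simp
    finally show ?thesis unfolding S_def by (simp add: norm_divide field_simps)
  qed
  ultimately have "cont_sym_form n X S" unfolding cont_sym_form_def by blast
  moreover have "B (replicate n y) = S (replicate n y)" for y
  proof -
    have "permute_list \<sigma> (replicate n y) = replicate n y" if "\<sigma> permutes {..<n}" for \<sigma>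
      using permutes_in_image[OF that] by (intro nth_equalityI) (auto simp: permute_list_nth that)
    then show ?thesis using card by (simp add: S_def)
  qed
  ultimately show ?thesis unfolding cont_polynomial_def by blast
qed

lemma cont_sym_form_bounded:
  assumes X: "normed_space X" and A: "cont_sym_form n X A"
  obtains C where "bounded_form n X C A"
proof -
  obtain C where C: "\<And>xs. xs \<in> lists (carrier X) \<Longrightarrow> length xs = n \<Longrightarrow> norm (A xs) \<le> C * prod_list (map (nrm X) xs)"
    using A unfolding cont_sym_form_def by blast
  have "norm (A xs) \<le> \<bar>C\<bar> * prod_list (map (nrm X) xs)" if xs: "set xs \<subseteq> carrier X" "length xs = n" for xs
  proof -
    have "0 \<le> prod_list (map (nrm X) xs)" using xs normed_spaceD(5)[OF X] by (intro prod_list_nonneg) auto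
    then have "C * prod_list (map (nrm X) xs) \<le> \<bar>C\<bar> * prod_list (map (nrm X) xs)" by (intro mult_right_mono) auto
    moreover have "xs \<in> lists (carrier X)" using xs by (auto simp: in_lists_conv_set)
    ultimately show ?thesis using C[of xs] xs by simp
  qed
  then have "bounded_form n X \<bar>C\<bar> A" using A by (simp add: bounded_form_def cont_sym_form_def)
  then show ?thesis by (rule that)
qed

lemma bidual_ext_cont_polynomial:
  assumes E: "normed_space E" and F: "normed_space F" and \<rho>: "isometric_iso F (bidual E) \<rho>"
    and A: "bounded_form n E C A"
  shows "cont_polynomial n F (\<lambda>y. bidual_ext E (replicate n (\<rho> y)) A)"
proof -
  note be = bidual_embedding[OF E F \<rho>]
  have \<rho>a: "\<rho> (x + y) = \<rho> x + \<rho> y" if "x \<in> carrier F" "y \<in> carrier F" for x y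
    using \<rho> that by (simp add: isometric_iso_def linear_on_def)
  have \<rho>s: "\<rho> (smult F c x) = fscale c (\<rho> x)" if "x \<in> carrier F" for x c
    using \<rho> that by (simp add: isometric_iso_def linear_on_def bidual_def dual_simps)
  have set: "set (map \<rho> xs) \<subseteq> carrier (dual (dual E))" if "set xs \<subseteq> carrier F" for xs
    using that be(1) by auto
  have "bounded_form n F C (\<lambda>ys. bidual_ext E (map \<rho> ys) A)" unfolding bounded_form_def
  proof (intro conjI allI impI)
    show "multilinear_form n F (\<lambda>ys. bidual_ext E (map \<rho> ys) A)"
    proof (rule multilinear_formI)
      fix us x y vs c
      assume *: "set us \<subseteq> carrier F" "set vs \<subseteq> carrier F" "x \<in> carrier F" "y \<in> carrier F" "Suc (length us + length vs) = n"
      then have "bounded_form (Suc (length (map \<rho> us) + length (map \<rho> vs))) E C A" using A by simp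
      note bm = bidual_ext_multilinear[OF E this set[OF *(1)] set[OF *(2)] be(1)[OF *(3)] be(1)[OF *(4)]]
      show "bidual_ext E (map \<rho> (us @ (x + y) # vs)) A =
          bidual_ext E (map \<rho> (us @ x # vs)) A + bidual_ext E (map \<rho> (us @ y # vs)) A \<and>
        bidual_ext E (map \<rho> (us @ smult F c x # vs)) A = c * bidual_ext E (map \<rho> (us @ x # vs)) A"
        using bm by (simp add: \<rho>a[OF *(3,4)] \<rho>s[OF *(3)])
    qed
    show "0 \<le> C" using A by (simp add: bounded_form_def)
    fix xs assume xs: "set xs \<subseteq> carrier F" "length xs = n"
    have eq: "map (nrm (dual (dual E))) (map \<rho> xs) = map (nrm F) xs" using xs be(2) by auto
    show "norm (bidual_ext E (map \<rho> xs) A) \<le> C * prod_list (map (nrm F) xs)"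
      using bidual_ext_bound[OF E set[OF xs(1)], of C A] A xs unfolding eq by simp
  qed
  then show ?thesis using symmetrization_cont_polynomial[OF F] by fastforce
qed

lemma bounded_form_append:
  assumes X: "normed_space X" and "bounded_form n X C A" "set us \<subseteq> carrier X" "length us \<le> n"
  shows "\<exists>C. bounded_form (n - length us) X C (\<lambda>xs. A (us @ xs))"
  using assms(2-)
proof (induction us arbitrary: n A C)
  case (Cons u us)
  then obtain n' where n: "n = Suc n'" by (cases n) auto
  have "bounded_form n' X (C * nrm X u) (\<lambda>xs. A (u # xs))"
    using Cons.prems n by (intro bounded_form_Cons[OF X]) auto
  then show ?case using Cons.IH[of n' "C * nrm X u" "\<lambda>xs. A (u # xs)"] Cons.prems n by simp
qed auto

lemma multilinear_form_sum:
  assumes X: "normed_space X" and A: "multilinear_form n X A"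
    and us: "set us \<subseteq> carrier X" and vs: "set vs \<subseteq> carrier X" and n: "Suc (length us + length vs) = n"
    and f: "\<And>j. j \<in> J \<Longrightarrow> f j \<in> carrier X" and J: "finite J"
  shows "A (us @ (\<Sum>j\<in>J. f j) # vs) = (\<Sum>j\<in>J. A (us @ f j # vs))"
  using J f
proof (induction J)
  case empty
  have z: "0 \<in> carrier X" by (rule normed_spaceD(1)[OF X])
  have "A (us @ (0 + 0) # vs) = A (us @ 0 # vs) + A (us @ 0 # vs)"
    by (rule multilinear_form_slot(1)[OF A us vs n z z])
  then show ?case by simp
next
  case (insert j J)
  have "A (us @ (f j + sum f J) # vs) = A (us @ f j # vs) + A (us @ sum f J # vs)"
    using insert.prems by (intro multilinear_form_slot(1)[OF A us vs n] nrm_sum_le[OF X]) auto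
  then show ?case using insert by simp
qed

text \<open>Multinomial expansion, with the terms indexed by the list of the chosen summands.\<close>

lemma multilinear_form_expand:
  assumes X: "normed_space X" and A: "multilinear_form n X A"
    and f: "\<And>j. j \<in> J \<Longrightarrow> f j \<in> carrier X" and J: "finite J"
    and us: "set us \<subseteq> carrier X" and n: "length us + k = n"
  shows "A (us @ replicate k (\<Sum>j\<in>J. f j)) = (\<Sum>js | set js \<subseteq> J \<and> length js = k. A (us @ map f js))"
  using us n
proof (induction k arbitrary: us)
  case 0
  have "{js. set js \<subseteq> J \<and> length js = 0} = {[]}" by auto
  then show ?case by simp
next
  case (Suc k)
  let ?L = "\<lambda>k. {js. set js \<subseteq> J \<and> length js = k}"
  have fJ: "sum f J \<in> carrier X" using f by (intro nrm_sum_le[OF X]) auto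
  have "A (us @ replicate (Suc k) (sum f J)) = A (us @ sum f J # replicate k (sum f J))" by simp
  also have "\<dots> = (\<Sum>j\<in>J. A (us @ f j # replicate k (sum f J)))"
    using Suc.prems f fJ J by (intro multilinear_form_sum[OF X A]) auto
  also have "\<dots> = (\<Sum>j\<in>J. \<Sum>js\<in>?L k. A (us @ map f (j # js)))"
  proof (intro sum.cong refl)
    fix j assume "j \<in> J"
    then have "A ((us @ [f j]) @ replicate k (sum f J)) = (\<Sum>js\<in>?L k. A ((us @ [f j]) @ map f js))"
      using Suc.prems f by (intro Suc.IH) auto
    then show "A (us @ f j # replicate k (sum f J)) = (\<Sum>js\<in>?L k. A (us @ map f (j # js)))" by simp
  qed
  also have "\<dots> = (\<Sum>(j, js)\<in>J \<times> ?L k. A (us @ map f (j # js)))"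
    by (rule sum.cartesian_product)
  also have "\<dots> = (\<Sum>js\<in>(\<lambda>(j, js). j # js) ` (J \<times> ?L k). A (us @ map f js))"
    by (subst sum.reindex) (auto simp: inj_on_def case_prod_beta)
  also have "(\<lambda>(j, js). j # js) ` (J \<times> ?L k) = ?L (Suc k)"
    by (auto simp: length_Suc_conv image_iff)
  finally show ?case .
qed

lemma multilinear_form_scale:
  assumes A: "multilinear_form n X A" and x: "x \<in> carrier X" "smult X c x \<in> carrier X"
    and us: "set us \<subseteq> carrier X" and n: "length us + k = n"
  shows "A (us @ replicate k (smult X c x)) = c ^ k * A (us @ replicate k x)"
  using us n
proof (induction k arbitrary: us)
  case (Suc k)
  have "A (us @ replicate (Suc k) (smult X c x)) = A ((us @ [smult X c x]) @ replicate k (smult X c x))" by simp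
  also have "\<dots> = c ^ k * A ((us @ [smult X c x]) @ replicate k x)"
    using Suc.prems x by (intro Suc.IH) auto
  also have "A ((us @ [smult X c x]) @ replicate k x) = c * A (us @ x # replicate k x)"
    using multilinear_form_slot(2)[OF A, of us "replicate k x" x c] Suc.prems x
    by (auto simp: set_replicate_conv_if)
  finally show ?case by simp
qed simp

text \<open>There are at least \<open>(m - n)\<^sup>n\<close> lists without repetition, and Bernoulli's inequality applies to
  \<open>(1 - n / m)\<^sup>n\<close>.\<close>

lemma card_nondistinct_lists:
  assumes "n < m"
  shows "real (card {js. set js \<subseteq> {..<m} \<and> length js = n \<and> \<not> distinct js}) \<le> real (n * n) / real m * real m ^ n"
proof -
  let ?L = "{js. set js \<subseteq> {..<m} \<and> length js = n}" and ?D = "{js. length js = n \<and> distinct js \<and> set js \<subseteq> {..<m}}"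
  have L: "finite ?L" "card ?L = m ^ n" using finite_lists_length_eq card_lists_length_eq[of "{..<m}" n] by auto
  have D: "?D \<subseteq> ?L" by auto
  have "card ?D = \<Prod>{m - n + 1..m}" using card_lists_distinct_length_eq[of "{..<m}" n] assms by simp
  also have "real \<dots> = (\<Prod>i\<in>{m - n + 1..m}. real i)" by simp
  also have "\<dots> \<ge> (\<Prod>i\<in>{m - n + 1..m}. real (m - n))" by (intro prod_mono) auto
  finally have "real (m - n) ^ n \<le> real (card ?D)" using assms by simp
  moreover have "real m ^ n - real (n * n) / real m * real m ^ n \<le> real (m - n) ^ n"
  proof -
    have "1 + real n * (- (real n / real m)) \<le> (1 + - (real n / real m)) ^ n"
      using assms by (intro Bernoulli_inequality) simp
    then have "(1 - real (n * n) / real m) * real m ^ n \<le> (1 - real n / real m) ^ n * real m ^ n"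
      by (intro mult_right_mono) auto
    also have "(1 - real n / real m) ^ n * real m ^ n = real (m - n) ^ n"
      using assms by (simp add: power_mult_distrib[symmetric] field_simps of_nat_diff)
    finally show ?thesis by (simp add: algebra_simps)
  qed
  moreover have "{js. set js \<subseteq> {..<m} \<and> length js = n \<and> \<not> distinct js} = ?L - ?D" by auto
  then have "real (card {js. set js \<subseteq> {..<m} \<and> length js = n \<and> \<not> distinct js}) = real m ^ n - real (card ?D)"
    using L D card_mono[OF L(1) D] by (simp add: card_Diff_subset finite_subset of_nat_diff)
  ultimately show ?thesis by linarith
qed

text \<open>In the application \<open>\<phi> us x\<close> is the functional obtained from a form by fixing the vectors
  \<open>us\<close> in the first slots, leaving the next slot free and extending to \<open>x\<close> in the remaining ones.
  When \<open>R i\<close> is chosen, only finitely many such functionals have been determined by the earlier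
  operators, so local reflexivity applies.\<close>

lemma successive_operators:
  fixes E :: "('k::real_or_complex, 'v::ab_group_add) nspace" and F :: "('k, 'w::ab_group_add) nspace"
  assumes E: "normed_space E" and F: "normed_space F" and \<rho>: "isometric_iso F (bidual E) \<rho>"
    and M: "FIN F M" and Z: "finite Z" "Z \<subseteq> M" and \<gamma>: "0 < \<gamma>" and c: "1 < c"
    and \<phi>: "\<And>us x. set us \<subseteq> carrier E \<Longrightarrow> length us < n \<Longrightarrow> x \<in> Z \<Longrightarrow> \<phi> us x \<in> carrier (dual E)"
  obtains R :: "nat \<Rightarrow> 'w \<Rightarrow> 'v" where
    "\<And>i. i < m \<Longrightarrow> bounded_linear_on (F\<lparr>carrier := M\<rparr>) E (R i)"
    "\<And>i. i < m \<Longrightarrow> opnorm (F\<lparr>carrier := M\<rparr>) E (R i) \<le> c"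
    "\<And>i js x. i < m \<Longrightarrow> set js \<subseteq> {..<i} \<Longrightarrow> length js < n \<Longrightarrow> x \<in> Z \<Longrightarrow>
      norm (\<rho> x (\<phi> (map (\<lambda>j. R j x) js) x) - \<phi> (map (\<lambda>j. R j x) js) x (R i x)) \<le> \<gamma>"
proof -
  define good where "good R i \<longleftrightarrow> bounded_linear_on (F\<lparr>carrier := M\<rparr>) E (R i) \<and>
    opnorm (F\<lparr>carrier := M\<rparr>) E (R i) \<le> c \<and>
    (\<forall>js x. set js \<subseteq> {..<i} \<longrightarrow> length js < n \<longrightarrow> x \<in> Z \<longrightarrow>
      norm (\<rho> x (\<phi> (map (\<lambda>j. R j x) js) x) - \<phi> (map (\<lambda>j. R j x) js) x (R i x)) \<le> \<gamma>)"
    for R :: "nat \<Rightarrow> 'w \<Rightarrow> 'v" and i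
  have "\<exists>R. \<forall>i<m. good R i"
  proof (induction m)
    case (Suc m)
    then obtain R where R: "\<And>i. i < m \<Longrightarrow> good R i" by blast
    let ?I = "{js. set js \<subseteq> {..<m} \<and> length js \<le> n}"
    define \<Phi> where "\<Phi> = (\<lambda>(js, x). \<phi> (map (\<lambda>j. R j x) js) x) ` ({js \<in> ?I. length js < n} \<times> Z)"
    have mem: "R j x \<in> carrier E" if "j < m" "x \<in> M" for j x
      using R[OF that(1)] that(2) by (auto simp: good_def bounded_linear_on_def linear_on_def)
    have "finite ?I" by (intro finite_lists_length_le) auto
    then have "finite {js \<in> ?I. length js < n}" by (rule rev_finite_subset) auto
    then have fin: "finite \<Phi>" unfolding \<Phi>_def using Z by (intro finite_imageI finite_cartesian_product)
    have sub: "\<Phi> \<subseteq> carrier (dual E)"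
      using mem Z(2) by (auto simp: \<Phi>_def subset_iff intro!: \<phi>)
    obtain S where S: "bounded_linear_on (F\<lparr>carrier := M\<rparr>) E S" "opnorm (F\<lparr>carrier := M\<rparr>) E S \<le> c"
      "\<And>\<psi> x. \<psi> \<in> \<Phi> \<Longrightarrow> x \<in> Z \<Longrightarrow> norm (\<rho> x \<psi> - \<psi> (S x)) \<le> \<gamma>"
      using local_reflexivity[OF E F \<rho> M fin sub Z \<gamma> c] by metis
    let ?R = "R(m := S)"
    have mp: "map (\<lambda>j. ?R j x) js = map (\<lambda>j. R j x) js" if "set js \<subseteq> {..<i}" "i \<le> m" for i js x
      using that by auto
    have "good ?R i" if "i < Suc m" for i
    proof (cases "i = m")
      case True
      have \<Phi>_mem: "\<phi> (map (\<lambda>j. R j x) js) x \<in> \<Phi>" if "set js \<subseteq> {..<m}" "length js < n" "x \<in> Z" for js x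
        using that by (auto simp: \<Phi>_def intro!: image_eqI[of _ _ "(js, x)"])
      show ?thesis unfolding good_def True fun_upd_same
      proof (intro conjI allI impI S(1,2))
        fix js x assume js: "set js \<subseteq> {..<m}" "length js < n" "x \<in> Z"
        show "norm (\<rho> x (\<phi> (map (\<lambda>j. ?R j x) js) x) - \<phi> (map (\<lambda>j. ?R j x) js) x (S x)) \<le> \<gamma>"
          unfolding mp[OF js(1) order_refl] by (rule S(3)[OF \<Phi>_mem[OF js] js(3)])
      qed
    next
      case False
      then have i: "i < m" using that by simp
      then have Ri: "?R i = R i" by simp
      show ?thesis unfolding good_def Ri
      proof (intro conjI allI impI)
        fix js x assume js: "set js \<subseteq> {..<i}" "length js < n" "x \<in> Z"
        show "norm (\<rho> x (\<phi> (map (\<lambda>j. ?R j x) js) x) - \<phi> (map (\<lambda>j. ?R j x) js) x (R i x)) \<le> \<gamma>"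
          unfolding mp[OF js(1) less_imp_le[OF i]] using R[OF i] js unfolding good_def by blast
      qed (use R[OF i] in \<open>auto simp: good_def\<close>)
    qed
    then show ?case by blast
  qed simp
  then obtain R where "\<And>i. i < m \<Longrightarrow> good R i" by blast
  then show ?thesis by (intro that[of R]) (simp_all add: good_def)
qed

text \<open>Replacing \<open>R i x\<close> by \<open>x\<close> slot by slot, from the last one to the first, changes the value of the
  form at a list of \<open>n\<close> increasing indices by at most \<open>\<gamma>\<close> in each step.\<close>

lemma averaged_operator:
  fixes E :: "('k::real_or_complex, 'v::ab_group_add) nspace" and F :: "('k, 'w::ab_group_add) nspace"
  assumes E: "normed_space E" and F: "normed_space F" and \<rho>: "isometric_iso F (bidual E) \<rho>"
    and M: "FIN F M" and Z: "finite Z" "Z \<subseteq> M" and symA: "cont_sym_form n E A"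
    and \<eta>: "0 < \<eta>" and c: "1 < c"
  obtains S where "bounded_linear_on (F\<lparr>carrier := M\<rparr>) E S" "opnorm (F\<lparr>carrier := M\<rparr>) E S \<le> c"
    "\<And>x. x \<in> Z \<Longrightarrow> norm (A (replicate n (S x)) - bidual_ext E (replicate n (\<rho> x)) A) \<le> \<eta>"
proof -
  have MF: "M \<subseteq> carrier F" using M by (simp add: FIN_def)
  have FM: "normed_space (F\<lparr>carrier := M\<rparr>)" by (rule normed_space_FIN[OF F M])
  obtain C where A: "bounded_form n E C A" by (rule cont_sym_form_bounded[OF E symA])
  have sym: "A ys = A xs" if "set xs \<subseteq> carrier E" "length xs = n" "mset ys = mset xs" for xs ys
    using symA that by (auto simp: cont_sym_form_def in_lists_conv_set subset_iff)
  have mlA: "multilinear_form n E A" and C: "0 \<le> C"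
    and boundA: "\<And>xs. set xs \<subseteq> carrier E \<Longrightarrow> length xs = n \<Longrightarrow> norm (A xs) \<le> C * prod_list (map (nrm E) xs)"
    using A by (auto simp: bounded_form_def)
  have \<rho>_mem: "\<rho> x \<in> carrier (dual (dual E))" if "x \<in> Z" for x
    using that Z MF bidual_embedding(1)[OF E F \<rho>] by blast
  \<comment> \<open>The vectors \<open>us\<close> are in the first slots, and \<open>x\<close> is in all the others.\<close>
  define pre where "pre us x = bidual_ext E (replicate (n - length us) (\<rho> x)) (\<lambda>xs. A (us @ xs))" for us x
  define \<phi> where "\<phi> us x = (\<lambda>u. if u \<in> carrier E
    then bidual_ext E (replicate (n - Suc (length us)) (\<rho> x)) (\<lambda>xs. A (us @ u # xs)) else 0)" for us x
  have \<phi>: "\<phi> us x \<in> carrier (dual E)" if us: "set us \<subseteq> carrier E" "length us < n" and x: "x \<in> Z" for us x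
  proof -
    obtain C' where "bounded_form (n - length us) E C' (\<lambda>xs. A (us @ xs))"
      using bounded_form_append[OF E A us(1)] us(2) by auto
    moreover have "n - length us = Suc (length (replicate (n - Suc (length us)) (\<rho> x)))" using us(2) by simp
    ultimately have "bounded_form (Suc (length (replicate (n - Suc (length us)) (\<rho> x)))) E C' (\<lambda>xs. A (us @ xs))"
      by simp
    moreover have "set (replicate (n - Suc (length us)) (\<rho> x)) \<subseteq> carrier (dual (dual E))"
      using \<rho>_mem[OF x] by (auto simp: set_replicate_conv_if)
    ultimately show ?thesis unfolding \<phi>_def using bidual_ext_slice[OF E] by blast
  qed
  have pre_step: "pre us x = \<rho> x (\<phi> us x)" if "length us < n" for us x
  proof -
    have "n - length us = Suc (n - Suc (length us))" using that by simp
    then show ?thesis by (simp add: pre_def \<phi>_def)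
  qed
  have pre_next: "\<phi> us x u = pre (us @ [u]) x" if "u \<in> carrier E" for us x u
    using that by (simp add: pre_def \<phi>_def)
  have pre_full: "pre us x = A us" if "length us = n" for us x
    using that by (simp add: pre_def)
  \<comment> \<open>A bound for the error at every list of indices, repetitions included.\<close>
  define K where "K = (\<Sum>x\<in>Z. C * (c * nrm F x) ^ n + norm (pre [] x))"
  have K_summand: "0 \<le> C * (c * nrm F x) ^ n + norm (pre [] x)" if "x \<in> Z" for x
    using C c that Z MF normed_spaceD(5)[OF F] by (intro add_nonneg_nonneg mult_nonneg_nonneg zero_le_power) auto
  have K0: "0 \<le> K" unfolding K_def using K_summand by (rule sum_nonneg)
  \<comment> \<open>So many operators that the lists with repetitions contribute at most \<open>\<eta> / 2\<close>.\<close>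
  obtain m :: nat where "max (real n) (2 * K * real (n * n) / \<eta>) < real m" using reals_Archimedean2 by blast
  then have m: "n < m" "2 * K * real (n * n) / \<eta> < real m" by auto
  have m0: "0 < real m" using m by simp
  have Km: "K * (real (n * n) / real m) \<le> \<eta> / 2" using m(2) m0 \<eta> by (simp add: field_simps)
  define \<gamma> where "\<gamma> = \<eta> / (2 * (real n + 1))"
  have \<gamma>: "0 < \<gamma>" "real n * \<gamma> \<le> \<eta> / 2" using \<eta> by (auto simp: \<gamma>_def field_simps)
  obtain R where R: "\<And>i. i < m \<Longrightarrow> bounded_linear_on (F\<lparr>carrier := M\<rparr>) E (R i)"
    "\<And>i. i < m \<Longrightarrow> opnorm (F\<lparr>carrier := M\<rparr>) E (R i) \<le> c"
    "\<And>i js x. i < m \<Longrightarrow> set js \<subseteq> {..<i} \<Longrightarrow> length js < n \<Longrightarrow> x \<in> Z \<Longrightarrow>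
      norm (\<rho> x (\<phi> (map (\<lambda>j. R j x) js) x) - \<phi> (map (\<lambda>j. R j x) js) x (R i x)) \<le> \<gamma>"
    using successive_operators[OF E F \<rho> M Z \<gamma>(1) c, of n \<phi> m] \<phi> by metis
  have mem: "R j x \<in> carrier E" if "j < m" "x \<in> M" for j x
    using R(1)[OF that(1)] that(2) by (auto simp: bounded_linear_on_def linear_on_def)
  have Rle: "nrm E (R j x) \<le> c * nrm F x" if "j < m" "x \<in> M" for j x
  proof -
    have "nrm E (R j x) \<le> opnorm (F\<lparr>carrier := M\<rparr>) E (R j) * nrm F x"
      using opnorm_bounded_linear(1)[OF FM E R(1)[OF that(1)], of x] that by simp
    also have "\<dots> \<le> c * nrm F x"
      using R(2)[OF that(1)] that MF normed_spaceD(5)[OF F] by (intro mult_right_mono) auto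
    finally show ?thesis .
  qed
  define S where "S x = smult E (of_real (1 / real m)) (\<Sum>i<m. R i x)" for x
  have sum_mem: "(\<Sum>i<m. R i x) \<in> carrier E" if "x \<in> M" for x
    using mem that by (intro nrm_sum_le[OF E]) auto
  have S_le: "nrm E (S x) \<le> c * nrm F x" if x: "x \<in> M" for x
  proof -
    have "nrm E (\<Sum>i<m. R i x) \<le> (\<Sum>i<m. nrm E (R i x))" using mem x by (intro nrm_sum_le[OF E]) auto
    also have "\<dots> \<le> (\<Sum>i<m. c * nrm F x)" using Rle x by (intro sum_mono) auto
    finally have "nrm E (\<Sum>i<m. R i x) \<le> real m * (c * nrm F x)" by simp
    then show ?thesis using normed_spaceD(7)[OF E sum_mem[OF x]] m0
      by (simp add: S_def norm_divide field_simps)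
  qed
  interpret vE: vector_space "smult E" using E by (rule normed_space_vs)
  have R_lin: "R i (x + y) = R i x + R i y" "R i (smult F k x) = smult E k (R i x)"
    if "i < m" "x \<in> M" "y \<in> M" for i x y k
    using R(1)[OF that(1)] that(2,3) by (auto simp: bounded_linear_on_def linear_on_def)
  have "linear_on (F\<lparr>carrier := M\<rparr>) E S"
    unfolding linear_on_def
  proof (intro conjI ballI allI)
    show "S ` carrier (F\<lparr>carrier := M\<rparr>) \<subseteq> carrier E"
      using sum_mem normed_spaceD(4)[OF E] by (auto simp: S_def)
    fix x assume x: "x \<in> carrier (F\<lparr>carrier := M\<rparr>)"
    show "S (x + y) = S x + S y" if "y \<in> carrier (F\<lparr>carrier := M\<rparr>)" for y
      using R_lin(1)[of _ x y] x that by (simp add: S_def sum.distrib vE.scale_right_distrib)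
    show "S (smult (F\<lparr>carrier := M\<rparr>) k x) = smult E k (S x)" for k
      using R_lin(2)[of _ x x k] x by (simp add: S_def vE.scale_sum_right[symmetric] mult.commute)
  qed
  then have S: "bounded_linear_on (F\<lparr>carrier := M\<rparr>) E S"
    unfolding bounded_linear_on_def using S_le by (auto intro!: exI[of _ c])
  have S_op: "opnorm (F\<lparr>carrier := M\<rparr>) E S \<le> c"
  proof (rule opnorm_bounded_linear(3)[OF FM E S])
    fix x assume x: "x \<in> carrier (F\<lparr>carrier := M\<rparr>)" "nrm (F\<lparr>carrier := M\<rparr>) x \<le> 1"
    then have "c * nrm F x \<le> c * 1" using c by (intro mult_left_mono) auto
    then show "nrm E (S x) \<le> c" using S_le[of x] x by simp
  qed
  \<comment> \<open>In an increasing list the last operator was chosen after all the others, so it is adapted to them.\<close>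
  have tele: "norm (pre (map (\<lambda>j. R j x) js) x - pre [] x) \<le> real (length js) * \<gamma>"
    if "sorted_wrt (<) js" "set js \<subseteq> {..<m}" "length js \<le> n" "x \<in> Z" for js x
    using that
  proof (induction js rule: rev_induct)
    case (snoc i js)
    let ?us = "map (\<lambda>j. R j x) js"
    have i: "i < m" "set js \<subseteq> {..<i}" "length js < n" using snoc.prems by (auto simp: sorted_wrt_append)
    have "R i x \<in> carrier E" using mem i(1) snoc.prems Z by blast
    then have e: "pre (?us @ [R i x]) x = \<phi> ?us x (R i x)" by (simp add: pre_next)
    have "pre ?us x = \<rho> x (\<phi> ?us x)" using i by (intro pre_step) simp
    then have 1: "norm (pre (?us @ [R i x]) x - pre ?us x) \<le> \<gamma>"
      using R(3)[OF i snoc.prems(4)] unfolding e by (simp add: norm_minus_commute)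
    have 2: "norm (pre ?us x - pre [] x) \<le> real (length js) * \<gamma>"
      using snoc.prems by (intro snoc.IH) (auto simp: sorted_wrt_append)
    have "norm (pre (?us @ [R i x]) x - pre [] x) \<le> \<gamma> + real (length js) * \<gamma>"
      using norm_triangle_mono[OF 1 2] by simp
    then show ?case by (simp add: algebra_simps)
  qed simp
  let ?L = "{js. set js \<subseteq> {..<m} \<and> length js = n}"
  have L: "finite ?L" "card ?L = m ^ n"
    using finite_lists_length_eq card_lists_length_eq[of "{..<m}" n] by auto
  have approx: "norm (A (replicate n (S x)) - pre [] x) \<le> \<eta>" if x: "x \<in> Z" for x
  proof -
    have xM: "x \<in> M" using x Z by blast
    have set_js: "set (map (\<lambda>j. R j x) js) \<subseteq> carrier E" if "js \<in> ?L" for js using that mem xM by auto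
    have dist: "norm (A (map (\<lambda>j. R j x) js) - pre [] x) \<le> \<eta> / 2" if js: "js \<in> ?L" "distinct js" for js
    proof -
      have s: "sorted_wrt (<) (sort js)" using js(2) by (simp add: strict_sorted_iff)
      have "A (map (\<lambda>j. R j x) (sort js)) = A (map (\<lambda>j. R j x) js)"
        using set_js[OF js(1)] js(1) by (intro sym) simp_all
      moreover have "pre (map (\<lambda>j. R j x) (sort js)) x = A (map (\<lambda>j. R j x) (sort js))"
        using js by (intro pre_full) simp
      moreover have "norm (pre (map (\<lambda>j. R j x) (sort js)) x - pre [] x) \<le> real (length (sort js)) * \<gamma>"
        using js x by (intro tele s) auto
      ultimately show ?thesis using js(1) \<gamma>(2) by simp
    qed
    have all: "norm (A (map (\<lambda>j. R j x) js) - pre [] x) \<le> K" if js: "js \<in> ?L" for js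
    proof -
      have "norm (A (map (\<lambda>j. R j x) js)) \<le> C * prod_list (map (nrm E) (map (\<lambda>j. R j x) js))"
        using js by (intro boundA set_js) auto
      also have "\<dots> \<le> C * (c * nrm F x) ^ length (map (\<lambda>j. R j x) js)"
        using C js mem Rle xM normed_spaceD(5)[OF E] by (intro mult_left_mono prod_list_le_power) auto
      finally have "norm (A (map (\<lambda>j. R j x) js) - pre [] x) \<le> C * (c * nrm F x) ^ n + norm (pre [] x)"
        using js norm_triangle_ineq4[of "A (map (\<lambda>j. R j x) js)" "pre [] x"] by simp
      also have "\<dots> \<le> K" unfolding K_def using x Z(1) K_summand by (intro member_le_sum) auto
      finally show ?thesis .
    qed
    have "A (replicate n (S x)) = of_real (1 / real m) ^ n * A (replicate n (\<Sum>i<m. R i x))"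
      unfolding S_def using multilinear_form_scale[OF mlA sum_mem[OF xM], of "of_real (1 / real m)" "[]" n]
        normed_spaceD(4)[OF E sum_mem[OF xM]] by simp
    also have "A (replicate n (\<Sum>i<m. R i x)) = (\<Sum>js\<in>?L. A (map (\<lambda>j. R j x) js))"
      using multilinear_form_expand[OF E mlA, of "{..<m}" "\<lambda>i. R i x" "[]" n] mem xM by simp
    also have "\<dots> = (\<Sum>js\<in>?L. A (map (\<lambda>j. R j x) js) - pre [] x) + of_nat (m ^ n) * pre [] x"
      using L by (simp add: sum_subtractf)
    finally have "A (replicate n (S x)) - pre [] x =
        of_real (1 / real m) ^ n * (\<Sum>js\<in>?L. A (map (\<lambda>j. R j x) js) - pre [] x)"
      using m0 by (simp add: field_simps power_divide)
    then have "norm (A (replicate n (S x)) - pre [] x) =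
        (1 / real m) ^ n * norm (\<Sum>js\<in>?L. A (map (\<lambda>j. R j x) js) - pre [] x)"
      by (simp add: norm_mult norm_power norm_divide)
    also have "norm (\<Sum>js\<in>?L. A (map (\<lambda>j. R j x) js) - pre [] x) \<le> (\<Sum>js\<in>?L. \<eta> / 2 + (if distinct js then 0 else K))"
    proof (rule sum_norm_le)
      fix js assume "js \<in> ?L"
      then show "norm (A (map (\<lambda>j. R j x) js) - pre [] x) \<le> \<eta> / 2 + (if distinct js then 0 else K)"
        using dist[of js] all[of js] \<eta> by (cases "distinct js") auto
    qed
    also have "\<dots> = real m ^ n * (\<eta> / 2) + K * real (card {js. set js \<subseteq> {..<m} \<and> length js = n \<and> \<not> distinct js})"
    proof -
      have "(\<Sum>js\<in>?L. if distinct js then 0 else K) = (\<Sum>js\<in>{js \<in> ?L. \<not> distinct js}. K)"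
        using L(1) by (subst sum.inter_filter) (auto intro!: sum.cong)
      also have "{js \<in> ?L. \<not> distinct js} = {js. set js \<subseteq> {..<m} \<and> length js = n \<and> \<not> distinct js}" by auto
      finally show ?thesis using L(2) by (simp add: sum.distrib)
    qed
    also have "\<dots> \<le> real m ^ n * (\<eta> / 2) + K * (real (n * n) / real m * real m ^ n)"
      using card_nondistinct_lists[OF m(1)] K0 by (intro add_left_mono mult_left_mono)
    also have "\<dots> = real m ^ n * (\<eta> / 2 + K * (real (n * n) / real m))" by (simp add: algebra_simps)
    also have "\<dots> \<le> real m ^ n * \<eta>" 
      by (rule mult_left_mono) (use Km in linarith, simp)
    finally show ?thesis using m0 by (simp add: power_divide field_simps)
  qed
  show ?thesis using that[OF S S_op] approx by (simp add: pre_def)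
qed

section \<open>Functionals on symmetric tensors\<close>

lemma sum_list_fun_apply: "sum_list (map f r) A = (\<Sum>a\<leftarrow>r. f a A)"
  by (induction r) auto

lemma represents_apply:
  assumes "represents n X r z"
  shows "z A = (\<Sum>(c, x)\<leftarrow>r. if multilinear_form n X A then c * A (replicate n x) else 0)"
  using assms unfolding represents_def
  by (auto simp: sum_list_fun_apply split_def fscale_def tensor_power_def elem_tensor_def
      intro!: arg_cong[where f = sum_list] map_cong)

lemma represents_append: "represents n X r z \<Longrightarrow> represents n X r' z' \<Longrightarrow> represents n X (r @ r') (z + z')"
  by (auto simp: represents_def)

lemma represents_scale:
  assumes "represents n X r z"
  shows "represents n X (map (\<lambda>(c, x). (k * c, x)) r) (fscale k z)"
proof -
  interpret vector_space fscale by (rule vector_space_fscale)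
  have "fscale k (\<Sum>(c, x)\<leftarrow>r. fscale c (tensor_power n X x)) =
      (\<Sum>(c, x)\<leftarrow>map (\<lambda>(c, x). (k * c, x)) r. fscale c (tensor_power n X x))"
    by (rule ext) (simp add: sum_list_fun_apply split_def fscale_def sum_list_const_mult o_def mult.assoc)
  then show ?thesis using assms by (auto simp: represents_def)
qed

lemma represents_sym_tensors: "represents n X r z \<Longrightarrow> z \<in> sym_tensors n X"
proof -
  interpret vector_space fscale by (rule vector_space_fscale)
  have "snd ` set r \<subseteq> carrier X \<Longrightarrow> (\<Sum>(c, x)\<leftarrow>r. fscale c (tensor_power n X x)) \<in> sym_tensors n X"
  proof (induction r)
    case Nil
    show ?case unfolding sym_tensors_def using span_zero by (simp only: list.map sum_list.Nil)
  next
    case (Cons a r)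
    have "fscale (fst a) (tensor_power n X (snd a)) \<in> sym_tensors n X"
      using Cons.prems unfolding sym_tensors_def by (intro span_scale span_base) auto
    moreover have "(\<Sum>(c, x)\<leftarrow>r. fscale c (tensor_power n X x)) \<in> sym_tensors n X"
      using Cons by simp
    ultimately show ?case unfolding sym_tensors_def list.map sum_list.Cons split_def by (rule span_add)
  qed
  then show "represents n X r z \<Longrightarrow> z \<in> sym_tensors n X" by (simp add: represents_def)
qed

lemma sym_tensors_represents:
  assumes "z \<in> sym_tensors n X"
  obtains r where "represents n X r z"
proof -
  interpret vector_space fscale by (rule vector_space_fscale)
  have "\<exists>r. represents n X r z"
    using assms unfolding sym_tensors_def
  proof (induction rule: span_induct_alt)
    case base
    show ?case by (rule exI[of _ "[]"]) (simp add: represents_def zero_fun_def)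
  next
    case (step c t w)
    then obtain x r where x: "x \<in> carrier X" "t = tensor_power n X x" and r: "represents n X r w" by auto
    have "represents n X ((c, x) # r) (fscale c t + w)" using x r by (simp add: represents_def)
    then show ?case by blast
  qed
  then show ?thesis using that by blast
qed

text \<open>The value does not depend on the representation because it equals \<open>z A\<close> for a form \<open>A\<close> of \<open>p\<close>,
  tensors being functions of forms.\<close>

lemma lin_functional_represents:
  assumes p: "cont_polynomial n X p" and r: "represents n X r z"
  shows "lin_functional n X p z = (\<Sum>(c, x)\<leftarrow>r. c * p x)"
proof -
  obtain A where A: "multilinear_form n X A" "\<And>x. x \<in> carrier X \<Longrightarrow> p x = A (replicate n x)"
    using p by (auto simp: cont_polynomial_def cont_sym_form_def)
  have eval: "(\<Sum>(c, x)\<leftarrow>r. c * p x) = z A" if "represents n X r z" for r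
  proof -
    have "snd ` set r \<subseteq> carrier X" using that by (simp add: represents_def)
    then have "(\<Sum>(c, x)\<leftarrow>r. c * p x) = (\<Sum>(c, x)\<leftarrow>r. c * A (replicate n x))"
      using A(2) by (intro arg_cong[where f = sum_list] map_cong) auto
    then show ?thesis using represents_apply[OF that, of A] A(1) by simp
  qed
  have "(THE v. \<exists>r. represents n X r z \<and> v = (\<Sum>(c, x)\<leftarrow>r. c * p x)) = z A"
  proof (rule the_equality)
    show "\<exists>r. represents n X r z \<and> z A = (\<Sum>(c, x)\<leftarrow>r. c * p x)" using r eval[OF r] by auto
  qed (use eval in auto)
  then show ?thesis using represents_sym_tensors[OF r] eval[OF r] by (simp add: lin_functional_def)
qed

lemma lin_functional_linear:
  assumes p: "cont_polynomial n X p" and z: "z \<in> sym_tensors n X"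
  shows "w \<in> sym_tensors n X \<Longrightarrow> lin_functional n X p (z + w) = lin_functional n X p z + lin_functional n X p w"
    and "lin_functional n X p (fscale k z) = k * lin_functional n X p z"
proof -
  obtain r where r: "represents n X r z" by (rule sym_tensors_represents[OF z])
  show "lin_functional n X p (z + w) = lin_functional n X p z + lin_functional n X p w" if w: "w \<in> sym_tensors n X"
  proof -
    obtain r' where r': "represents n X r' w" by (rule sym_tensors_represents[OF w])
    show ?thesis
      using lin_functional_represents[OF p r] lin_functional_represents[OF p r']
        lin_functional_represents[OF p represents_append[OF r r']] by simp
  qed
  have "(\<Sum>(c, x)\<leftarrow>map (\<lambda>(c, x). (k * c, x)) r. c * p x) = k * (\<Sum>(c, x)\<leftarrow>r. c * p x)"
    by (induction r) (auto simp: algebra_simps)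
  then show "lin_functional n X p (fscale k z) = k * lin_functional n X p z"
    using lin_functional_represents[OF p r] lin_functional_represents[OF p represents_scale[OF r, of k]] by simp
qed

lemma tensor_map_represents:
  assumes X: "normed_space X" and T: "linear_on X Y T" and r: "represents n X r z"
  shows "represents n Y (map (\<lambda>(c, x). (c, T x)) r) (tensor_map n Y T z)"
proof -
  have T': "T x \<in> carrier Y" if "x \<in> carrier X" for x using T that by (auto simp: linear_on_def)
  have r': "snd ` set r \<subseteq> carrier X" using r by (simp add: represents_def)
  have "tensor_map n Y T z B = (\<Sum>(c, x)\<leftarrow>map (\<lambda>(c, x). (c, T x)) r. fscale c (tensor_power n Y x)) B" for B
  proof (cases "multilinear_form n Y B")
    case True
    have "multilinear_form n X (\<lambda>xs. B (map T xs))"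
    proof (rule multilinear_formI)
      fix us x y vs c
      assume *: "set us \<subseteq> carrier X" "set vs \<subseteq> carrier X" "x \<in> carrier X" "y \<in> carrier X" "Suc (length us + length vs) = n"
      have "set (map T us) \<subseteq> carrier Y" "set (map T vs) \<subseteq> carrier Y" using * T' by auto
      then show "B (map T (us @ (x + y) # vs)) = B (map T (us @ x # vs)) + B (map T (us @ y # vs)) \<and>
          B (map T (us @ smult X c x # vs)) = c * B (map T (us @ x # vs))"
        using multilinear_form_slot[OF True, of "map T us" "map T vs" "T x"] * T' T
        by (simp add: linear_on_def)
    qed
    then have "tensor_map n Y T z B = (\<Sum>(c, x)\<leftarrow>r. c * B (replicate n (T x)))"
      using represents_apply[OF r, of "\<lambda>xs. B (map T xs)"] True by (simp add: tensor_map_def)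
    then show ?thesis using True
      by (simp add: sum_list_fun_apply split_def fscale_def tensor_power_def elem_tensor_def o_def)
  next
    case False
    then show ?thesis
      by (induction r) (auto simp: tensor_map_def fscale_def tensor_power_def elem_tensor_def)
  qed
  then show ?thesis using r' T' by (auto simp: represents_def)
qed

lemma tensor_space_simps [simp]:
  "carrier (tensor_space n \<alpha> X) = sym_tensors n X" "smult (tensor_space n \<alpha> X) = fscale" "nrm (tensor_space n \<alpha> X) = \<alpha> X"
  by (simp_all add: tensor_space_def)

lemma tensor_dual_norm_bound:
  assumes \<alpha>: "s_tensor_norm n \<alpha>" and X: "normed_space X" and p: "p \<in> tensor_dual n \<alpha> X" and z: "z \<in> sym_tensors n X"
  shows "norm (lin_functional n X p z) \<le> tensor_dual_norm n \<alpha> X p * \<alpha> X z"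
proof -
  have "normed_space (tensor_space n \<alpha> X)" using \<alpha> X by (simp add: s_tensor_norm_def)
  then show ?thesis unfolding tensor_dual_norm_def
    using dual_norm_le[of "tensor_space n \<alpha> X" "lin_functional n X p" z] p z by (simp add: tensor_dual_def)
qed

lemma tensor_dual_normI:
  assumes \<alpha>: "s_tensor_norm n \<alpha>" and X: "normed_space X" and p: "cont_polynomial n X p"
    and le: "\<And>z. z \<in> sym_tensors n X \<Longrightarrow> norm (lin_functional n X p z) \<le> C * \<alpha> X z" and C: "0 \<le> C"
  shows "p \<in> tensor_dual n \<alpha> X" and "tensor_dual_norm n \<alpha> X p \<le> C"
proof -
  have T: "normed_space (tensor_space n \<alpha> X)" using \<alpha> X by (simp add: s_tensor_norm_def)
  have mem: "lin_functional n X p \<in> carrier (dual (tensor_space n \<alpha> X))"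
  proof (rule dualI[where C = C])
    show "lin_functional n X p z = 0" if "z \<notin> carrier (tensor_space n \<alpha> X)" for z
      using that by (simp add: lin_functional_def)
  qed (use le lin_functional_linear[OF p] in auto)
  then show "p \<in> tensor_dual n \<alpha> X" using p by (simp add: tensor_dual_def)
  have "opnorm (tensor_space n \<alpha> X) scalars (lin_functional n X p) \<le> C"
  proof (rule opnorm_dual(3)[OF T dualD(4)[OF mem]])
    fix z assume z: "z \<in> carrier (tensor_space n \<alpha> X)" "nrm (tensor_space n \<alpha> X) z \<le> 1"
    then have "C * \<alpha> X z \<le> C * 1" using C by (intro mult_left_mono) auto
    then show "norm (lin_functional n X p z) \<le> C" using le z by force
  qed
  then show "tensor_dual_norm n \<alpha> X p \<le> C" by (simp add: tensor_dual_norm_def dual_simps)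
qed

lemma tensor_dual_norm_nonneg:
  assumes \<alpha>: "s_tensor_norm n \<alpha>" and X: "normed_space X" and p: "p \<in> tensor_dual n \<alpha> X"
  shows "0 \<le> tensor_dual_norm n \<alpha> X p"
proof -
  have "normed_space (tensor_space n \<alpha> X)" using \<alpha> X by (simp add: s_tensor_norm_def)
  then have "normed_space (dual (tensor_space n \<alpha> X))" by (rule normed_space_dual)
  then show ?thesis using p by (simp add: tensor_dual_norm_def tensor_dual_def normed_spaceD(5))
qed

lemma tensor_map_norm:
  assumes \<alpha>: "s_tensor_norm n \<alpha>" and X: "normed_space X" and Y: "normed_space Y"
    and T: "bounded_linear_on X Y T" and c: "opnorm X Y T \<le> c" and z: "z \<in> sym_tensors n X"
  shows "tensor_map n Y T z \<in> sym_tensors n Y" "\<alpha> Y (tensor_map n Y T z) \<le> c ^ n * \<alpha> X z"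
proof -
  have N: "normed_space (tensor_space n \<alpha> X)" "normed_space (tensor_space n \<alpha> Y)"
    using \<alpha> X Y by (auto simp: s_tensor_norm_def)
  have TT: "bounded_linear_on (tensor_space n \<alpha> X) (tensor_space n \<alpha> Y) (tensor_map n Y T)"
    and op: "opnorm (tensor_space n \<alpha> X) (tensor_space n \<alpha> Y) (tensor_map n Y T) \<le> opnorm X Y T ^ n"
    using \<alpha> X Y T unfolding s_tensor_norm_def by blast+
  show "tensor_map n Y T z \<in> sym_tensors n Y"
    using TT z by (auto simp: bounded_linear_on_def linear_on_def)
  have "\<alpha> Y (tensor_map n Y T z) \<le> opnorm (tensor_space n \<alpha> X) (tensor_space n \<alpha> Y) (tensor_map n Y T) * \<alpha> X z"
    using opnorm_bounded_linear(1)[OF N TT, of z] z by simp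
  also have "\<dots> \<le> c ^ n * \<alpha> X z"
  proof (rule mult_right_mono)
    have "opnorm X Y T ^ n \<le> c ^ n" using opnorm_bounded_linear(2)[OF X Y T] c by (intro power_mono)
    with op show "opnorm (tensor_space n \<alpha> X) (tensor_space n \<alpha> Y) (tensor_map n Y T) \<le> c ^ n" by simp
    show "0 \<le> \<alpha> X z" using normed_spaceD(5)[OF N(1), of z] z by simp
  qed
  finally show "\<alpha> Y (tensor_map n Y T z) \<le> c ^ n * \<alpha> X z" .
qed

section \<open>The extension lemma\<close>

text \<open>Limits along the weak-star filter are unique since local reflexivity, applied to the line through
  \<open>y\<close>, shows that the filter is proper.\<close>

lemma aron_berner_eq_bidual_ext:
  fixes E :: "('k::real_or_complex, 'v::ab_group_add) nspace" and F :: "('k, 'w::ab_group_add) nspace"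
  assumes E: "normed_space E" and F: "normed_space F" and \<rho>: "isometric_iso F (bidual E) \<rho>"
    and A: "bounded_form n E C (sym_form_of n E p)" and y: "y \<in> carrier F"
  shows "aron_berner n E p (\<rho> y) = bidual_ext E (replicate n (\<rho> y)) (sym_form_of n E p)"
proof -
  interpret F: vector_space "smult F" using F by (rule normed_space_vs)
  have M: "FIN F (F.span {y})"
    using y normed_space_subspace[OF F] by (auto simp: FIN_def intro: F.span_minimal[THEN subsetD])
  have nt: "wstar_to E (\<rho> y) \<noteq> bot"
  proof (rule wstar_to_nontrivial)
    fix \<Phi> and \<delta> :: real assume \<Phi>: "finite \<Phi>" "\<Phi> \<subseteq> carrier (dual E)" and \<delta>: "0 < \<delta>"
    have Z: "finite {y}" "{y} \<subseteq> F.span {y}" by (auto simp: F.span_base)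
    have "0 < \<delta> / 2" "1 < (2::real)" using \<delta> by auto
    then obtain R where R: "bounded_linear_on (F\<lparr>carrier := F.span {y}\<rparr>) E R"
      "\<And>\<phi> x. \<phi> \<in> \<Phi> \<Longrightarrow> x \<in> {y} \<Longrightarrow> norm (\<rho> x \<phi> - \<phi> (R x)) \<le> \<delta> / 2"
      using local_reflexivity[OF E F \<rho> M \<Phi> Z, of "\<delta> / 2" 2] by metis
    have "R y \<in> carrier E" using R(1) Z(2) by (auto simp: bounded_linear_on_def linear_on_def)
    moreover have "norm (\<rho> y \<phi> - \<phi> (R y)) < \<delta>" if "\<phi> \<in> \<Phi>" for \<phi> using R(2)[OF that, of y] \<delta> by simp
    ultimately show "\<exists>x\<in>carrier E. \<forall>\<phi>\<in>\<Phi>. norm (\<rho> y \<phi> - \<phi> x) < \<delta>" by blast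
  qed
  have "\<rho> y \<in> carrier (dual (dual E))" by (rule bidual_embedding(1)[OF E F \<rho> y])
  then show ?thesis unfolding aron_berner_def iterated_extension_def
    using nt A by (intro iter_lim_eq_bidual_ext[OF E]) (auto simp: set_replicate_conv_if split: if_splits)
qed

lemma canonical_embedding:
  fixes E :: "('k::real_or_complex, 'v::ab_group_add) nspace" and F :: "('k, 'w::ab_group_add) nspace"
  assumes E: "normed_space E" and F: "normed_space F" and \<rho>: "isometric_iso F (bidual E) \<rho>"
  obtains J where "bounded_linear_on E F J" "opnorm E F J \<le> 1"
    "\<forall>x\<in>carrier E. \<rho> (J x) = (\<lambda>\<phi>. if \<phi> \<in> carrier (dual E) then \<phi> x else 0)"
proof -
  let ?ev = "\<lambda>x \<phi>. if \<phi> \<in> carrier (dual E) then \<phi> x else 0"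
  have D: "normed_space (dual E)" by (rule normed_space_dual[OF E])
  have le: "norm (?ev x \<phi>) \<le> nrm E x * nrm (dual E) \<phi>" if "x \<in> carrier E" "\<phi> \<in> carrier (dual E)" for x \<phi>
    using dual_norm_le[OF E that(2,1)] that by (simp add: mult.commute)
  have ev: "?ev x \<in> carrier (dual (dual E))" if "x \<in> carrier E" for x
  proof (rule dualI[OF _ _ _ le[OF that]])
  qed (use normed_spaceD(3,4)[OF D] in \<open>auto simp: dual_simps(2) fscale_def\<close>)
  have ev_norm: "nrm (dual (dual E)) (?ev x) \<le> nrm E x" if x: "x \<in> carrier E" for x
  proof -
    have "opnorm (dual E) scalars (?ev x) \<le> nrm E x"
    proof (rule opnorm_dual(3)[OF D dualD(4)[OF ev[OF x]]])
      fix \<phi> assume \<phi>: "\<phi> \<in> carrier (dual E)" "nrm (dual E) \<phi> \<le> 1"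
      have "nrm E x * nrm (dual E) \<phi> \<le> nrm E x * 1"
        using \<phi> normed_spaceD(5)[OF E x] by (intro mult_left_mono) auto
      then show "norm (?ev x \<phi>) \<le> nrm E x" using le[OF x \<phi>(1)] by simp
    qed
    then show ?thesis by (simp add: dual_simps)
  qed
  have surj: "\<rho> ` carrier F = carrier (dual (dual E))" using \<rho> by (simp add: isometric_iso_def bidual_def)
  have \<rho>a: "\<rho> (x + y) = \<rho> x + \<rho> y" if "x \<in> carrier F" "y \<in> carrier F" for x y
    using \<rho> that by (simp add: isometric_iso_def linear_on_def)
  have \<rho>s: "\<rho> (smult F c x) = fscale c (\<rho> x)" if "x \<in> carrier F" for x c
    using \<rho> that by (simp add: isometric_iso_def linear_on_def bidual_def dual_simps)
  have inj: "x = y" if x: "x \<in> carrier F" and y: "y \<in> carrier F" and eq: "\<rho> x = \<rho> y" for x y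
  proof -
    have d: "x - y \<in> carrier F" by (rule nrm_minus_commute(1)[OF F x y])
    have "\<rho> ((x - y) + y) = \<rho> (x - y) + \<rho> y" by (rule \<rho>a[OF d y])
    then have "\<rho> (x - y) = 0" using eq by simp
    moreover have "nrm (dual (dual E)) 0 = 0" by (rule normed_spaceD(2)[OF normed_space_dual[OF D]])
    ultimately have "nrm F (x - y) = 0" using bidual_embedding(2)[OF E F \<rho> d] by simp
    then show ?thesis using normed_spaceD(6)[OF F d] by simp
  qed
  define J where "J x = inv_into (carrier F) \<rho> (?ev x)" for x
  have J: "J x \<in> carrier F" "\<rho> (J x) = ?ev x" if "x \<in> carrier E" for x
  proof -
    have "?ev x \<in> \<rho> ` carrier F" using ev[OF that] surj by simp
    then show "J x \<in> carrier F" "\<rho> (J x) = ?ev x" unfolding J_def by (rule inv_into_into, rule f_inv_into_f)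
  qed
  have J_norm: "nrm F (J x) \<le> nrm E x" if "x \<in> carrier E" for x
    using bidual_embedding(2)[OF E F \<rho> J(1)[OF that]] ev_norm[OF that] J(2)[OF that] by simp
  have "linear_on E F J" unfolding linear_on_def
  proof (intro conjI ballI allI)
    show "J ` carrier E \<subseteq> carrier F" using J(1) by blast
    fix x assume x: "x \<in> carrier E"
    show "J (x + y) = J x + J y" if y: "y \<in> carrier E" for y
    proof (rule inj)
      have xy: "x + y \<in> carrier E" by (rule normed_spaceD(3)[OF E x y])
      show "J (x + y) \<in> carrier F" using J(1)[OF xy] .
      show "J x + J y \<in> carrier F" using J(1) x y by (intro normed_spaceD(3)[OF F])
      have "?ev (x + y) = ?ev x + ?ev y" using x y by (auto simp: fun_eq_iff dualD(1))
      then show "\<rho> (J (x + y)) = \<rho> (J x + J y)"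
        by (simp only: \<rho>a[OF J(1)[OF x] J(1)[OF y]] J(2)[OF x] J(2)[OF y] J(2)[OF xy])
    qed
    show "J (smult E c x) = smult F c (J x)" for c
    proof (rule inj)
      have cx: "smult E c x \<in> carrier E" by (rule normed_spaceD(4)[OF E x])
      show "J (smult E c x) \<in> carrier F" using J(1)[OF cx] .
      show "smult F c (J x) \<in> carrier F" using J(1)[OF x] by (rule normed_spaceD(4)[OF F])
      have "?ev (smult E c x) = fscale c (?ev x)" using x by (auto simp: fun_eq_iff fscale_def dualD(2))
      then show "\<rho> (J (smult E c x)) = \<rho> (smult F c (J x))"
        by (simp only: \<rho>s[OF J(1)[OF x]] J(2)[OF x] J(2)[OF cx])
    qed
  qed
  then have bl: "bounded_linear_on E F J"
    unfolding bounded_linear_on_def using J_norm by (auto intro!: exI[of _ 1])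
  have op: "opnorm E F J \<le> 1"
    using J_norm by (intro opnorm_bounded_linear(3)[OF E F bl]) (auto intro: order_trans)
  show ?thesis using J(2) by (intro that[OF bl op] ballI)
qed

text \<open>The averaged operators \<open>S\<close> carry \<open>w\<close> to tensors over \<open>E\<close> at which the value of \<open>p\<close> is close to the
  sum in question, and which have \<open>\<alpha>\<close>-norm at most \<open>c\<^sup>n\<close> times that of \<open>w\<close>. Then \<open>c\<close> tends to
  one.\<close>

lemma aron_berner_finite_dim_bound:
  fixes E F :: "('k::real_or_complex, 'u::ab_group_add) nspace"
  assumes \<alpha>: "s_tensor_norm n \<alpha>" and E: "normed_space E" and F: "normed_space F"
    and \<rho>: "isometric_iso F (bidual E) \<rho>" and p: "p \<in> tensor_dual n \<alpha> E"
    and A: "cont_sym_form n E A" "\<And>x. x \<in> carrier E \<Longrightarrow> p x = A (replicate n x)"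
    and M: "FIN F M" and r: "represents n (F\<lparr>carrier := M\<rparr>) r w"
  shows "norm (\<Sum>(c, x)\<leftarrow>r. c * bidual_ext E (replicate n (\<rho> x)) A) \<le>
    tensor_dual_norm n \<alpha> E p * \<alpha> (F\<lparr>carrier := M\<rparr>) w"
proof -
  let ?FM = "F\<lparr>carrier := M\<rparr>" and ?N = "tensor_dual_norm n \<alpha> E p"
  let ?AB = "\<lambda>x. bidual_ext E (replicate n (\<rho> x)) A"
  have FM: "normed_space ?FM" by (rule normed_space_FIN[OF F M])
  have w: "w \<in> sym_tensors n ?FM" by (rule represents_sym_tensors[OF r])
  have Z: "finite (snd ` set r)" "snd ` set r \<subseteq> M" using r by (auto simp: represents_def)
  have main: "norm (\<Sum>(c, x)\<leftarrow>r. c * ?AB x) \<le> (?N * \<alpha> ?FM w) * c ^ n" if c: "1 < c" for c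
  proof (rule field_le_epsilon)
    fix e :: real assume e: "0 < e"
    \<comment> \<open>The tolerance \<open>\<eta>\<close> for each summand keeps the total error below \<open>e\<close>; adding \<open>1\<close> covers \<open>s = 0\<close>.\<close>
    define s where "s = (\<Sum>(c, x)\<leftarrow>r. norm c)"
    have s: "0 \<le> s" unfolding s_def by (intro sum_list_nonneg) auto
    define \<eta> where "\<eta> = e / (s + 1)"
    have \<eta>: "0 < \<eta>" "s * \<eta> \<le> e" using e s by (auto simp: \<eta>_def field_simps)
    obtain S where S: "bounded_linear_on ?FM E S" "opnorm ?FM E S \<le> c"
      "\<And>x. x \<in> snd ` set r \<Longrightarrow> norm (A (replicate n (S x)) - ?AB x) \<le> \<eta>"
      using averaged_operator[OF E F \<rho> M Z A(1) \<eta>(1) c] by metis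
    have Sm: "S x \<in> carrier E" if "x \<in> M" for x using S(1) that by (auto simp: bounded_linear_on_def linear_on_def)
    have "norm (\<Sum>(c, x)\<leftarrow>r. c * p (S x)) \<le> ?N * (c ^ n * \<alpha> ?FM w)"
    proof -
      have "linear_on ?FM E S" using S(1) by (simp add: bounded_linear_on_def)
      then have rep: "represents n E (map (\<lambda>(c, x). (c, S x)) r) (tensor_map n E S w)"
        by (rule tensor_map_represents[OF FM _ r])
      have "cont_polynomial n E p" using p by (simp add: tensor_dual_def)
      then have "lin_functional n E p (tensor_map n E S w) = (\<Sum>(c, x)\<leftarrow>r. c * p (S x))"
        using lin_functional_represents[OF _ rep] by (simp add: o_def split_def)
      moreover note tm = tensor_map_norm[OF \<alpha> FM E S(1,2) w]
      have "norm (lin_functional n E p (tensor_map n E S w)) \<le> ?N * \<alpha> E (tensor_map n E S w)"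
        by (rule tensor_dual_norm_bound[OF \<alpha> E p tm(1)])
      moreover have "?N * \<alpha> E (tensor_map n E S w) \<le> ?N * (c ^ n * \<alpha> ?FM w)"
        using tm(2) tensor_dual_norm_nonneg[OF \<alpha> E p] by (rule mult_left_mono)
      ultimately show ?thesis by simp
    qed
    moreover have "norm ((\<Sum>(c, x)\<leftarrow>r. c * p (S x)) - (\<Sum>(c, x)\<leftarrow>r. c * ?AB x)) \<le> s * \<eta>"
    proof -
      have le: "norm (p (S x) - ?AB x) \<le> \<eta>" if "x \<in> snd ` set r" for x
        using S(3)[OF that] A(2)[OF Sm] Z(2) that by auto
      have "norm ((\<Sum>(c, x)\<leftarrow>r'. c * p (S x)) - (\<Sum>(c, x)\<leftarrow>r'. c * ?AB x)) \<le> (\<Sum>(c, x)\<leftarrow>r'. norm c) * \<eta>"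
        if "set r' \<subseteq> set r" for r'
        using that
      proof (induction r')
        case (Cons a r')
        obtain b x where a: "a = (b, x)" by (cases a)
        have "x \<in> snd ` set r" using Cons.prems a by force
        then have 1: "norm (b * p (S x) - b * ?AB x) \<le> norm b * \<eta>"
          using mult_left_mono[OF le, of x "norm b"] by (simp add: norm_mult[symmetric] right_diff_distrib)
        have 2: "norm ((\<Sum>(c, x)\<leftarrow>r'. c * p (S x)) - (\<Sum>(c, x)\<leftarrow>r'. c * ?AB x)) \<le> (\<Sum>(c, x)\<leftarrow>r'. norm c) * \<eta>"
          using Cons by simp
        show ?case using norm_triangle_mono[OF 1 2] by (simp add: a algebra_simps)
      qed simp
      then show ?thesis by (simp add: s_def)
    qed
    ultimately show "norm (\<Sum>(c, x)\<leftarrow>r. c * ?AB x) \<le> (?N * \<alpha> ?FM w) * c ^ n + e"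
      using \<eta>(2) norm_triangle_ineq2[of "\<Sum>(c, x)\<leftarrow>r. c * ?AB x" "\<Sum>(c, x)\<leftarrow>r. c * p (S x)"]
      by (simp add: norm_minus_commute mult_ac)
  qed
  have lim: "((\<lambda>c. (?N * \<alpha> ?FM w) * c ^ n) \<longlongrightarrow> (?N * \<alpha> ?FM w) * 1 ^ n) (at_right 1)"
    by (intro tendsto_intros)
  have "\<forall>\<^sub>F c in at_right (1::real). norm (\<Sum>(c, x)\<leftarrow>r. c * ?AB x) \<le> (?N * \<alpha> ?FM w) * c ^ n"
    using main by (auto simp: eventually_at_filter intro!: always_eventually)
  from tendsto_lowerbound[OF lim this] show ?thesis by simp
qed

theorem lemma2p2:
  fixes n :: nat
    and \<alpha> :: "('k::real_or_complex, 'u::ab_group_add) tnorm"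
    and E F :: "('k, 'u) nspace"
    and \<rho> :: "'u \<Rightarrow> ('u \<Rightarrow> 'k) \<Rightarrow> 'k"
    and p :: "'u \<Rightarrow> 'k"
  assumes "s_tensor_norm n \<alpha>" and "finitely_generated n \<alpha>"
    and "normed_space E"
    and "normed_space F" and "isometric_iso F (bidual E) \<rho>"
    and "p \<in> tensor_dual n \<alpha> E"
  shows "(\<lambda>y. aron_berner n E p (\<rho> y)) \<in> tensor_dual n \<alpha> F \<and>
         tensor_dual_norm n \<alpha> E p = tensor_dual_norm n \<alpha> F (\<lambda>y. aron_berner n E p (\<rho> y))"
proof -
  note \<alpha> = assms(1) and fin_gen = assms(2) and E = assms(3) and F = assms(4) and \<rho> = assms(5) and p = assms(6)
  let ?q = "\<lambda>y. aron_berner n E p (\<rho> y)" and ?N = "tensor_dual_norm n \<alpha> E p"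
  interpret F: vector_space "smult F" using F by (rule normed_space_vs)
  define A where "A = sym_form_of n E p"
  have "\<exists>A. cont_sym_form n E A \<and> (\<forall>x\<in>carrier E. p x = A (replicate n x))"
    using p by (simp add: tensor_dual_def cont_polynomial_def)
  then have "cont_sym_form n E A \<and> (\<forall>x\<in>carrier E. p x = A (replicate n x))"
    unfolding A_def sym_form_of_def by (rule someI_ex)
  then have A: "cont_sym_form n E A" "\<And>x. x \<in> carrier E \<Longrightarrow> p x = A (replicate n x)" by auto
  obtain C where C: "bounded_form n E C A" by (rule cont_sym_form_bounded[OF E A(1)])
  have AB: "?q y = bidual_ext E (replicate n (\<rho> y)) A" if "y \<in> carrier F" for y
    using aron_berner_eq_bidual_ext[OF E F \<rho> _ that] C unfolding A_def by blast
  have "cont_polynomial n F (\<lambda>y. bidual_ext E (replicate n (\<rho> y)) A)"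
    by (rule bidual_ext_cont_polynomial[OF E F \<rho> C])
  then obtain B where "cont_sym_form n F B" "\<And>y. y \<in> carrier F \<Longrightarrow> bidual_ext E (replicate n (\<rho> y)) A = B (replicate n y)"
    unfolding cont_polynomial_def by blast
  then have q: "cont_polynomial n F ?q" unfolding cont_polynomial_def by (intro exI[of _ B]) (simp add: AB)
  have N0: "0 \<le> ?N" by (rule tensor_dual_norm_nonneg[OF \<alpha> E p])
  have upper: "norm (lin_functional n F ?q z) \<le> ?N * \<alpha> F z" if z: "z \<in> sym_tensors n F" for z
  proof -
    let ?V = "{\<alpha> (F\<lparr>carrier := M\<rparr>) w | M w.
      FIN F M \<and> w \<in> sym_tensors n (F\<lparr>carrier := M\<rparr>) \<and> tensor_map n F id w = z}"
    have inclusion: "linear_on (F\<lparr>carrier := M\<rparr>) F id" if "FIN F M" for M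
      using that by (auto simp: linear_on_def FIN_def)
    have le: "norm (lin_functional n F ?q z) \<le> ?N * v" if "v \<in> ?V" for v
    proof -
      obtain M w where M: "FIN F M" and w: "w \<in> sym_tensors n (F\<lparr>carrier := M\<rparr>)"
        and wz: "tensor_map n F id w = z" and v: "v = \<alpha> (F\<lparr>carrier := M\<rparr>) w" using \<open>v \<in> ?V\<close> by blast
      obtain r where r: "represents n (F\<lparr>carrier := M\<rparr>) r w" by (rule sym_tensors_represents[OF w])
      have rz: "represents n F r z"
        using tensor_map_represents[OF normed_space_FIN[OF F M] inclusion[OF M] r] wz by simp
      have "lin_functional n F ?q z = (\<Sum>(c, x)\<leftarrow>r. c * bidual_ext E (replicate n (\<rho> x)) A)"
        unfolding lin_functional_represents[OF q rz] using rz AB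
        by (intro arg_cong[where f = sum_list] map_cong) (auto simp: represents_def image_subset_iff)
      then show ?thesis
        using aron_berner_finite_dim_bound[OF \<alpha> E F \<rho> p A M r] v by simp
    qed
    obtain r where r: "represents n F r z" by (rule sym_tensors_represents[OF z])
    define M where "M = F.span (snd ` set r)"
    have rF: "snd ` set r \<subseteq> carrier F" using r by (simp add: represents_def)
    have M: "FIN F M" unfolding FIN_def M_def
      using rF normed_space_subspace[OF F] by (auto intro: F.span_minimal[THEN subsetD])
    define w where "w = (\<Sum>(c, x)\<leftarrow>r. fscale c (tensor_power n (F\<lparr>carrier := M\<rparr>) x))"
    have rw: "represents n (F\<lparr>carrier := M\<rparr>) r w"
      by (auto simp: represents_def w_def M_def intro: F.span_base)
    have "represents n F r (tensor_map n F id w)"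
      using tensor_map_represents[OF normed_space_FIN[OF F M] inclusion[OF M] rw] by simp
    then have "tensor_map n F id w = z" using r by (simp add: represents_def)
    then have "\<alpha> (F\<lparr>carrier := M\<rparr>) w \<in> ?V" using M represents_sym_tensors[OF rw] by blast
    then have ne: "?V \<noteq> {}" by blast
    have \<alpha>_Inf: "\<alpha> F z = Inf ?V" using fin_gen F z unfolding finitely_generated_def by blast
    show ?thesis
    proof (cases "?N = 0")
      case True
      then show ?thesis using le ne by fastforce
    next
      case False
      then have pos: "0 < ?N" using N0 by simp
      have "norm (lin_functional n F ?q z) / ?N \<le> Inf ?V"
        using le pos by (intro cInf_greatest[OF ne]) (simp add: field_simps)
      then show ?thesis using pos \<alpha>_Inf by (simp add: field_simps)
    qed
  qed
  note qI = tensor_dual_normI[OF \<alpha> F q upper N0]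
  obtain J where J: "bounded_linear_on E F J" "opnorm E F J \<le> 1"
    "\<forall>x\<in>carrier E. \<rho> (J x) = (\<lambda>\<phi>. if \<phi> \<in> carrier (dual E) then \<phi> x else 0)"
    by (rule canonical_embedding[OF E F \<rho>])
  have J_mem: "J x \<in> carrier F" if "x \<in> carrier E" for x
    using J(1) that by (auto simp: bounded_linear_on_def linear_on_def)
  have qJ: "?q (J x) = p x" if x: "x \<in> carrier E" for x
  proof -
    have "bidual_ext E (map (\<lambda>x \<phi>. if \<phi> \<in> carrier (dual E) then \<phi> x else 0) (replicate n x)) A = A (replicate n x)"
      using C x by (intro bidual_ext_evaluation[OF E]) (auto simp: set_replicate_conv_if)
    then show ?thesis using AB[OF J_mem[OF x]] bspec[OF J(3) x] A(2)[OF x] by simp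
  qed
  have cp: "cont_polynomial n E p" using p by (simp add: tensor_dual_def)
  have lower: "norm (lin_functional n E p z) \<le> tensor_dual_norm n \<alpha> F ?q * \<alpha> E z" if z: "z \<in> sym_tensors n E" for z
  proof -
    obtain r where r: "represents n E r z" by (rule sym_tensors_represents[OF z])
    have "linear_on E F J" using J(1) by (simp add: bounded_linear_on_def)
    note rJ = tensor_map_represents[OF E this r]
    have "lin_functional n F ?q (tensor_map n F J z) = (\<Sum>(c, x)\<leftarrow>r. c * ?q (J x))"
      unfolding lin_functional_represents[OF q rJ] by (simp add: o_def split_def)
    also have "\<dots> = (\<Sum>(c, x)\<leftarrow>r. c * p x)"
      using r qJ by (intro arg_cong[where f = sum_list] map_cong) (auto simp: represents_def image_subset_iff)
    also have "\<dots> = lin_functional n E p z" using lin_functional_represents[OF cp r] by simp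
    finally have "norm (lin_functional n E p z) \<le> tensor_dual_norm n \<alpha> F ?q * \<alpha> F (tensor_map n F J z)"
      using tensor_dual_norm_bound[OF \<alpha> F qI(1) tensor_map_norm(1)[OF \<alpha> E F J(1,2) z]] by simp
    also have "\<dots> \<le> tensor_dual_norm n \<alpha> F ?q * \<alpha> E z"
      using tensor_map_norm(2)[OF \<alpha> E F J(1,2) z] tensor_dual_norm_nonneg[OF \<alpha> F qI(1)]
      by (intro mult_left_mono) auto
    finally show ?thesis .
  qed
  have "?N \<le> tensor_dual_norm n \<alpha> F ?q"
    by (rule tensor_dual_normI(2)[OF \<alpha> E cp lower tensor_dual_norm_nonneg[OF \<alpha> F qI(1)]])
  then show ?thesis using qI by auto
qed

end
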